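(* Let $r\ge 0$ be an integer and let $u\in H^r(a,b)$ be given. For any degree $p\ge 0$, knot sequence $\Xi$ and smoothness $-1\leq k\leq p-1$, let $Q_p^{q,k}$ be the projector onto $\mathcal{S}^{k}_{p,\Xi}$ defined in the context, for $q=0,\ldots,\min\{k+1,r\}$. Then, for any $\ell=0,\ldots,q$, we have $$\|\partial^{\ell}(u-Q^{q,k}_pu)\| \leq c_{p-q,k-q,q-\ell}\, c_{p-q,k-q,r-q}\, h^{r-\ell}\,\|\partial^ru\|,$$ for all $p\geq \max\{r-1,2q-\ell-1\}$.
   Context: Let $a<b$ be real; $\|\cdot\|$ is the norm of $L^2(a,b)$, $\partial$ the (weak) derivative, $H^r(a,b)=\{u\in L^2(a,b):\partial^\alpha u\in L^2(a,b),\ \alpha=1,\ldots,r\}$, $H^0(a,b)=L^2(a,b)$; for $u\in H^1(a,b)$ point values are those of the continuous representative. $\mathcal{P}_p$ is the space of polynomials of degree at most $p$. A knot sequence is $\Xi=(\xi_0,\ldots,\xi_{N+1})$ with $a=\xi_0<\xi_1<\cdots<\xi_N<\xi_{N+1}=b$; $h:=\max_{j=0,\ldots,N}(\xi_{j+1}-\xi_j)$; $I_j:=[\xi_j,\xi_{j+1})$ for $j=0,\ldots,N-1$ and $I_N:=[\xi_N,\xi_{N+1}]$. For $k\ge0$, $C^k[a,b]$ is the usual space of functions with continuous derivatives of order $0,\ldots,k$; $C^{-1}[a,b]$ is the space of bounded, piecewise continuous functions on $[a,b]$ that are discontinuous only at finitely many points. For $-1\le k\le p-1$, $$\mathcal{S}^k_{p,\Xi}:=\{s\in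 C^k[a,b]: s|_{I_j}\in\mathcal{P}_p,\ j=0,\ldots,N\}.$$ $S_p^k$ is the $L^2(a,b)$-orthogonal projector onto $\mathcal{S}^k_{p,\Xi}$. With $(Kf)(x)=\int_a^xf(y)\,dy$, the projectors $Q_p^{q,k}:H^q(a,b)\to\mathcal{S}^k_{p,\Xi}$, $q=0,\ldots,k+1$, are defined recursively by $Q_p^{0,k}:=S_p^k$ and, for $q\ge1$, $Q_p^{q,k}u:=u(a)+KQ_{p-1}^{q-1,k-1}\partial u$. The constants $c_{p,k,r}$ are defined for $p\ge r-1$, $-1\le k\le p-1$, as follows: $c_{p,p-1,r}:=(1/\pi)^r$ if $k=p-1$; and if $k\le p-2$, $$c_{p,k,r}:=\left(\frac12\right)^r\begin{cases}\left(\dfrac{1}{\sqrt{(p-k)(p-k+1)}}\right)^r,& k\ge r-2,\\[2mm] \left(\dfrac{1}{\sqrt{(p-k)(p-k+1)}}\right)^{k+1}\sqrt{\dfrac{(p+1-r)!}{(p-1+r-2k)!}},& k<r-2.\end{cases}$$ *)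

theory Defs
  imports "HOL-Analysis.Analysis" "HOL-Computational_Algebra.Polynomial"
begin

text \<open>
  Elements of \<open>L\<^sup>2(a,b)\<close> are represented by functions on the reals of which only the values almost
  everywhere on \<open>(a,b)\<close> matter. Operators on \<open>L\<^sup>2(a,b)\<close> and on Sobolev spaces therefore return
  a chosen representative (\<open>SOME\<close>), which is determined up to a null set.
\<close>

definition L2_space :: "real \<Rightarrow> real \<Rightarrow> (real \<Rightarrow> real) set" where
  "L2_space a b = {f. f \<in> borel_measurable (lebesgue_on {a<..<b}) \<and>
                      integrable (lebesgue_on {a<..<b}) (\<lambda>x. (f x)\<^sup>2)}"

definition L2_inner :: "real \<Rightarrow> real \<Rightarrow> (real \<Rightarrow> real) \<Rightarrow> (real \<Rightarrow> real) \<Rightarrow> real" where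
  "L2_inner a b f g = (LINT x|lebesgue_on {a<..<b}. f x * g x)"

definition L2_norm :: "real \<Rightarrow> real \<Rightarrow> (real \<Rightarrow> real) \<Rightarrow> real" where
  "L2_norm a b f = sqrt (L2_inner a b f f)"

definition test_functions :: "real \<Rightarrow> real \<Rightarrow> (real \<Rightarrow> real) set" where
  "test_functions a b =
     {\<phi>. (\<forall>n x. (deriv ^^ n) \<phi> differentiable (at x)) \<and>
         (\<exists>c d. a < c \<and> c < d \<and> d < b \<and> (\<forall>x. x \<notin> {c..d} \<longrightarrow> \<phi> x = 0))}"

definition locally_integrable :: "real \<Rightarrow> real \<Rightarrow> (real \<Rightarrow> real) \<Rightarrow> bool" where
  "locally_integrable a b f \<longleftrightarrow>
     (\<forall>c d. a < c \<and> c < d \<and> d < b \<longrightarrow> integrable (lebesgue_on {c..d}) f)"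

definition is_weak_deriv ::
  "real \<Rightarrow> real \<Rightarrow> nat \<Rightarrow> (real \<Rightarrow> real) \<Rightarrow> (real \<Rightarrow> real) \<Rightarrow> bool" where
  "is_weak_deriv a b n u v \<longleftrightarrow>
     locally_integrable a b u \<and> locally_integrable a b v \<and>
     (\<forall>\<phi>\<in>test_functions a b.
        (LINT x|lebesgue_on {a<..<b}. u x * (deriv ^^ n) \<phi> x) =
        (-1) ^ n * (LINT x|lebesgue_on {a<..<b}. v x * \<phi> x))"

definition weak_deriv :: "real \<Rightarrow> real \<Rightarrow> nat \<Rightarrow> (real \<Rightarrow> real) \<Rightarrow> real \<Rightarrow> real" where
  "weak_deriv a b n u = (SOME v. is_weak_deriv a b n u v)"

definition sobolev :: "real \<Rightarrow> real \<Rightarrow> nat \<Rightarrow> (real \<Rightarrow> real) set" where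
  "sobolev a b r =
     {u \<in> L2_space a b. \<forall>n\<in>{1..r}. \<exists>v\<in>L2_space a b. is_weak_deriv a b n u v}"

definition cont_rep :: "real \<Rightarrow> real \<Rightarrow> (real \<Rightarrow> real) \<Rightarrow> real \<Rightarrow> real" where
  "cont_rep a b u =
     (SOME g. continuous_on {a..b} g \<and> (AE x in lebesgue_on {a<..<b}. u x = g x))"

definition knot_seq :: "real \<Rightarrow> real \<Rightarrow> nat \<Rightarrow> (nat \<Rightarrow> real) \<Rightarrow> bool" where
  "knot_seq a b N \<xi> \<longleftrightarrow> \<xi> 0 = a \<and> \<xi> (N + 1) = b \<and> (\<forall>j\<le>N. \<xi> j < \<xi> (j + 1))"

definition mesh_size :: "nat \<Rightarrow> (nat \<Rightarrow> real) \<Rightarrow> real" where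
  "mesh_size N \<xi> = Max ((\<lambda>j. \<xi> (j + 1) - \<xi> j) ` {0..N})"

definition knot_interval :: "nat \<Rightarrow> (nat \<Rightarrow> real) \<Rightarrow> nat \<Rightarrow> real set" where
  "knot_interval N \<xi> j = (if j < N then {\<xi> j..<\<xi> (j + 1)} else {\<xi> j..\<xi> (j + 1)})"

definition piecewise_cont :: "real \<Rightarrow> real \<Rightarrow> (real \<Rightarrow> real) \<Rightarrow> bool" where
  "piecewise_cont a b f \<longleftrightarrow>
     finite {x \<in> {a..b}. \<not> continuous (at x within {a..b}) f} \<and>
     (\<forall>x\<in>{a<..b}. \<exists>y. (f \<longlongrightarrow> y) (at_left x)) \<and>
     (\<forall>x\<in>{a..<b}. \<exists>y. (f \<longlongrightarrow> y) (at_right x))"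

definition C_space :: "int \<Rightarrow> real \<Rightarrow> real \<Rightarrow> (real \<Rightarrow> real) set" where
  "C_space k a b =
     (if k = -1 then {f. bounded (f ` {a..b}) \<and> piecewise_cont a b f}
      else {f. \<exists>D. (\<forall>x\<in>{a..b}. D 0 x = f x) \<and>
                   (\<forall>i<nat k. \<forall>x\<in>{a..b}.
                      (D i has_real_derivative D (Suc i) x) (at x within {a..b})) \<and>
                   (\<forall>i\<le>nat k. continuous_on {a..b} (D i))})"

definition spline_space ::
  "real \<Rightarrow> real \<Rightarrow> nat \<Rightarrow> (nat \<Rightarrow> real) \<Rightarrow> nat \<Rightarrow> int \<Rightarrow> (real \<Rightarrow> real) set" where
  "spline_space a b N \<xi> p k =
     {s \<in> C_space k a b.
        \<forall>j\<in>{0..N}. \<exists>P :: real poly. degree P \<le> p \<and> (\<forall>x\<in>knot_interval N \<xi> j. s x = poly P x)}"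

definition spline_proj ::
  "real \<Rightarrow> real \<Rightarrow> nat \<Rightarrow> (nat \<Rightarrow> real) \<Rightarrow> nat \<Rightarrow> int \<Rightarrow> (real \<Rightarrow> real) \<Rightarrow> real \<Rightarrow> real" where
  "spline_proj a b N \<xi> p k u =
     (SOME s. s \<in> spline_space a b N \<xi> p k \<and>
              (\<forall>v\<in>spline_space a b N \<xi> p k. L2_inner a b (\<lambda>x. u x - s x) v = 0))"

definition K_op :: "real \<Rightarrow> (real \<Rightarrow> real) \<Rightarrow> real \<Rightarrow> real" where
  "K_op a f x = (LINT y|lebesgue_on {a..x}. f y)"

text \<open>
  The truncated subtraction \<open>p - 1\<close> below is harmless: \<open>q \<le> k + 1 \<le> p\<close> for all admissible indices.
\<close>

primrec Q_proj ::
  "real \<Rightarrow> real \<Rightarrow> nat \<Rightarrow> (nat \<Rightarrow> real) \<Rightarrow> nat \<Rightarrow> nat \<Rightarrow> int \<Rightarrow> (real \<Rightarrow> real) \<Rightarrow> real \<Rightarrow> real" where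
  "Q_proj a b N \<xi> 0 p k u = spline_proj a b N \<xi> p k u"
| "Q_proj a b N \<xi> (Suc q) p k u =
     (\<lambda>x. cont_rep a b u a + K_op a (Q_proj a b N \<xi> q (p - 1) (k - 1) (weak_deriv a b 1 u)) x)"

text \<open>Only meaningful for \<open>p \<ge> r - 1\<close> and \<open>-1 \<le> k \<le> p - 1\<close>; then nothing is truncated.\<close>

definition spline_const :: "nat \<Rightarrow> int \<Rightarrow> nat \<Rightarrow> real" where
  "spline_const p k r =
     (if k = int p - 1 then (1 / pi) ^ r
      else (1 / 2) ^ r *
        (let t = 1 / sqrt (real_of_int ((int p - k) * (int p - k + 1))) in
         if k \<ge> int r - 2 then t ^ r
         else t ^ nat (k + 1) *
              sqrt (fact (p + 1 - r) / fact (nat (int p - 1 + int r - 2 * k)))))"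

end

theory Submission
  imports Defs "HOL-Real_Asymp.Real_Asymp"
begin

text \<open>
  Everything is reduced to dual bounds \<open>\<parallel>K\<^sup>m g\<parallel> \<le> c\<^bsub>p,k,m\<^esub> h\<^sup>m \<parallel>g\<parallel>\<close> for \<open>g\<close> orthogonal to the spline space
  \<open>S\<^bsub>p,k\<^esub>\<close> (degree \<open>p\<close>, smoothness \<open>k\<close>) and \<open>m \<le> p + 1\<close>. With \<open>g = \<partial>\<^sup>q u - S\<^bsub>p-q,k-q\<^esub> \<partial>\<^sup>q u\<close> the error satisfies
  \<open>\<partial>\<^sup>l (u - Q u) = K\<^bsup>q-l\<^esup> g\<close>, and \<open>\<parallel>g\<parallel>\<^sup>2 = \<langle>g, \<partial>\<^sup>q u\<rangle> = \<plusminus>\<langle>K\<^bsup>r-q\<^esup> g, \<partial>\<^sup>r u\<rangle>\<close>, so the dual bound is used once with \<open>m = q - l\<close>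
  and once with \<open>m = r - q\<close>.

  If \<open>g\<close> is orthogonal to \<open>S\<^bsub>p,k\<^esub>\<close> with \<open>k \<ge> 0\<close>, then \<open>K g\<close> is orthogonal to \<open>S\<^bsub>p-1,k-1\<^esub>\<close> and
  \<open>\<parallel>K g\<parallel>\<^sup>2 = -\<langle>g, K (K g)\<rangle>\<close>; hence the constant for \<open>m = 1\<close> passes from \<open>(p-1, k-1)\<close> to \<open>(p, k)\<close>, and an
  induction on \<open>k\<close> leaves the discontinuous case \<open>k = -1\<close>. There, duality once more reduces the bound to the
  approximation of a polynomial by a polynomial of degree \<open>p\<close> on a single knot interval: Wirtinger's inequality
  for \<open>p = 0\<close> and the Legendre expansion for \<open>p \<ge> 1\<close>.
\<close>

section \<open>Polynomial approximation on an interval\<close>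

text \<open>The constants have two sources. On a single interval the forms
  \<open>legendre_form c d r\<close> are all diagonal in the Legendre polynomials, with eigenvalue
  (n+r)!/(n-r)! in degree n \<ge> r. Approximation in degree p removes the degrees up to p, so n =
  p+1 is the worst one left. Under the passage from (p-1, k-1) to (p, k) the difference p-k is
  preserved, so each of at most k+1 such steps costs the same first-order factor c_{p-k-1,-1,1};
  integrations beyond the (k+1)-st are estimated at once in the discontinuous space of degree p-k-1.
  This explains the two branches of \<open>spline_const\<close>.

  The descent in k works because K maps the smaller spline space into the larger one and constants
  are splines. At k = -1 it has nowhere to go, but there the pieces are independent of each other,
  so interval-by-interval approximation is possible.

  The conditions on p say that both orders, q-l and r-q, are at most (p-q)+1: orthogonality to
  polynomials of degree p-q removes the boundary terms of that many integrations.\<close>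

definition poly_int :: "real \<Rightarrow> real \<Rightarrow> real poly \<Rightarrow> real" where
  "poly_int c d P = integral {c..d} (poly P)"

lemma poly_integrable: "(poly (P :: real poly)) integrable_on {c..d}"
  by (intro integrable_continuous_interval continuous_intros)

lemma poly_int_add: "poly_int c d (P + Q) = poly_int c d P + poly_int c d Q"
  unfolding poly_int_def by (simp add: poly_integrable integral_add poly_add [abs_def])

lemma poly_int_smult: "poly_int c d (smult k P) = k * poly_int c d P"
  unfolding poly_int_def by (simp add: poly_smult [abs_def])

lemma poly_int_minus: "poly_int c d (- P) = - poly_int c d P"
  using poly_int_smult[of c d "-1" P] by simp

lemma poly_int_0 [simp]: "poly_int c d 0 = 0"
  using poly_int_smult[of c d 0 0] by simp

lemma poly_int_mono:
  "(\<And>x. c \<le> x \<Longrightarrow> x \<le> d \<Longrightarrow> poly P x \<le> poly Q x) \<Longrightarrow> poly_int c d P \<le> poly_int c d Q"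
  unfolding poly_int_def by (intro integral_le poly_integrable) auto

lemma poly_int_square_nonneg: "0 \<le> poly_int c d (P * P)"
  using poly_int_mono[of c d 0 "P * P"] by simp

lemma poly_int_pderiv: "c \<le> d \<Longrightarrow> poly_int c d (pderiv P) = poly P d - poly P c"
  unfolding poly_int_def
  by (intro integral_unique fundamental_theorem_of_calculus)
     (auto simp: has_real_derivative_iff_has_vector_derivative[symmetric]
           intro!: DERIV_subset[OF poly_DERIV])

lemma poly_int_by_parts:
  assumes "c \<le> d" "poly (P * Q) c = 0" "poly (P * Q) d = 0"
  shows "poly_int c d (P * pderiv Q) = - poly_int c d (pderiv P * Q)"
proof -
  have "poly_int c d (pderiv (P * Q)) = 0"
    unfolding poly_int_pderiv[OF assms(1)] assms(2,3) by simp
  then show ?thesis by (simp add: pderiv_mult poly_int_add algebra_simps)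
qed

lemma poly_antiderivative:
  fixes P :: "real poly"
  obtains Q where "pderiv Q = P" "poly Q c = 0" "degree Q \<le> Suc (degree P)"
proof -
  define R where "R = (\<Sum>i\<le>degree P. monom (coeff P i / real (Suc i)) (Suc i))"
  have "pderiv R = (\<Sum>i\<le>degree P. monom (coeff P i) i)"
    unfolding R_def by (simp add: higher_pderiv_sum[of 1, simplified] pderiv_monom del: of_nat_Suc)
  also have "\<dots> = P" by (rule poly_as_sum_of_monoms)
  finally have R: "pderiv R = P" .
  have "degree R \<le> Suc (degree P)"
    using degree_pderiv[of R] unfolding R(1) by (cases "degree R") auto
  then have "degree (R - [:poly R c:]) \<le> Suc (degree P)"
    by (intro degree_diff_le) auto
  then show ?thesis using R by (intro that[of "R - [:poly R c:]"]) (auto simp: pderiv_diff pderiv_pCons)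
qed

section \<open>Wirtinger and Poincare inequalities for polynomials\<close>

lemma DERIV_cot_affine:
  fixes \<kappa> e c x :: real
  defines "\<phi> \<equiv> \<lambda>x. \<kappa> * cot (\<kappa> * (x - c + e))"
  assumes "sin (\<kappa> * (x - c + e)) \<noteq> 0"
  shows "(\<phi> has_real_derivative - \<kappa>\<^sup>2 - (\<phi> x)\<^sup>2) (at x)"
proof -
  let ?s = "sin (\<kappa> * (x - c + e))" and ?c = "cos (\<kappa> * (x - c + e))"
  have "(\<phi> has_real_derivative - (\<kappa>\<^sup>2 / ?s\<^sup>2)) (at x)"
    unfolding \<phi>_def using assms(2)
    by (auto intro!: derivative_eq_intros DERIV_cot[THEN DERIV_chain2] simp: power2_eq_square inverse_eq_divide)
  \<comment> \<open>With sin^2 + cos^2 = 1 the derivative of \<phi> becomes the Riccati equation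
    \<phi>' = -\<kappa>^2 - \<phi>^2, which is what makes the square (G' - \<phi> G)^2 complete
    without remainder.\<close>
  moreover have "\<kappa>\<^sup>2 + (\<phi> x)\<^sup>2 = \<kappa>\<^sup>2 * (?s\<^sup>2 + ?c\<^sup>2) / ?s\<^sup>2"
    using assms(2) unfolding \<phi>_def cot_def distrib_left add_divide_distrib power_mult_distrib power_divide
    by simp
  then have "- (\<kappa>\<^sup>2 / ?s\<^sup>2) = - \<kappa>\<^sup>2 - (\<phi> x)\<^sup>2" by simp
  ultimately show ?thesis by (simp only:)
qed

text \<open>
  Completing the square: with \<open>\<phi> = \<kappa> cot\<close> one has \<open>G'\<^sup>2 - \<kappa>\<^sup>2 G\<^sup>2 = (G' - \<phi> G)\<^sup>2 + (\<phi> G\<^sup>2)'\<close>. The interval is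
  enlarged by \<open>e\<close> on both sides so that \<open>\<phi>\<close> is smooth up to the end points.
\<close>

lemma wirtinger_enlarged:
  fixes G :: "real poly"
  assumes "c < d" "poly G c = 0" "poly G d = 0" "e > 0"
  shows "poly_int c d (G * G) \<le> ((d - c + 2 * e) / pi)\<^sup>2 * poly_int c d (pderiv G * pderiv G)"
proof -
  \<comment> \<open>The length of the enlarged interval times \<kappa> is pi, so on [c, d] the
    argument of sin stays strictly inside (0, pi).\<close>
  define \<kappa> where "\<kappa> = pi / (d - c + 2 * e)"
  define \<phi> where "\<phi> = (\<lambda>x. \<kappa> * cot (\<kappa> * (x - c + e)))"
  have \<kappa>: "\<kappa> > 0" using assms by (simp add: \<kappa>_def)
  have sin: "sin (\<kappa> * (x - c + e)) \<noteq> 0" if "c \<le> x" "x \<le> d" for x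
  proof -
    have "0 < \<kappa> * (x - c + e)" using \<kappa> that assms by simp
    moreover have "\<kappa> * (x - c + e) < \<kappa> * (d - c + 2 * e)"
      using \<kappa> that assms by (intro mult_strict_left_mono) auto
    moreover have "\<kappa> * (d - c + 2 * e) = pi" using assms by (simp add: \<kappa>_def)
    ultimately show ?thesis using sin_gt_zero[of "\<kappa> * (x - c + e)"] by linarith
  qed
  let ?g = "\<lambda>x. poly G x" and ?g' = "\<lambda>x. poly (pderiv G) x"
  let ?h = "\<lambda>x. (- \<kappa>\<^sup>2 - (\<phi> x)\<^sup>2) * (?g x)\<^sup>2 + \<phi> x * (2 * ?g x * ?g' x)"
  have \<phi>': "(\<phi> has_real_derivative - \<kappa>\<^sup>2 - (\<phi> x)\<^sup>2) (at x)" if "c \<le> x" "x \<le> d" for x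
    unfolding \<phi>_def using DERIV_cot_affine sin[OF that] .
  have "((\<lambda>x. \<phi> x * (?g x)\<^sup>2) has_real_derivative ?h x) (at x within {c..d})" if "c \<le> x" "x \<le> d" for x
  proof (rule has_field_derivative_at_within)
    have "((\<lambda>x. ?g x * ?g x) has_real_derivative ?g' x * ?g x + ?g' x * ?g x) (at x)"
      by (intro DERIV_mult poly_DERIV)
    from DERIV_mult[OF \<phi>'[OF that] this]
    show "((\<lambda>x. \<phi> x * (?g x)\<^sup>2) has_real_derivative ?h x) (at x)"
      unfolding power2_eq_square by (rule DERIV_cong) (simp add: algebra_simps)
  qed
  then have "(?h has_integral \<phi> d * (?g d)\<^sup>2 - \<phi> c * (?g c)\<^sup>2) {c..d}"
    using assms by (intro fundamental_theorem_of_calculus)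
     (auto simp: has_real_derivative_iff_has_vector_derivative[symmetric])
  then have h: "(?h has_integral 0) {c..d}" using assms by simp
  have g: "((\<lambda>x. ?g x * ?g x) has_integral poly_int c d (G * G)) {c..d}"
    "((\<lambda>x. ?g' x * ?g' x) has_integral poly_int c d (pderiv G * pderiv G)) {c..d}"
    using integrable_integral[OF poly_integrable, of "G * G" c d]
      integrable_integral[OF poly_integrable, of "pderiv G * pderiv G" c d]
    unfolding poly_int_def poly_mult[abs_def] by this+
  have int: "((\<lambda>x. ?h x + \<kappa>\<^sup>2 * (?g x * ?g x)) has_integral 0 + \<kappa>\<^sup>2 * poly_int c d (G * G)) {c..d}"
    by (intro has_integral_add h has_integral_mult_right g)
  have "?h x + \<kappa>\<^sup>2 * (?g x * ?g x) \<le> ?g' x * ?g' x" for x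
    using zero_le_power2[of "?g' x - \<phi> x * ?g x"] by (simp add: power2_eq_square algebra_simps)
  then have "0 + \<kappa>\<^sup>2 * poly_int c d (G * G) \<le> poly_int c d (pderiv G * pderiv G)"
    by (rule has_integral_le[OF int g(2)])
  then have "poly_int c d (G * G) \<le> (1 / \<kappa>)\<^sup>2 * poly_int c d (pderiv G * pderiv G)"
    using \<kappa> by (simp add: power_divide pos_le_divide_eq mult.commute)
  then show ?thesis by (simp add: \<kappa>_def)
qed

text \<open>For e = 0 the cotangent has poles at both end points, so this case is reached as the
  limit e \<rightarrow> 0+; only the constant on the right depends on e.\<close>

lemma wirtinger_Dirichlet:
  fixes G :: "real poly"
  assumes "c < d" "poly G c = 0" "poly G d = 0"
  shows "poly_int c d (G * G) \<le> ((d - c) / pi)\<^sup>2 * poly_int c d (pderiv G * pderiv G)"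
proof -
  have "((\<lambda>e. ((d - c + 2 * e) / pi)\<^sup>2 * poly_int c d (pderiv G * pderiv G)) \<longlongrightarrow>
     ((d - c + 2 * 0) / pi)\<^sup>2 * poly_int c d (pderiv G * pderiv G)) (at_right 0)"
    by (intro tendsto_intros) auto
  moreover have "eventually (\<lambda>e. poly_int c d (G * G) \<le>
      ((d - c + 2 * e) / pi)\<^sup>2 * poly_int c d (pderiv G * pderiv G)) (at_right 0)"
    using wirtinger_enlarged[OF assms] by (auto simp: eventually_at_right[of 0 1] intro!: exI[of _ 1])
  ultimately show ?thesis by (intro tendsto_lowerbound) auto
qed

text \<open>Duality with the Dirichlet case through an antiderivative of \<open>U - z\<close>.\<close>

lemma poincare_mean_zero:
  fixes U :: "real poly"
  assumes "c < d"
  shows "\<exists>z. poly_int c d ((U - [:z:]) * (U - [:z:])) \<le> ((d - c) / pi)\<^sup>2 * poly_int c d (pderiv U * pderiv U)"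
proof -
  obtain R where R: "pderiv R = U" "poly R c = 0" using poly_antiderivative by blast
  \<comment> \<open>z is the mean of U on [c, d]; the primitive Q of U - z then vanishes at d as
    well as at c.\<close>
  define z where "z = poly R d / (d - c)"
  define V Q where "V = U - [:z:]" and "Q = R - [:- c * z, z:]"
  define \<kappa> where "\<kappa> = (d - c) / pi"
  have \<kappa>: "\<kappa> > 0" using assms by (simp add: \<kappa>_def)
  have Q: "pderiv Q = V" "poly Q c = 0" "poly Q d = 0"
  proof -
    have "z * (d - c) = poly R d" using assms by (simp add: z_def)
    then show "poly Q d = 0" by (simp add: Q_def algebra_simps)
  qed (use R in \<open>simp_all add: Q_def V_def pderiv_diff pderiv_pCons\<close>)
  have U': "pderiv U = pderiv V" by (simp add: V_def pderiv_diff pderiv_pCons)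
  have "poly_int c d (V * V) = - poly_int c d (pderiv V * Q)"
    using poly_int_by_parts[of c d V Q] Q assms by simp
  \<comment> \<open>Weighted AM-GM. With the weight \<kappa>^2, Wirtinger's inequality bounds the Q
    term by one copy of the integral of V^2, which is absorbed by the two copies on the
    left.\<close>
  moreover have "poly_int c d (smult (-2) (pderiv V * Q)) \<le>
      poly_int c d (smult (\<kappa>\<^sup>2) (pderiv V * pderiv V) + smult (1 / \<kappa>\<^sup>2) (Q * Q))"
  proof (rule poly_int_mono)
    fix x
    show "poly (smult (-2) (pderiv V * Q)) x \<le>
        poly (smult (\<kappa>\<^sup>2) (pderiv V * pderiv V) + smult (1 / \<kappa>\<^sup>2) (Q * Q)) x"
      using zero_le_power2[of "\<kappa> * poly (pderiv V) x + poly Q x / \<kappa>"] \<kappa>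
      by (simp add: power2_eq_square field_simps)
  qed
  moreover have "poly_int c d (Q * Q) \<le> \<kappa>\<^sup>2 * poly_int c d (V * V)"
    using wirtinger_Dirichlet[OF assms Q(2,3)] by (simp add: Q \<kappa>_def)
  then have "(1 / \<kappa>\<^sup>2) * poly_int c d (Q * Q) \<le> poly_int c d (V * V)"
    using \<kappa> by (simp add: field_simps)
  ultimately have "poly_int c d (V * V) \<le> \<kappa>\<^sup>2 * poly_int c d (pderiv V * pderiv V)"
    unfolding poly_int_add poly_int_smult by linarith
  then show ?thesis unfolding V_def[symmetric] U' \<kappa>_def[symmetric]  using V_def by blast
qed

section \<open>Legendre polynomials and their weighted forms\<close>

lemma poly_ext: "(\<And>x. poly p x = poly q x) \<Longrightarrow> p = (q :: real poly)"
  by (simp add: poly_eq_poly_eq_iff[symmetric] fun_eq_iff del: poly_eq_poly_eq_iff)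

text \<open>Its zeros at c and d remove the boundary terms from the integrations by parts
  below.\<close>

definition bubble :: "real \<Rightarrow> real \<Rightarrow> real poly" where
  "bubble c d = [:- c * d, c + d, -1:]"

lemma poly_bubble: "poly (bubble c d) x = (x - c) * (d - x)"
  by (simp add: bubble_def algebra_simps)

text \<open>The unnormalised Legendre polynomial of \<open>[c, d]\<close>, by Rodrigues' formula.\<close>

definition legendre :: "real \<Rightarrow> real \<Rightarrow> nat \<Rightarrow> real poly" where
  "legendre c d n = (pderiv ^^ n) (bubble c d ^ n)"

text \<open>The chain rule, multiplied by \<open>bubble c d\<close>: the extra factor turns the
  exponent n - 1 back into n, so n = 0 is no exception. Differentiating this first-order equation
  gives the Legendre equations.\<close>

lemma pderiv_bubble_power: "bubble c d * pderiv (bubble c d ^ n) = smult (real n) (pderiv (bubble c d) * bubble c d ^ n)"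
proof (cases n)
  case (Suc k)
  show ?thesis unfolding Suc pderiv_power_Suc by (simp add: ac_simps del: of_nat_Suc)
qed simp

lemma pderiv2_bubble: "pderiv (pderiv (bubble c d)) = [:-2:]"
  by (simp add: bubble_def pderiv_pCons)

text \<open>This is \<open>pderiv_bubble_power\<close> differentiated m + 1 times. Three terms
  suffice since W'' = -2 is constant.\<close>

lemma bubble_power_ode:
  fixes c d :: real and n m :: nat
  defines "W \<equiv> bubble c d"
  shows "W * (pderiv ^^ (m + 2)) (W ^ n) + smult (real m + 1 - real n) (pderiv W * (pderiv ^^ (m + 1)) (W ^ n))
     + smult ((real m + 1) * (2 * real n - real m)) ((pderiv ^^ m) (W ^ n)) = 0"
proof (induction m)
  case 0
  have "pderiv (W * pderiv (W ^ n)) = pderiv (smult (real n) (pderiv W * W ^ n))"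
    by (simp only: W_def pderiv_bubble_power)
  then have "W * pderiv (pderiv (W ^ n)) + pderiv W * pderiv (W ^ n)
      = smult (real n) (pderiv W * pderiv (W ^ n) + [:-2:] * W ^ n)"
    by (simp only: pderiv_mult pderiv_smult pderiv2_bubble W_def) (simp add: algebra_simps)
  then have "poly (W * pderiv (pderiv (W ^ n)) + pderiv W * pderiv (W ^ n)) x
      = poly (smult (real n) (pderiv W * pderiv (W ^ n) + [:-2:] * W ^ n)) x" for x by simp
  then show ?case
    by (intro poly_ext) (simp add: numeral_2_eq_2 algebra_simps)
next
  case (Suc m)
  let ?D = "\<lambda>i. (pderiv ^^ i) (W ^ n)"
  have "pderiv (W * ?D (m + 2) + smult (real m + 1 - real n) (pderiv W * ?D (m + 1))
     + smult ((real m + 1) * (2 * real n - real m)) (?D m)) = 0"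
    using Suc by simp
  then have "pderiv W * ?D (m + 2) + W * ?D (m + 3)
     + smult (real m + 1 - real n) ([:-2:] * ?D (m + 1) + pderiv W * ?D (m + 2))
     + smult ((real m + 1) * (2 * real n - real m)) (?D (m + 1)) = 0"
    by (simp add: pderiv_add pderiv_mult pderiv_smult numeral_3_eq_3 W_def pderiv2_bubble algebra_simps)
  then have "poly (pderiv W * ?D (m + 2) + W * ?D (m + 3)
     + smult (real m + 1 - real n) ([:-2:] * ?D (m + 1) + pderiv W * ?D (m + 2))
     + smult ((real m + 1) * (2 * real n - real m)) (?D (m + 1))) x = 0" for x by simp
  then show ?case
    by (intro poly_ext) (simp add: numeral_3_eq_3 algebra_simps)
qed

text \<open>Take m = n + j in the previous equation: the middle coefficient becomes j + 1, the
  factor that differentiation of \<open>W ^ Suc j\<close> produces, and the equation takes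
  self-adjoint form.\<close>

lemma legendre_ode:
  fixes c d :: real and n j :: nat
  defines "W \<equiv> bubble c d" and "P \<equiv> legendre c d n"
  shows "pderiv (W ^ Suc j * (pderiv ^^ Suc j) P)
     = smult (- ((real n + real j + 1) * (real n - real j))) (W ^ j * (pderiv ^^ j) P)"
proof -
  have D: "(pderiv ^^ i) P = (pderiv ^^ (n + i)) (W ^ n)" for i
    by (simp add: P_def legendre_def W_def funpow_add add.commute)
  have "W * (pderiv ^^ (j + 2)) P + smult (real j + 1) (pderiv W * (pderiv ^^ (j + 1)) P)
     + smult ((real n + real j + 1) * (real n - real j)) ((pderiv ^^ j) P) = 0"
    using bubble_power_ode[where m = "n + j" and n = n and c = c and d = d, folded W_def]
    unfolding D by (simp add: algebra_simps)
  then have "W ^ j * (W * (pderiv ^^ (j + 2)) P + smult (real j + 1) (pderiv W * (pderiv ^^ (j + 1)) P)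
     + smult ((real n + real j + 1) * (real n - real j)) ((pderiv ^^ j) P)) = 0"
    by simp
  moreover have "pderiv (W ^ Suc j * (pderiv ^^ Suc j) P)
     = W ^ j * (W * (pderiv ^^ (j + 2)) P + smult (real j + 1) (pderiv W * (pderiv ^^ (j + 1)) P))"
    unfolding pderiv_mult pderiv_power_Suc
    by (simp add: algebra_simps numeral_2_eq_2)
  ultimately show ?thesis by (simp add: distrib_left eq_neg_iff_add_eq_0)
qed

lemma legendre_degree:
  shows "degree (legendre c d n) = n" "legendre c d n \<noteq> 0"
proof -
  have W: "bubble c d \<noteq> 0" "degree (bubble c d) = 2" by (auto simp: bubble_def)
  have deg: "degree ((pderiv ^^ i) (bubble c d ^ n)) = 2 * n - i" for i
    by (induction i) (auto simp: degree_power_eq W degree_pderiv)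
  show 1: "degree (legendre c d n) = n" by (simp add: legendre_def deg)
  show "legendre c d n \<noteq> 0"
  proof (cases "n = 0")
    case True then show ?thesis by (simp add: legendre_def)
  next
    case False then show ?thesis using 1 by (metis degree_0)
  qed
qed

text \<open>For every r the same Legendre polynomials diagonalise this form, so it compares u
  directly with its r-th derivative.\<close>

definition legendre_form :: "real \<Rightarrow> real \<Rightarrow> nat \<Rightarrow> real poly \<Rightarrow> real poly \<Rightarrow> real" where
  "legendre_form c d r u v = poly_int c d (bubble c d ^ r * ((pderiv ^^ r) u * (pderiv ^^ r) v))"

definition legendre_eigenvalue :: "nat \<Rightarrow> nat \<Rightarrow> real" where
  "legendre_eigenvalue n r = (\<Prod>j<r. (real n + real j + 1) * (real n - real j))"

text \<open>Each induction step integrates by parts once: \<open>bubble c d ^ Suc j\<close> vanishes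
  at the end points, and the self-adjoint equation returns the form of order j with one more
  eigenvalue factor.\<close>

lemma legendre_form_eigen:
  assumes "c < d"
  shows "legendre_form c d r (legendre c d n) v
    = legendre_eigenvalue n r * poly_int c d (legendre c d n * v)"
proof (induction r)
  case 0 then show ?case by (simp add: legendre_form_def legendre_eigenvalue_def)
next
  case (Suc j)
  let ?W = "bubble c d" and ?P = "legendre c d n"
  have "legendre_form c d (Suc j) ?P v
      = poly_int c d ((?W ^ Suc j * (pderiv ^^ Suc j) ?P) * pderiv ((pderiv ^^ j) v))"
    by (simp add: legendre_form_def mult.assoc)
  also have "\<dots> = - poly_int c d (pderiv (?W ^ Suc j * (pderiv ^^ Suc j) ?P) * (pderiv ^^ j) v)"
    using assms by (intro poly_int_by_parts) (auto simp: poly_bubble)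
  also have "\<dots> = (real n + real j + 1) * (real n - real j) * legendre_form c d j ?P v"
    unfolding legendre_ode legendre_form_def by (simp add: poly_int_smult poly_int_minus mult.assoc)
  also have "\<dots> = legendre_eigenvalue n (Suc j) * poly_int c d (?P * v)"
    by (simp add: Suc legendre_eigenvalue_def)
  finally show ?case .
qed

lemma higher_pderiv_eq_0: "degree (v :: real poly) < n \<Longrightarrow> (pderiv ^^ n) v = 0"
proof (induction n arbitrary: v)
  case (Suc n)
  show ?case
  proof (cases "degree v = 0")
    case True
    then have "pderiv v = 0" by (simp add: pderiv_eq_0_iff)
    then show ?thesis by (simp add: funpow_Suc_right del: funpow.simps)
  next
    case False
    then have "degree (pderiv v) < n" using Suc by (simp add: degree_pderiv)
    then show ?thesis using Suc.IH by (simp add: funpow_Suc_right del: funpow.simps)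
  qed
qed simp

lemma legendre_eigenvalue_pos: "r \<le> n \<Longrightarrow> legendre_eigenvalue n r > 0"
  unfolding legendre_eigenvalue_def by (intro prod_pos) auto

lemma legendre_eigenvalue_mono:
  "r \<le> m \<Longrightarrow> m \<le> n \<Longrightarrow> legendre_eigenvalue m r \<le> legendre_eigenvalue n r"
  unfolding legendre_eigenvalue_def by (intro prod_mono conjI mult_mono) auto

text \<open>Take r = n: the n-th derivative of v is zero, while the eigenvalue of order n in degree
  n is positive.\<close>

lemma legendre_orthogonal:
  assumes "c < d" "degree v < n"
  shows "poly_int c d (legendre c d n * v) = 0"
proof -
  have "legendre_form c d n (legendre c d n) v = 0"
    using assms(2) by (simp add: legendre_form_def higher_pderiv_eq_0)
  then show ?thesis
    using legendre_form_eigen[OF assms(1)] legendre_eigenvalue_pos[of n n] by simp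
qed

lemma legendre_form_nonneg: "c < d \<Longrightarrow> 0 \<le> legendre_form c d r u u"
  unfolding legendre_form_def
  by (rule order_trans[OF _ poly_int_mono[of c d 0]]) (auto simp: poly_bubble)

text \<open>The weight is at most its midpoint value ((d - c)/2)^2. This is the origin of the factor
  (1/2)^r in \<open>spline_const\<close>.\<close>

lemma legendre_form_le:
  assumes "c < d"
  shows "legendre_form c d r u u \<le> (((d - c) / 2) ^ r)\<^sup>2 * poly_int c d ((pderiv ^^ r) u * (pderiv ^^ r) u)"
proof -
  have "poly_int c d (bubble c d ^ r * ((pderiv ^^ r) u * (pderiv ^^ r) u))
     \<le> poly_int c d (smult ((((d - c) / 2) ^ r)\<^sup>2) ((pderiv ^^ r) u * (pderiv ^^ r) u))"
  proof (rule poly_int_mono)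
    fix x assume x: "c \<le> x" "x \<le> d"
    have "(x - c) * (d - x) \<le> ((d - c) / 2)\<^sup>2"
      using zero_le_power2[of "x - (c + d) / 2"] by (simp add: power2_eq_square field_simps)
    then have "((x - c) * (d - x)) ^ r \<le> (((d - c) / 2)\<^sup>2) ^ r"
      using x by (intro power_mono) auto
    also have "\<dots> = (((d - c) / 2) ^ r)\<^sup>2" by (simp add: power_mult[symmetric] mult.commute)
    finally show "poly (bubble c d ^ r * ((pderiv ^^ r) u * (pderiv ^^ r) u)) x
        \<le> poly (smult ((((d - c) / 2) ^ r)\<^sup>2) ((pderiv ^^ r) u * (pderiv ^^ r) u)) x"
      by (simp add: poly_bubble mult_right_mono)
  qed
  then show ?thesis by (simp add: legendre_form_def poly_int_smult)
qed

lemma higher_pderiv_linear: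
  "(pderiv ^^ r) (smult k u + v) = smult k ((pderiv ^^ r) u) + (pderiv ^^ r) (v :: real poly)"
  by (simp add: higher_pderiv_add higher_pderiv_smult)

text \<open>Splits off the Legendre component of highest degree; the remainder is orthogonal to it for both forms.\<close>

lemma legendre_approximation:
  assumes "c < d" "r \<le> Suc p" "degree u \<le> n"
  shows "\<exists>z. degree z \<le> p \<and>
    legendre_eigenvalue (Suc p) r * poly_int c d ((u - z) * (u - z)) \<le> legendre_form c d r u u"
  using assms(3)
proof (induction n arbitrary: u rule: less_induct)
  case (less n)
  show ?case
  proof (cases "n \<le> p")
    case True
    then show ?thesis using less.prems legendre_form_nonneg[OF assms(1)] by (intro exI[of _ u]) auto
  next
    case False
    define P where "P = legendre c d n"
    have P: "degree P = n" "P \<noteq> 0" by (auto simp: P_def legendre_degree)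
    define k where "k = coeff u n / lead_coeff P"
    define v where "v = u - smult k P"
    have uv: "u = smult k P + v" by (simp add: v_def)
    have "coeff v n = 0" using P leading_coeff_0_iff[of P] by (simp add: v_def k_def)
    moreover have "degree v \<le> n" unfolding v_def using less.prems P by (intro degree_diff_le) auto
    ultimately have v: "degree v \<le> n - 1" "degree v < n"
      using False eq_zero_or_degree_less[of v n] by fastforce+
    from less.IH[OF _ v(1)] False obtain z where z: "degree z \<le> p"
      "legendre_eigenvalue (Suc p) r * poly_int c d ((v - z) * (v - z)) \<le> legendre_form c d r v v"
      by auto
    let ?I = "poly_int c d" and ?\<Lambda> = "legendre_eigenvalue"
    have orth: "?I (P * w) = 0" if "degree w < n" for w
      unfolding P_def using legendre_orthogonal[OF assms(1) that] .
    have deg: "degree (v - z) < n" using v z False by (intro le_less_trans[OF degree_diff_le[of v "n-1" z]]) auto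
    have "(u - z) * (u - z) = smult (k * k) (P * P) + smult (2 * k) (P * (v - z)) + (v - z) * (v - z)"
      unfolding uv by (intro poly_ext) (simp add: algebra_simps)
    then have "?I ((u - z) * (u - z)) = k * k * ?I (P * P) + ?I ((v - z) * (v - z))"
      using orth[OF deg] by (simp only: poly_int_add poly_int_smult)
    moreover have "bubble c d ^ r * ((pderiv ^^ r) u * (pderiv ^^ r) u)
       = smult (k * k) (bubble c d ^ r * ((pderiv ^^ r) P * (pderiv ^^ r) P))
       + smult (2 * k) (bubble c d ^ r * ((pderiv ^^ r) P * (pderiv ^^ r) v))
       + bubble c d ^ r * ((pderiv ^^ r) v * (pderiv ^^ r) v)"
      unfolding uv higher_pderiv_linear by (intro poly_ext) (simp add: algebra_simps)
    then have "legendre_form c d r u u = k * k * legendre_form c d r P P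
       + 2 * k * legendre_form c d r P v + legendre_form c d r v v"
      unfolding legendre_form_def by (simp only: poly_int_add poly_int_smult)
    then have "legendre_form c d r u u = k * k * (?\<Lambda> n r * ?I (P * P)) + legendre_form c d r v v"
      using orth[OF v(2)] by (simp add: legendre_form_eigen[OF assms(1), of r n, folded P_def])
    \<comment> \<open>Only degrees n > p are split off, and the eigenvalues grow with n, so that of
      degree p + 1 is the smallest.\<close>
    moreover have "?\<Lambda> (Suc p) r \<le> ?\<Lambda> n r"
      using False assms(2) by (intro legendre_eigenvalue_mono) auto
    then have "k * k * (?\<Lambda> (Suc p) r * ?I (P * P)) \<le> k * k * (?\<Lambda> n r * ?I (P * P))"
      by (intro mult_left_mono mult_right_mono poly_int_square_nonneg) auto
    ultimately show ?thesis using z by (intro exI[of _ z]) (simp add: algebra_simps)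
  qed
qed

lemma legendre_eigenvalue_fact:
  "r \<le> n \<Longrightarrow> legendre_eigenvalue n r = fact (n + r) / fact (n - r)"
proof (induction r)
  case (Suc r)
  have "n - r = Suc (n - Suc r)" using Suc.prems by simp
  then have "fact (n - r) = (real n - real r) * (fact (n - Suc r) :: real)"
    using Suc.prems by (simp add: of_nat_diff)
  moreover have "fact (n + Suc r) = (real n + real r + 1) * (fact (n + r) :: real)" by simp
  moreover have "legendre_eigenvalue n (Suc r)
      = fact (n + r) / fact (n - r) * ((real n + real r + 1) * (real n - real r))"
    using Suc by (simp add: legendre_eigenvalue_def)
  moreover have "real n - real r > 0" using Suc.prems by simp
  moreover have "x / (b * z) * (a * b) = a * x / z" if "b > 0" for x z a b :: real
    using that by simp
  ultimately show ?case by (simp only:)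
qed (simp add: legendre_eigenvalue_def)

lemma spline_const_nonneg: "0 \<le> spline_const p k r"
proof -
  \<comment> \<open>A product of two consecutive integers is nonnegative, whatever the sign of its
    factors.\<close>
  have "0 \<le> (int p - k) * (int p - k + 1)"
    by (cases "k \<le> int p") (auto intro: mult_nonneg_nonneg mult_nonpos_nonpos)
  then have "0 \<le> real_of_int ((int p - k) * (int p - k + 1))" by linarith
  then show ?thesis unfolding spline_const_def Let_def by (auto simp del: of_int_mult)
qed

text \<open>Degree 0 is the case k = p - 1 of \<open>spline_const\<close>, where 1/pi is required.
  The Legendre expansion would give only 1/(2 sqrt 2), so the Poincare inequality takes its
  place.\<close>

lemma poly_approximation:
  assumes "c < d" "m \<le> Suc p"
  shows "\<exists>z. degree z \<le> p \<and> poly_int c d ((U - z) * (U - z))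
     \<le> (spline_const p (-1) m * (d - c) ^ m)\<^sup>2 * poly_int c d ((pderiv ^^ m) U * (pderiv ^^ m) U)"
proof (cases "p = 0")
  case True
  show ?thesis
  proof (cases "m = 0")
    case True
    then show ?thesis by (intro exI[of _ 0]) (simp add: spline_const_def)
  next
    case False
    then have "m = 1" using assms True by simp
    obtain z where "poly_int c d ((U - [:z:]) * (U - [:z:]))
        \<le> ((d - c) / pi)\<^sup>2 * poly_int c d (pderiv U * pderiv U)"
      using poincare_mean_zero[OF assms(1), of U] by blast
    then show ?thesis using \<open>m = 1\<close> True
      by (intro exI[of _ "[:z:]"]) (simp add: spline_const_def)
  qed
next
  case False
  define \<Lambda> where "\<Lambda> = legendre_eigenvalue (Suc p) m"
  have \<Lambda>: "\<Lambda> > 0" unfolding \<Lambda>_def using assms by (intro legendre_eigenvalue_pos) simp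
  \<comment> \<open>Orders m \<le> 1 fall under the power branch of \<open>spline_const\<close>,
    larger ones under the factorial branch; for k = -1 both equal (1/2)^m over the square root of
    the eigenvalue of degree p + 1.\<close>
  have const: "(spline_const p (-1) m)\<^sup>2 = (1/2) ^ (2 * m) / \<Lambda>"
  proof (cases "m \<le> 1")
    case True
    then consider "m = 0" | "m = 1" by linarith
    then show ?thesis
      by cases (use False in \<open>simp_all add: spline_const_def \<Lambda>_def legendre_eigenvalue_def
        power_mult_distrib power_divide real_sqrt_pow2 field_simps power2_eq_square\<close>)
  next
    case m: False
    have "nat (int p + 1 + int m) = Suc p + m" by simp
    then have "spline_const p (-1) m = (1/2) ^ m * sqrt (fact (Suc p - m) / fact (Suc p + m))"
      using m False by (simp add: spline_const_def algebra_simps)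
    then have "(spline_const p (-1) m)\<^sup>2 = ((1/2) ^ m)\<^sup>2 * (fact (Suc p - m) / fact (Suc p + m))"
      by (simp only: power_mult_distrib) simp
    then show ?thesis using assms by (simp add: \<Lambda>_def legendre_eigenvalue_fact power_mult[symmetric] mult.commute)
  qed
  obtain z where z: "degree z \<le> p" "\<Lambda> * poly_int c d ((U - z) * (U - z)) \<le> legendre_form c d m U U"
    using legendre_approximation[OF assms order_refl, of U] by (auto simp: \<Lambda>_def)
  note z(2)
  also have "legendre_form c d m U U
      \<le> (((d - c) / 2) ^ m)\<^sup>2 * poly_int c d ((pderiv ^^ m) U * (pderiv ^^ m) U)"
    by (rule legendre_form_le[OF assms(1)])
  finally have "poly_int c d ((U - z) * (U - z))
      \<le> (((d - c) / 2) ^ m)\<^sup>2 / \<Lambda> * poly_int c d ((pderiv ^^ m) U * (pderiv ^^ m) U)"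
    using \<Lambda> by (simp add: field_simps)
  also have "(((d - c) / 2) ^ m)\<^sup>2 / \<Lambda> = (spline_const p (-1) m * (d - c) ^ m)\<^sup>2"
    unfolding power_mult_distrib[of _ _ 2] const
    by (simp add: power_divide power_mult[symmetric] mult.commute)
  finally show ?thesis using z(1) by blast
qed

section \<open>The space of square integrable functions and the operator K\<close>

lemma AE_lebesgue_on_iff:
  "S \<in> sets lebesgue \<Longrightarrow> (AE x in lebesgue_on S. P x) \<longleftrightarrow> (AE x in lebesgue. x \<in> S \<longrightarrow> P x)"
  by (rule AE_restrict_space_iff) simp

text \<open>Holds since Lebesgue measure is complete; extension by zero moves the claim to the whole
  line, where completeness is applied.\<close>

lemma borel_measurable_lebesgue_on_AE:
  fixes f g :: "real \<Rightarrow> real"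
  assumes "S \<in> sets lebesgue" "f \<in> borel_measurable (lebesgue_on S)" "AE x in lebesgue_on S. f x = g x"
  shows "g \<in> borel_measurable (lebesgue_on S)"
proof -
  have "(\<lambda>x. if x \<in> S then f x else 0) \<in> borel_measurable lebesgue"
    using assms by (simp add: borel_measurable_if)
  moreover have "AE x in lebesgue. (if x \<in> S then f x else 0) = (if x \<in> S then g x else 0)"
    using assms(3) unfolding AE_lebesgue_on_iff[OF assms(1)] by (auto elim: eventually_mono)
  ultimately have "(\<lambda>x. if x \<in> S then g x else 0) \<in> borel_measurable lebesgue"
    by (rule borel_measurable_AE)
  then show ?thesis using assms by (simp add: borel_measurable_if)
qed

lemma integral_lebesgue_on_cong_AE:
  fixes f g :: "real \<Rightarrow> real"
  assumes "S \<in> sets lebesgue" "f \<in> borel_measurable (lebesgue_on S)" "AE x in lebesgue_on S. f x = g x"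
  shows "integral\<^sup>L (lebesgue_on S) f = integral\<^sup>L (lebesgue_on S) g"
  using borel_measurable_lebesgue_on_AE[OF assms] assms by (intro integral_cong_AE) auto

lemma integral_lebesgue_cong_AE:
  fixes f g :: "real \<Rightarrow> real"
  assumes "f \<in> borel_measurable lebesgue" "AE x in lebesgue. f x = g x"
  shows "integral\<^sup>L lebesgue f = integral\<^sup>L lebesgue g"
  using integral_lebesgue_on_cong_AE[of UNIV f g] assms unfolding lebesgue_on_UNIV_eq by simp

lemma integrable_lebesgue_on_cong_AE:
  fixes f g :: "real \<Rightarrow> real"
  assumes "S \<in> sets lebesgue" "integrable (lebesgue_on S) f" "AE x in lebesgue_on S. f x = g x"
  shows "integrable (lebesgue_on S) g"
  using borel_measurable_lebesgue_on_AE[OF assms(1) _ assms(3)] assms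
  by (intro integrable_cong_AE_imp[OF assms(2)]) (auto elim: eventually_mono)

lemma integrable_lebesgue_cong_AE:
  fixes f g :: "real \<Rightarrow> real"
  assumes "integrable lebesgue f" "AE x in lebesgue. f x = g x"
  shows "integrable lebesgue g"
  using integrable_lebesgue_on_cong_AE[of UNIV f g] assms unfolding lebesgue_on_UNIV_eq by simp

text \<open>The end points form a null set. This links L^2 on the open interval with
  \<open>K_op\<close>, which integrates over closed intervals.\<close>

lemma integrable_lebesgue_on_Icc_iff:
  fixes f :: "real \<Rightarrow> real"
  shows "integrable (lebesgue_on {c..d}) f \<longleftrightarrow> integrable (lebesgue_on {c<..<d}) f"
proof -
  have ae: "AE x in lebesgue. (if x \<in> {c..d} then f x else 0) = (if x \<in> {c<..<d} then f x else 0)"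
  proof -
    have "AE x in lebesgue. x \<notin> {c, d}"
      by (intro AE_not_in) (simp add: negligible_iff_null_sets[symmetric])
    then show ?thesis by (rule eventually_mono) auto
  qed

  have "integrable lebesgue (\<lambda>x. if x \<in> {c..d} then f x else 0)
      \<longleftrightarrow> integrable lebesgue (\<lambda>x. if x \<in> {c<..<d} then f x else 0)"
  proof
    assume "integrable lebesgue (\<lambda>x. if x \<in> {c..d} then f x else 0)"
    from integrable_lebesgue_cong_AE[OF this ae]
    show "integrable lebesgue (\<lambda>x. if x \<in> {c<..<d} then f x else 0)" .
  next
    assume 1: "integrable lebesgue (\<lambda>x. if x \<in> {c<..<d} then f x else 0)"
    show "integrable lebesgue (\<lambda>x. if x \<in> {c..d} then f x else 0)"
      by (rule integrable_lebesgue_cong_AE[OF 1]) (use ae in eventually_elim, simp)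
  qed
  moreover have "{c..d} \<in> sets lebesgue" "{c<..<d} \<in> sets lebesgue" by auto
  ultimately show ?thesis by (simp only: Lebesgue_Measure.integrable_restrict_UNIV)
qed

text \<open>The bridge from the Lebesgue to the gauge integral, through which the fundamental
  theorem of calculus enters.\<close>

lemma integral_lebesgue_on_Icc:
  fixes f :: "real \<Rightarrow> real"
  assumes "integrable (lebesgue_on {c<..<d}) f"
  shows "integral\<^sup>L (lebesgue_on {c..d}) f = integral {c..d} f"
    "integral\<^sup>L (lebesgue_on {c<..<d}) f = integral {c..d} f"
  using assms integrable_lebesgue_on_Icc_iff[of c d f] integral_open_interval_real[of c d f]
  by (simp_all add: lebesgue_integral_eq_integral)

section \<open>The inner product of L^2(a, b)\<close>

locale open_interval =
  fixes a b :: real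
  assumes ab: "a < b"
begin

abbreviation M :: "real measure" where "M \<equiv> lebesgue_on {a<..<b}"
abbreviation L2 :: "(real \<Rightarrow> real) set" where "L2 \<equiv> L2_space a b"
abbreviation ip :: "(real \<Rightarrow> real) \<Rightarrow> (real \<Rightarrow> real) \<Rightarrow> real" where "ip \<equiv> L2_inner a b"
abbreviation nrm :: "(real \<Rightarrow> real) \<Rightarrow> real" where "nrm \<equiv> L2_norm a b"
abbreviation K :: "(real \<Rightarrow> real) \<Rightarrow> real \<Rightarrow> real" where "K \<equiv> K_op a"

text \<open>Finiteness of the measure puts the constants into L^2 and L^2 into L^1.\<close>

sublocale finite_measure M
  by (rule finite_measure_lebesgue_on) simp

lemma AE_M_I: "(\<And>x. a < x \<Longrightarrow> x < b \<Longrightarrow> P x) \<Longrightarrow> AE x in M. P x"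
  by (intro AE_I2) simp

lemma L2D:
  assumes "f \<in> L2"
  shows "f \<in> borel_measurable M" "integrable M (\<lambda>x. (f x)\<^sup>2)"
  using assms by (auto simp: L2_space_def)

lemma L2_mult_integrable:
  assumes "f \<in> L2" "g \<in> L2"
  shows "integrable M (\<lambda>x. f x * g x)"
proof (rule Bochner_Integration.integrable_bound)
  show "integrable M (\<lambda>x. (f x)\<^sup>2 + (g x)\<^sup>2)" using assms L2D by auto
  show "(\<lambda>x. f x * g x) \<in> borel_measurable M" using assms L2D by auto
  have "\<bar>s * t\<bar> \<le> s\<^sup>2 + t\<^sup>2" for s t :: real
    using sum_squares_bound[of "\<bar>s\<bar>" "\<bar>t\<bar>"] abs_ge_zero[of "s * t"] unfolding abs_mult power2_abs by linarith
  then show "AE x in M. norm (f x * g x) \<le> norm ((f x)\<^sup>2 + (g x)\<^sup>2)"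
    by (intro AE_I2) (simp add: order_trans[OF _ abs_ge_self])
qed

lemma L2_bounded:
  assumes "f \<in> borel_measurable M" "\<And>x. a < x \<Longrightarrow> x < b \<Longrightarrow> \<bar>f x\<bar> \<le> B"
  shows "f \<in> L2"
proof -
  have "integrable M (\<lambda>x. (f x)\<^sup>2)"
    using assms order_trans[OF assms(2) abs_ge_self]
    by (intro integrable_const_bound[of _ "B\<^sup>2"] AE_M_I) (auto simp flip: abs_le_square_iff)
  then show ?thesis using assms by (simp add: L2_space_def)
qed

lemma L2_continuous:
  assumes "continuous_on {a..b} f"
  shows "f \<in> L2"
proof -
  have "continuous_on {a<..<b} f" using assms by (rule continuous_on_subset) auto
  then have "f \<in> borel_measurable M"
    by (intro continuous_imp_measurable_on_sets_lebesgue) auto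
  moreover obtain B where "\<forall>x\<in>{a..b}. norm (f x) \<le> B"
    using compact_imp_bounded[OF compact_continuous_image[OF assms]] by (auto simp: bounded_iff)
  ultimately show ?thesis by (intro L2_bounded[of f B]) auto
qed

lemma L2_const [simp]: "(\<lambda>x. c) \<in> L2"
  by (intro L2_continuous continuous_intros)

lemma L2_poly [simp]: "poly P \<in> L2"
  by (intro L2_continuous continuous_intros)

lemma L2_add [intro]:
  assumes "f \<in> L2" "g \<in> L2"
  shows "(\<lambda>x. f x + g x) \<in> L2"
proof -
  have "integrable M (\<lambda>x. (f x)\<^sup>2 + (g x)\<^sup>2 + 2 * (f x * g x))"
    using assms L2D L2_mult_integrable[OF assms] by auto
  moreover have "(\<lambda>x. f x + g x) \<in> borel_measurable M" using assms[THEN L2D(1)] by measurable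
  ultimately show ?thesis unfolding L2_space_def by (simp add: power2_sum mult.assoc)
qed

lemma L2_scale [intro]: "f \<in> L2 \<Longrightarrow> (\<lambda>x. c * f x) \<in> L2"
  unfolding L2_space_def by (auto simp: power_mult_distrib intro!: borel_measurable_times)

lemma L2_diff [intro]: "f \<in> L2 \<Longrightarrow> g \<in> L2 \<Longrightarrow> (\<lambda>x. f x - g x) \<in> L2"
  using L2_add[of f "\<lambda>x. (-1) * g x"] L2_scale[of g "-1"] by simp

lemma L2_integrable: "f \<in> L2 \<Longrightarrow> integrable M f"
  using L2_mult_integrable[of f "\<lambda>x. 1"] by simp

lemma ip_commute: "ip f g = ip g f"
  by (simp add: L2_inner_def mult.commute)

lemma ip_add_right: "f \<in> L2 \<Longrightarrow> g \<in> L2 \<Longrightarrow> h \<in> L2 \<Longrightarrow> ip f (\<lambda>x. g x + h x) = ip f g + ip f h"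
  by (simp add: L2_inner_def distrib_left L2_mult_integrable)

lemma ip_diff_right: "f \<in> L2 \<Longrightarrow> g \<in> L2 \<Longrightarrow> h \<in> L2 \<Longrightarrow> ip f (\<lambda>x. g x - h x) = ip f g - ip f h"
  by (simp add: L2_inner_def right_diff_distrib L2_mult_integrable)

lemma ip_scale_right: "ip f (\<lambda>x. c * g x) = c * ip f g"
  by (simp add: L2_inner_def mult.left_commute)

lemma ip_add_left: "f \<in> L2 \<Longrightarrow> g \<in> L2 \<Longrightarrow> h \<in> L2 \<Longrightarrow> ip (\<lambda>x. g x + h x) f = ip g f + ip h f"
  using ip_add_right[of f g h] by (simp add: ip_commute)

lemma ip_diff_left: "f \<in> L2 \<Longrightarrow> g \<in> L2 \<Longrightarrow> h \<in> L2 \<Longrightarrow> ip (\<lambda>x. g x - h x) f = ip g f - ip h f"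
  using ip_diff_right[of f g h] by (simp add: ip_commute)

lemma ip_scale_left: "ip (\<lambda>x. c * f x) g = c * ip f g"
  using ip_scale_right[of g c f] by (simp add: ip_commute)

lemma ip_nonneg: "0 \<le> ip f f"
  by (simp add: L2_inner_def)

lemma nrm_square: "(nrm f)\<^sup>2 = ip f f"
  by (simp add: L2_norm_def ip_nonneg)

lemma nrm_nonneg: "0 \<le> nrm f"
  by (simp add: L2_norm_def ip_nonneg)

lemma ip_Cauchy_Schwarz:
  assumes f: "f \<in> L2" and g: "g \<in> L2"
  shows "\<bar>ip f g\<bar> \<le> nrm f * nrm g"
proof -
  have *: "0 \<le> ip f f - 2 * t * ip f g + t\<^sup>2 * ip g g" for t
  proof -
    have "ip (\<lambda>x. f x - t * g x) (\<lambda>x. f x - t * g x) = ip f f - 2 * t * ip f g + t\<^sup>2 * ip g g"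
      using f g by (simp add: ip_diff_left ip_diff_right ip_scale_left ip_scale_right L2_diff L2_scale
          ip_commute[of g f] power2_eq_square algebra_simps)
    then show ?thesis using ip_nonneg[of "\<lambda>x. f x - t * g x"] by simp
  qed
  have "(ip f g)\<^sup>2 \<le> ip f f * ip g g"
  \<comment> \<open>\<open>ip\<close> is only positive semidefinite on functions: if
    \<open>ip g g = 0\<close>, the quadratic in t is affine and bounded below, hence constant;
    otherwise it is evaluated at its minimiser.\<close>
  proof (cases "ip g g = 0")
    case True
    have "ip f g = 0"
    proof (rule ccontr)
      assume "ip f g \<noteq> 0"
      then show False using *[of "(ip f f + 1) / (2 * ip f g)"] True by simp
    qed
    then show ?thesis using True by simp
  next
    case False
    then have "ip g g > 0" using ip_nonneg[of g] by simp
    then show ?thesis using *[of "ip f g / ip g g"] by (simp add: field_simps power2_eq_square)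
  qed
  then have "sqrt ((ip f g)\<^sup>2) \<le> sqrt (ip f f * ip g g)" by (rule real_sqrt_le_mono)
  then show ?thesis by (simp add: L2_norm_def real_sqrt_mult)
qed

lemma ip_le: "f \<in> L2 \<Longrightarrow> g \<in> L2 \<Longrightarrow> ip f g \<le> nrm f * nrm g"
  using ip_Cauchy_Schwarz[of f g] by simp

lemma measurable_AE:
  fixes f g :: "real \<Rightarrow> real"
  shows "f \<in> borel_measurable M \<Longrightarrow> AE x in M. f x = g x \<Longrightarrow> g \<in> borel_measurable M"
  using borel_measurable_lebesgue_on_AE[of "{a<..<b}" f g] by simp

lemma L2_AE:
  assumes "f \<in> L2" "AE x in M. f x = g x"
  shows "g \<in> L2"
proof -
  have "integrable M (\<lambda>x. (g x)\<^sup>2)"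
  proof (rule integrable_lebesgue_on_cong_AE[OF _ L2D(2)[OF assms(1)]])
    show "AE x in M. (f x)\<^sup>2 = (g x)\<^sup>2" using assms(2) by eventually_elim simp
  qed simp
  then show ?thesis using measurable_AE[OF L2D(1)[OF assms(1)] assms(2)] by (simp add: L2_space_def)
qed

lemma ip_AE:
  assumes "f \<in> L2" "g \<in> L2" "AE x in M. f x = f' x" "AE x in M. g x = g' x"
  shows "ip f g = ip f' g'"
  unfolding L2_inner_def
proof (rule integral_lebesgue_on_cong_AE)
  show "AE x in M. f x * g x = f' x * g' x" using assms(3,4) by eventually_elim simp
  show "(\<lambda>x. f x * g x) \<in> borel_measurable M" using assms(1,2)[THEN L2D(1)] by measurable
qed simp

lemma nrm_AE: "f \<in> L2 \<Longrightarrow> AE x in M. f x = g x \<Longrightarrow> nrm f = nrm g"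
  unfolding L2_norm_def using ip_AE[of f f g g] by simp

section \<open>The operator K and integration by parts\<close>

lemma K_eq_integral:
  assumes "integrable M f" "x \<in> {a..b}"
  shows "f integrable_on {a..b}" "K f x = integral {a..x} f"
proof -
  have f: "integrable (lebesgue_on {a..b}) f" using assms by (simp add: integrable_lebesgue_on_Icc_iff)
  then show "f integrable_on {a..b}" by (simp add: integrable_on_lebesgue_on)
  have "integrable (lebesgue_on {a..x}) f"
  proof -
    have "integrable lebesgue (\<lambda>y. if y \<in> {a..b} then f y else 0)"
      using f by (subst Lebesgue_Measure.integrable_restrict_UNIV) auto
    then have "integrable lebesgue (\<lambda>y. indicat_real {a..x} y *\<^sub>R (if y \<in> {a..b} then f y else 0))"
      by (intro integrable_mult_indicator) auto
    moreover have "(\<lambda>y. indicat_real {a..x} y *\<^sub>R (if y \<in> {a..b} then f y else 0))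
        = (\<lambda>y. if y \<in> {a..x} then f y else 0)"
      using assms(2) by (auto simp: indicator_def)
    ultimately have "integrable lebesgue (\<lambda>y. if y \<in> {a..x} then f y else 0)" by simp
    then show ?thesis by (subst (asm) Lebesgue_Measure.integrable_restrict_UNIV) auto
  qed
  then show "K f x = integral {a..x} f"
    unfolding K_op_def by (simp add: lebesgue_integral_eq_integral)
qed

lemma K_continuous:
  assumes "integrable M f"
  shows "continuous_on {a..b} (K f)"
proof -
  have "continuous_on {a..b} (\<lambda>x. integral {a..x} f)"
    using K_eq_integral(1)[OF assms, of a] ab by (intro indefinite_integral_continuous_1) auto
  then show ?thesis
    by (rule continuous_on_eq) (simp add: K_eq_integral(2)[OF assms])
qed

lemma integrable_mult_continuous:
  fixes f g :: "real \<Rightarrow> real"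
  assumes "integrable M f" "continuous_on {a..b} g"
  shows "integrable M (\<lambda>x. f x * g x)"
proof -
  have g: "g \<in> borel_measurable M" using L2_continuous[OF assms(2)] by (rule L2D)
  obtain B where B: "\<forall>x\<in>{a..b}. norm (g x) \<le> B"
    using compact_imp_bounded[OF compact_continuous_image[OF assms(2)]] by (auto simp: bounded_iff)
  show ?thesis
  proof (rule Bochner_Integration.integrable_bound)
    show "integrable M (\<lambda>x. B * f x)" using assms by simp
    show "AE x in M. norm (f x * g x) \<le> norm (B * f x)"
      using B by (intro AE_M_I) (simp add: abs_mult mult.commute[of "\<bar>f _\<bar>"] mult_right_mono order_trans[OF _ abs_ge_self])
  qed (use assms g in measurable)
qed

lemma L2_K [intro]: "f \<in> L2 \<Longrightarrow> K f \<in> L2"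
  by (rule L2_continuous[OF K_continuous[OF L2_integrable]])

lemma K_at_a [simp]: "K f a = 0"
  unfolding K_op_def by (rule integral_eq_zero_null_sets) (simp add: negligible_iff_null_sets[symmetric])

lemma K_at_b: "integrable M f \<Longrightarrow> K f b = integral\<^sup>L M f"
  using K_eq_integral(2)[of f b] integral_lebesgue_on_Icc(2)[of a b f] ab by simp

lemma K_poly:
  assumes "pderiv Q = P" "poly Q a = 0" "x \<in> {a..b}"
  shows "K (poly P) x = poly Q x"
proof -
  have "K (poly P) x = poly_int a x P"
    unfolding poly_int_def using assms(3) by (intro K_eq_integral(2) L2_integrable) auto
  then show ?thesis using poly_int_pderiv[of a x Q] assms by simp
qed

lemma integral_M_eq_lebesgue:
  fixes f :: "real \<Rightarrow> real"
  shows "integral\<^sup>L M f = integral\<^sup>L lebesgue (\<lambda>x. if x \<in> {a<..<b} then f x else 0)"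
  by (rule Lebesgue_Measure.integral_restrict_UNIV[symmetric]) simp

text \<open>Fubini's theorem is applied to the product of two copies of \<open>lborel\<close>, so
  integrands must be Borel; the representative vanishes almost everywhere outside (a, b).\<close>

lemma borel_representative:
  fixes f :: "real \<Rightarrow> real"
  assumes "integrable M f"
  obtains f' where "f' \<in> borel_measurable borel" "integrable lborel f'"
    "AE x in lebesgue. (if x \<in> {a<..<b} then f x else 0) = f' x" "(LINT x|lborel. f' x) = integral\<^sup>L M f"
proof -
  have int: "integrable lebesgue (\<lambda>x. if x \<in> {a<..<b} then f x else 0)"
    using assms by (subst Lebesgue_Measure.integrable_restrict_UNIV) auto
  then obtain f' where f': "f' \<in> borel_measurable lborel"
    "AE x in lborel. (if x \<in> {a<..<b} then f x else 0) = f' x"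
    using completion_ex_borel_measurable_real[of "\<lambda>x. if x \<in> {a<..<b} then f x else 0" lborel] by auto
  then have ae: "AE x in lebesgue. (if x \<in> {a<..<b} then f x else 0) = f' x"
    by (intro AE_completion)
  have "integrable lebesgue f'"
    using integrable_lebesgue_cong_AE[OF int ae] .
  moreover have "(LINT x|lborel. f' x) = integral\<^sup>L M f"
  proof -
    have "(LINT x|lborel. f' x) = (LINT x|lebesgue. f' x)" using f'(1) by (simp add: integral_completion)
    also have "\<dots> = integral\<^sup>L M f"
      unfolding integral_M_eq_lebesgue using int ae
      by (intro integral_lebesgue_cong_AE[symmetric]) auto
    finally show ?thesis .
  qed
  ultimately show ?thesis using f' ae by (intro that[of f']) (auto simp: integrable_completion)
qed

text \<open>The lower limit a disappears because f' vanishes almost everywhere to its left; the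
  remaining condition x \<le> y is Borel in both variables.\<close>

lemma K_eq_lborel:
  assumes "f' \<in> borel_measurable borel" "AE x in lebesgue. (if x \<in> {a<..<b} then f x else 0) = f' x"
    "y \<in> {a..b}"
  shows "K f y = (LINT x|lborel. (if x \<le> y then f' x else 0))"
proof -
  have "K f y = integral\<^sup>L lebesgue (\<lambda>x. if x \<in> {a..y} then f x else 0)"
    unfolding K_op_def by (rule Lebesgue_Measure.integral_restrict_UNIV[symmetric]) simp
  also have "\<dots> = integral\<^sup>L lebesgue (\<lambda>x. if x \<le> y then f' x else 0)"
  proof (rule integral_lebesgue_cong_AE[symmetric])
    show "(\<lambda>x. if x \<le> y then f' x else 0) \<in> borel_measurable lebesgue"
    proof (rule measurable_completion)
      have "(\<lambda>x. if x \<le> y then f' x else 0) \<in> borel_measurable borel"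
        using assms(1) by measurable
      then show "(\<lambda>x. if x \<le> y then f' x else 0) \<in> borel_measurable lborel" by simp
    qed
    show "AE x in lebesgue. (if x \<le> y then f' x else 0) = (if x \<in> {a..y} then f x else 0)"
    proof -
      have "AE x in lebesgue. x \<notin> {a, b}"
        by (intro AE_not_in) (simp add: negligible_iff_null_sets[symmetric])
      with assms(2) show ?thesis
        by eventually_elim (use assms(3) in \<open>auto split: if_splits\<close>)
    qed
  qed
  also have "\<dots> = (LINT x|lborel. (if x \<le> y then f' x else 0))"
  proof (rule integral_completion)
    have "(\<lambda>x. if x \<le> y then f' x else 0) \<in> borel_measurable borel"
      using assms(1) by measurable
    then show "(\<lambda>x. if x \<le> y then f' x else 0) \<in> borel_measurable lborel" by simp
  qed
  finally show ?thesis .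
qed

text \<open>Fubini on the triangle x \<le> y: integrating out x first gives K f, integrating out y
  first gives the total integral of g minus K g. No pointwise derivative enters, so f and g may be
  merely integrable.\<close>

lemma K_parts_integrable:
  assumes f: "integrable M f" and g: "integrable M g"
  shows "ip (K f) g + ip f (K g) = integral\<^sup>L M f * integral\<^sup>L M g"
proof -
  obtain f' where f': "f' \<in> borel_measurable borel" "integrable lborel f'"
    "AE x in lebesgue. (if x \<in> {a<..<b} then f x else 0) = f' x" using borel_representative[OF f] .
  obtain g' where g': "g' \<in> borel_measurable borel" "integrable lborel g'"
    "AE x in lebesgue. (if x \<in> {a<..<b} then g x else 0) = g' x"
    "(LINT x|lborel. g' x) = integral\<^sup>L M g" using borel_representative[OF g] .
  note [measurable] = f'(1) g'(1)
  let ?h = "\<lambda>x y. f' x * g' y * (if x \<le> y then 1 else 0)"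
  have int: "integrable (lborel \<Otimes>\<^sub>M lborel) (case_prod ?h)"
  proof (rule lborel_pair.Fubini_integrable)
    have bnd: "integrable lborel (\<lambda>y. ?h x y)" for x
      by (rule Bochner_Integration.integrable_bound[of _ "\<lambda>y. f' x * g' y"]) (use g' in auto)
    have bnd': "integrable lborel (\<lambda>y. \<bar>?h x y\<bar>)" for x using bnd by (rule integrable_abs)
    show "AE x in lborel. integrable lborel (\<lambda>y. case (x, y) of (x, y) \<Rightarrow> ?h x y)" using bnd by simp
    show "integrable lborel (\<lambda>x. LINT y|lborel. norm (case (x, y) of (x, y) \<Rightarrow> ?h x y))"
    proof (rule Bochner_Integration.integrable_bound[of _ "\<lambda>x. (LINT y|lborel. \<bar>g' y\<bar>) * f' x"])
      have "\<bar>LINT y|lborel. \<bar>?h x y\<bar>\<bar> \<le> \<bar>(LINT y|lborel. \<bar>g' y\<bar>) * f' x\<bar>" for x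
      proof -
        have "(LINT y|lborel. \<bar>?h x y\<bar>) \<le> (LINT y|lborel. \<bar>f' x\<bar> * \<bar>g' y\<bar>)"
          using bnd' g'(2) by (intro integral_mono) (auto simp: abs_mult)
        then show ?thesis by (simp add: abs_mult mult.commute)
      qed
      then show "AE x in lborel. norm (LINT y|lborel. norm (case (x, y) of (x, y) \<Rightarrow> ?h x y))
         \<le> norm ((LINT y|lborel. \<bar>g' y\<bar>) * f' x)" by simp
    qed (use f' in auto)
  qed measurable

  have Kf: "K f y = (LINT x|lborel. (if x \<le> y then f' x else 0))" if "y \<in> {a..b}" for y
    using K_eq_lborel f' that by blast
  have Kg: "K g y = (LINT x|lborel. (if x \<le> y then g' x else 0))" if "y \<in> {a..b}" for y
    using K_eq_lborel g' that by blast
  have "(LINT y|lborel. LINT x|lborel. ?h x y) = (LINT y|lborel. g' y * (LINT x|lborel. (if x \<le> y then f' x else 0)))"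
  proof (rule Bochner_Integration.integral_cong[OF refl])
    fix y
    have "(LINT x|lborel. ?h x y) = (LINT x|lborel. g' y * (if x \<le> y then f' x else 0))"
      by (rule Bochner_Integration.integral_cong) auto
    then show "(LINT x|lborel. ?h x y) = g' y * (LINT x|lborel. (if x \<le> y then f' x else 0))" by simp
  qed
  also have "\<dots> = (LINT y|lebesgue. g' y * (LINT x|lborel. (if x \<le> y then f' x else 0)))"
    by (intro integral_completion[symmetric]) measurable
  also have "\<dots> = (LINT y|lebesgue. (if y \<in> {a<..<b} then K f y * g y else 0))"
  proof (rule integral_lebesgue_cong_AE)
    show "(\<lambda>y. g' y * (LINT x|lborel. (if x \<le> y then f' x else 0))) \<in> borel_measurable lebesgue"
      by (intro measurable_completion) measurable
    show "AE y in lebesgue. g' y * (LINT x|lborel. (if x \<le> y then f' x else 0)) =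
        (if y \<in> {a<..<b} then K f y * g y else 0)"
      using g'(3) by eventually_elim (auto simp: Kf split: if_splits)
  qed
  also have "\<dots> = ip (K f) g" by (simp only: L2_inner_def integral_M_eq_lebesgue)
  finally have 1: "(LINT y|lborel. LINT x|lborel. ?h x y) = ip (K f) g" .
  let ?G = "integral\<^sup>L M g"
  have "(LINT x|lborel. LINT y|lborel. ?h x y) = (LINT x|lborel. f' x * (?G - (LINT y|lborel. (if y \<le> x then g' y else 0))))"
  proof (rule Bochner_Integration.integral_cong[OF refl])
    fix x
    \<comment> \<open>Up to the null set {x}, the half-line y \<ge> x is the complement of y \<le>
      x.\<close>
    have "(LINT y|lborel. ?h x y) = (LINT y|lborel. f' x * (g' y - (if y \<le> x then g' y else 0)))"
      by (intro integral_cong_AE eventually_mono[OF AE_lborel_singleton[of x]]) auto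
    also have "\<dots> = f' x * ((LINT y|lborel. g' y) - (LINT y|lborel. (if y \<le> x then g' y else 0)))"
    proof -
      have "integrable lborel (\<lambda>y. if y \<le> x then g' y else 0)"
        by (rule Bochner_Integration.integrable_bound[OF g'(2)]) auto
      then show ?thesis using g'(2) by simp
    qed
    finally show "(LINT y|lborel. ?h x y) = f' x * (?G - (LINT y|lborel. (if y \<le> x then g' y else 0)))"
      by (simp only: g'(4))
  qed
  also have "\<dots> = (LINT x|lebesgue. f' x * (?G - (LINT y|lborel. (if y \<le> x then g' y else 0))))"
    by (intro integral_completion[symmetric]) measurable
  also have "\<dots> = (LINT x|lebesgue. (if x \<in> {a<..<b} then f x * (?G - K g x) else 0))"
  proof (rule integral_lebesgue_cong_AE)
    show "(\<lambda>x. f' x * (?G - (LINT y|lborel. (if y \<le> x then g' y else 0)))) \<in> borel_measurable lebesgue"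
      by (intro measurable_completion) measurable
    show "AE x in lebesgue. f' x * (?G - (LINT y|lborel. (if y \<le> x then g' y else 0))) =
        (if x \<in> {a<..<b} then f x * (?G - K g x) else 0)"
      using f'(3) by eventually_elim (auto simp: Kg split: if_splits)
  qed
  also have "\<dots> = (LINT x|M. f x * (?G - K g x))" by (simp only: integral_M_eq_lebesgue)
  also have "\<dots> = (LINT x|M. f x * ?G - f x * K g x)" by (simp add: right_diff_distrib)
  also have "\<dots> = integral\<^sup>L M f * ?G - ip f (K g)"
    using f integrable_mult_continuous[OF f K_continuous[OF g]] by (simp add: L2_inner_def)
  finally have 2: "(LINT x|lborel. LINT y|lborel. ?h x y) = integral\<^sup>L M f * ?G - ip f (K g)" .
  show ?thesis using lborel_pair.Fubini_integral[OF int] 1 2 by simp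
qed

end

section \<open>Test functions and weak derivatives\<close>

text \<open>The flat function exp(-1/t) times t^(-k): with these factors the family is closed under
  differentiation up to linear combinations, and still flat at 0.\<close>

definition flat_exp :: "nat \<Rightarrow> real \<Rightarrow> real" where
  "flat_exp k t = (if t \<le> 0 then 0 else inverse t ^ k * exp (- inverse t))"

lemma flat_exp_tendsto_0: "(flat_exp k \<longlongrightarrow> 0) (at 0)"
proof -
  have "((\<lambda>y::real. y ^ k / exp y) \<longlongrightarrow> 0) at_top" by (rule tendsto_power_div_exp_0)
  then have "((\<lambda>t::real. inverse t ^ k / exp (inverse t)) \<longlongrightarrow> 0) (at_right 0)"
    by (rule filterlim_compose[OF _ filterlim_inverse_at_top_right])
  then have "(flat_exp k \<longlongrightarrow> 0) (at_right 0)"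
    by (rule Lim_transform_eventually)
      (auto simp: flat_exp_def exp_minus divide_inverse eventually_at_filter)
  moreover have "(flat_exp k \<longlongrightarrow> 0) (at_left 0)"
    by (rule Lim_transform_eventually[OF tendsto_const])
      (auto simp: flat_exp_def eventually_at_filter)
  ultimately show ?thesis by (simp add: filterlim_split_at)
qed

lemma DERIV_flat_exp:
  "(flat_exp k has_real_derivative flat_exp (k + 2) t - real k * flat_exp (k + 1) t) (at t)"
proof -
  consider "t < 0" | "t > 0" | "t = 0" by linarith
  then show ?thesis
  proof cases
    case 1
    then have "eventually (\<lambda>s. s < 0) (nhds t)" by (intro order_tendstoD[OF filterlim_ident])
    then have ev: "eventually (\<lambda>s. flat_exp k s = 0) (nhds t)"
      by eventually_elim (simp add: flat_exp_def)
    have "((\<lambda>_. 0::real) has_real_derivative 0) (at t)" by simp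
    then have "(flat_exp k has_real_derivative 0) (at t)"
      using DERIV_cong_ev[OF refl ev refl, of 0] by simp
    then show ?thesis using 1 by (simp add: flat_exp_def)
  next
    case 2
    then have "eventually (\<lambda>s. s > 0) (nhds t)" by (intro order_tendstoD[OF filterlim_ident])
    then have ev: "eventually (\<lambda>s. flat_exp k s = inverse s ^ k * exp (- inverse s)) (nhds t)"
      by eventually_elim (simp add: flat_exp_def)
    have 1: "((\<lambda>s. inverse s ^ k) has_real_derivative - real k * inverse t ^ (k + 1)) (at t)"
    proof (cases k)
      case (Suc j)
      have "((\<lambda>s. inverse s ^ Suc j) has_real_derivative
          real (Suc j) * (- (inverse t ^ Suc (Suc 0)) * inverse t ^ (Suc j - Suc 0))) (at t)"
        by (rule DERIV_power[OF DERIV_inverse]) (use 2 in simp)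
      then show ?thesis unfolding Suc by (rule DERIV_cong) (simp add: algebra_simps)
    qed simp
    have 2: "((\<lambda>s. exp (- inverse s)) has_real_derivative exp (- inverse t) * inverse t ^ 2) (at t)"
      using 2 by (auto intro!: derivative_eq_intros simp: power2_eq_square)
    have "((\<lambda>s. inverse s ^ k * exp (- inverse s)) has_real_derivative
        flat_exp (k + 2) t - real k * flat_exp (k + 1) t) (at t)"
      by (rule DERIV_cong[OF DERIV_mult[OF 1 2]])
        (use \<open>t > 0\<close> in \<open>simp add: flat_exp_def power2_eq_square algebra_simps\<close>)
    then show ?thesis using DERIV_cong_ev[OF refl ev refl] by blast
  next
    case 3
    \<comment> \<open>At 0 the difference quotient of \<open>flat_exp k\<close> is
      \<open>flat_exp (k + 1)\<close>, which tends to 0.\<close>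
    have "((\<lambda>h. (flat_exp k (0 + h) - flat_exp k 0) / h) \<longlongrightarrow> 0) (at 0)"
      by (rule Lim_transform_eventually[OF flat_exp_tendsto_0[of "k + 1"]])
        (auto simp: flat_exp_def eventually_at_filter divide_inverse)
    then have "(flat_exp k has_real_derivative 0) (at 0)" by (simp add: DERIV_def)
    then show ?thesis using 3 by (simp add: flat_exp_def)
  qed
qed

lemma flat_exp_bounds: "0 \<le> flat_exp 0 t" "flat_exp 0 t \<le> 1"
  by (auto simp: flat_exp_def)

text \<open>The closure is stable under differentiation, so every member is smooth by a plain
  induction on the order, without a formula for higher derivatives of products.\<close>

inductive flat_exp_algebra :: "(real \<Rightarrow> real) \<Rightarrow> bool" where
  base: "flat_exp_algebra (\<lambda>x. flat_exp k (\<alpha> * x + \<beta>))"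
| add: "flat_exp_algebra f \<Longrightarrow> flat_exp_algebra g \<Longrightarrow> flat_exp_algebra (\<lambda>x. f x + g x)"
| mult: "flat_exp_algebra f \<Longrightarrow> flat_exp_algebra g \<Longrightarrow> flat_exp_algebra (\<lambda>x. f x * g x)"
| scale: "flat_exp_algebra f \<Longrightarrow> flat_exp_algebra (\<lambda>x. c * f x)"

lemma flat_exp_algebra_deriv:
  "flat_exp_algebra f \<Longrightarrow> \<exists>f'. flat_exp_algebra f' \<and> (\<forall>x. (f has_real_derivative f' x) (at x))"
proof (induction rule: flat_exp_algebra.induct)
  case (base k \<alpha> \<beta>)
  let ?f' = "\<lambda>x. \<alpha> * (flat_exp (k + 2) (\<alpha> * x + \<beta>) + (- real k) * flat_exp (k + 1) (\<alpha> * x + \<beta>))"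
  have "((\<lambda>x. flat_exp k (\<alpha> * x + \<beta>)) has_real_derivative ?f' x) (at x)" for x
  proof -
    have "((\<lambda>x. \<alpha> * x + \<beta>) has_real_derivative \<alpha>) (at x)" by (auto intro!: derivative_eq_intros)
    from DERIV_chain2[OF DERIV_flat_exp this] show ?thesis by (rule DERIV_cong) (simp add: algebra_simps)
  qed
  moreover have "flat_exp_algebra ?f'" by (intro flat_exp_algebra.intros)
  ultimately show ?case by blast
next
  case (add f g)
  then obtain f' g' where *: "flat_exp_algebra f'" "flat_exp_algebra g'"
    "\<And>x. (f has_real_derivative f' x) (at x)" "\<And>x. (g has_real_derivative g' x) (at x)" by blast
  have "((\<lambda>x. f x + g x) has_real_derivative f' x + g' x) (at x)" for x
    by (rule DERIV_add[OF *(3,4)])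
  then show ?case using flat_exp_algebra.add[OF *(1,2)] by blast
next
  case (mult f g)
  then obtain f' g' where *: "flat_exp_algebra f'" "flat_exp_algebra g'"
    "\<And>x. (f has_real_derivative f' x) (at x)" "\<And>x. (g has_real_derivative g' x) (at x)" by blast
  have "((\<lambda>x. f x * g x) has_real_derivative f' x * g x + g' x * f x) (at x)" for x
    by (rule DERIV_mult[OF *(3,4)])
  moreover have "flat_exp_algebra (\<lambda>x. f' x * g x + g' x * f x)"
    by (intro flat_exp_algebra.add flat_exp_algebra.mult * mult)
  ultimately show ?case by blast
next
  case (scale f c)
  then obtain f' where *: "flat_exp_algebra f'" "\<And>x. (f has_real_derivative f' x) (at x)" by blast
  have "((\<lambda>x. c * f x) has_real_derivative c * f' x) (at x)" for x
    by (rule DERIV_cmult[OF *(2)])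
  then show ?case using flat_exp_algebra.scale[OF *(1)] by blast
qed

definition smooth_real :: "(real \<Rightarrow> real) \<Rightarrow> bool" where
  "smooth_real f \<longleftrightarrow> (\<forall>n x. (deriv ^^ n) f differentiable (at x))"

lemma test_functions_iff:
  "\<phi> \<in> test_functions a b \<longleftrightarrow> smooth_real \<phi> \<and>
    (\<exists>c d. a < c \<and> c < d \<and> d < b \<and> (\<forall>x. x \<notin> {c..d} \<longrightarrow> \<phi> x = 0))"
  by (auto simp: test_functions_def smooth_real_def)

lemma flat_exp_algebra_smooth:
  assumes "flat_exp_algebra f"
  shows "smooth_real f"
proof -
  have "flat_exp_algebra ((deriv ^^ n) f)" for n
  proof (induction n)
    case (Suc n)
    then obtain g where "flat_exp_algebra g" "\<And>x. ((deriv ^^ n) f has_real_derivative g x) (at x)"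
      using flat_exp_algebra_deriv by blast
    moreover from this have "deriv ((deriv ^^ n) f) = g" using DERIV_imp_deriv by blast
    ultimately show ?case by simp
  qed (use assms in simp)
  then show ?thesis
    unfolding smooth_real_def using flat_exp_algebra_deriv real_differentiable_def by blast
qed

lemma smooth_real_DERIV: "smooth_real f \<Longrightarrow> (f has_real_derivative deriv f x) (at x)"
  unfolding smooth_real_def
  by (metis DERIV_deriv_iff_real_differentiable funpow_0)

lemma smooth_real_deriv: "smooth_real f \<Longrightarrow> smooth_real (deriv f)"
  unfolding smooth_real_def
  by (metis comp_apply funpow_Suc_right)

lemma smooth_real_continuous: "smooth_real f \<Longrightarrow> continuous_on S f"
  by (meson DERIV_continuous_on has_field_derivative_at_within smooth_real_DERIV)

lemma smooth_realI:
  assumes "\<And>x. (f has_real_derivative g x) (at x)" "smooth_real g"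
  shows "smooth_real f"
proof -
  have "deriv f = g" using DERIV_imp_deriv[OF assms(1)] by auto
  then show ?thesis
    unfolding smooth_real_def
  proof (intro allI)
    fix n x assume g: "deriv f = g"
    show "(deriv ^^ n) f differentiable at x"
    proof (cases n)
      case 0
      then show ?thesis using assms(1) real_differentiable_def by auto
    next
      case (Suc m)
      then show ?thesis using assms(2) g by (simp add: smooth_real_def funpow_Suc_right del: funpow.simps)
    qed
  qed
qed

lemma smooth_real_linear:
  assumes "smooth_real f" "smooth_real g"
  shows "smooth_real (\<lambda>x. f x + k * g x)"
proof -
  have D: "((deriv ^^ n) h has_real_derivative (deriv ^^ Suc n) h x) (at x)" if "smooth_real h" for h n x
    using that unfolding smooth_real_def by (simp add: DERIV_deriv_iff_real_differentiable)
  have eq: "(deriv ^^ n) (\<lambda>x. f x + k * g x) = (\<lambda>x. (deriv ^^ n) f x + k * (deriv ^^ n) g x)" for n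
  proof (induction n)
    case (Suc n)
    have "deriv (\<lambda>x. (deriv ^^ n) f x + k * (deriv ^^ n) g x) x = (deriv ^^ Suc n) f x + k * (deriv ^^ Suc n) g x" for x
      by (intro DERIV_imp_deriv DERIV_add DERIV_cmult D assms)
    then show ?case using Suc by auto
  qed simp
  show ?thesis
    unfolding smooth_real_def eq
    using DERIV_add[OF D[OF assms(1)] DERIV_cmult[OF D[OF assms(2)]]] real_differentiable_def by blast
qed

lemma test_functions_linear:
  assumes "\<phi> \<in> test_functions a b" "\<psi> \<in> test_functions a b"
  shows "(\<lambda>x. \<phi> x + k * \<psi> x) \<in> test_functions a b"
proof -
  obtain c d c' d' where "a < c" "c < d" "d < b" "\<And>x. x \<notin> {c..d} \<Longrightarrow> \<phi> x = 0"
    "a < c'" "c' < d'" "d' < b" "\<And>x. x \<notin> {c'..d'} \<Longrightarrow> \<psi> x = 0"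
    using assms by (auto simp: test_functions_iff)
  then have "a < min c c' \<and> min c c' < max d d' \<and> max d d' < b \<and>
      (\<forall>x. x \<notin> {min c c'..max d d'} \<longrightarrow> \<phi> x + k * \<psi> x = 0)"
    by (auto simp: min_le_iff_disj le_max_iff_disj)
  then show ?thesis using assms smooth_real_linear unfolding test_functions_iff by blast
qed

lemma test_functions_deriv:
  assumes "\<phi> \<in> test_functions a b"
  shows "deriv \<phi> \<in> test_functions a b"
proof -
  obtain c d where cd: "a < c" "c < d" "d < b" "\<And>x. x \<notin> {c..d} \<Longrightarrow> \<phi> x = 0"
    using assms by (auto simp: test_functions_iff)
  have "deriv \<phi> x = 0" if "x \<notin> {c..d}" for x
  proof -
    have "eventually (\<lambda>y. y \<in> - {c..d}) (nhds x)"
      using that by (intro eventually_nhds_in_open) auto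
    then have ev: "eventually (\<lambda>y. \<phi> y = 0) (nhds x)" by eventually_elim (use cd in auto)
    have "(\<phi> has_real_derivative 0) (at x)"
      using DERIV_cong_ev[OF refl ev refl, of 0] by simp
    then show ?thesis by (rule DERIV_imp_deriv)
  qed
  then show ?thesis using cd assms smooth_real_deriv unfolding test_functions_iff by blast
qed

lemma test_functions_higher_deriv:
  "\<phi> \<in> test_functions a b \<Longrightarrow> (deriv ^^ n) \<phi> \<in> test_functions a b"
  by (induction n) (auto intro: test_functions_deriv)

text \<open>As n grows, these bump functions on [c, d] with values in [0, 1] tend to the indicator
  function of (c, d).\<close>

definition plateau :: "real \<Rightarrow> real \<Rightarrow> nat \<Rightarrow> real \<Rightarrow> real" where
  "plateau c d n x = flat_exp 0 (real (Suc n) * (x - c)) * flat_exp 0 (real (Suc n) * (d - x))"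

lemma plateau_test_function:
  assumes "a < c" "c < d" "d < b"
  shows "plateau c d n \<in> test_functions a b"
proof -
  have "flat_exp_algebra (\<lambda>x. flat_exp 0 (real (Suc n) * x + (- real (Suc n) * c)) *
      flat_exp 0 ((- real (Suc n)) * x + real (Suc n) * d))"
    by (intro flat_exp_algebra.intros)
  moreover have "(\<lambda>x. flat_exp 0 (real (Suc n) * x + (- real (Suc n) * c)) *
      flat_exp 0 ((- real (Suc n)) * x + real (Suc n) * d)) = plateau c d n"
    by (simp add: fun_eq_iff plateau_def algebra_simps)
  ultimately have "smooth_real (plateau c d n)" using flat_exp_algebra_smooth by metis
  moreover have "plateau c d n x = 0" if "x \<notin> {c..d}" for x
    using that by (auto simp: plateau_def flat_exp_def mult_le_0_iff)
  ultimately show ?thesis using assms unfolding test_functions_iff by blast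
qed

lemma plateau_bounds: "0 \<le> plateau c d n x" "plateau c d n x \<le> 1"
  unfolding plateau_def using flat_exp_bounds by (simp_all add: mult_le_one)

lemma flat_exp_tendsto_1:
  assumes "t > 0"
  shows "(\<lambda>n. flat_exp 0 (real (Suc n) * t)) \<longlonglongrightarrow> 1"
proof -
  have "(\<lambda>n. exp (- (inverse (real (Suc n)) * inverse t))) \<longlonglongrightarrow> exp (- (0 * inverse t))"
    by (intro tendsto_intros LIMSEQ_inverse_real_of_nat)
  then show ?thesis using assms by (simp add: flat_exp_def mult_le_0_iff del: of_nat_Suc)
qed

lemma plateau_tendsto_1:
  assumes "c < x" "x < d"
  shows "(\<lambda>n. plateau c d n x) \<longlonglongrightarrow> 1"
  unfolding plateau_def
  using tendsto_mult[OF flat_exp_tendsto_1[of "x - c"] flat_exp_tendsto_1[of "d - x"]] assms by simp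

lemma plateau_pos: "c < x \<Longrightarrow> x < d \<Longrightarrow> plateau c d n x > 0"
  by (simp add: plateau_def flat_exp_def mult_le_0_iff del: of_nat_Suc)

section \<open>Local integrability and the fundamental lemma\<close>

context open_interval
begin

lemma locally_integrableD:
  "locally_integrable a b v \<Longrightarrow> a < c \<Longrightarrow> c < d \<Longrightarrow> d < b \<Longrightarrow> integrable (lebesgue_on {c..d}) v"
  by (simp add: locally_integrable_def)

lemma integrable_imp_locally_integrable:
  assumes "integrable M f"
  shows "locally_integrable a b f"
  unfolding locally_integrable_def
proof (intro allI impI)
  fix c d assume cd: "a < c \<and> c < d \<and> d < b"
  have "integrable lebesgue (\<lambda>x. if x \<in> {a<..<b} then f x else 0)"
    using assms by (subst Lebesgue_Measure.integrable_restrict_UNIV) auto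
  then have "integrable lebesgue (\<lambda>x. indicat_real {c..d} x *\<^sub>R (if x \<in> {a<..<b} then f x else 0))"
    by (intro integrable_mult_indicator) auto
  moreover have "(\<lambda>x. indicat_real {c..d} x *\<^sub>R (if x \<in> {a<..<b} then f x else 0))
      = (\<lambda>x. if x \<in> {c..d} then f x else 0)"
    using cd by (auto simp: indicator_def)
  ultimately have "integrable lebesgue (\<lambda>x. if x \<in> {c..d} then f x else 0)" by simp
  then show "integrable (lebesgue_on {c..d}) f"
    by (subst (asm) Lebesgue_Measure.integrable_restrict_UNIV) auto
qed

lemma L2_locally_integrable: "f \<in> L2 \<Longrightarrow> locally_integrable a b f"
  by (intro integrable_imp_locally_integrable L2_integrable)

lemma locally_integrable_diff:
  "locally_integrable a b f \<Longrightarrow> locally_integrable a b g \<Longrightarrow> locally_integrable a b (\<lambda>x. f x - g x)"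
  by (simp add: locally_integrable_def)

lemma AE_M_subinterval:
  assumes "a < c" "d < b" "AE x in M. P x"
  shows "AE x in lebesgue_on {c..d}. P x"
proof -
  have "AE x in lebesgue. x \<in> {a<..<b} \<longrightarrow> P x" using assms(3) by (subst (asm) AE_lebesgue_on_iff) auto
  then have "AE x in lebesgue. x \<in> {c..d} \<longrightarrow> P x" by eventually_elim (use assms in auto)
  then show ?thesis by (subst AE_lebesgue_on_iff) auto
qed

lemma locally_integrable_AE:
  assumes "locally_integrable a b f" "AE x in M. f x = g x"
  shows "locally_integrable a b g"
  unfolding locally_integrable_def
proof (intro allI impI)
  fix c d assume cd: "a < c \<and> c < d \<and> d < b"
  show "integrable (lebesgue_on {c..d}) g"
    by (rule integrable_lebesgue_on_cong_AE[of _ f])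
      (use cd assms in \<open>auto simp: locally_integrable_def intro: AE_M_subinterval\<close>)
qed

text \<open>A locally integrable v may blow up at a and b; the product is integrable because the
  support of \<phi> stays away from the end points.\<close>

lemma compact_support_integral:
  assumes "locally_integrable a b v" "a < c" "c < d" "d < b"
    and \<phi>: "continuous_on {c..d} \<phi>" "\<And>x. x \<notin> {c..d} \<Longrightarrow> \<phi> x = 0"
  shows "integrable M (\<lambda>x. v x * \<phi> x)" "integrable (lebesgue_on {c..d}) (\<lambda>x. v x * \<phi> x)"
    "(LINT x|M. v x * \<phi> x) = (LINT x|lebesgue_on {c..d}. v x * \<phi> x)"
proof -
  interpret cd: open_interval c d by standard fact
  have "integrable (lebesgue_on {c<..<d}) v"
    using locally_integrableD[OF assms(1-4)] by (simp add: integrable_lebesgue_on_Icc_iff)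
  then have "integrable (lebesgue_on {c<..<d}) (\<lambda>x. v x * \<phi> x)"
    using \<phi>(1) by (rule cd.integrable_mult_continuous)
  then show 1: "integrable (lebesgue_on {c..d}) (\<lambda>x. v x * \<phi> x)"
    by (simp add: integrable_lebesgue_on_Icc_iff)
  have eq: "(\<lambda>x. if x \<in> {c..d} then v x * \<phi> x else 0) = (\<lambda>x. if x \<in> {a<..<b} then v x * \<phi> x else 0)"
    using \<phi>(2) assms(2-4) by fastforce
  have "integrable lebesgue (\<lambda>x. if x \<in> {c..d} then v x * \<phi> x else 0)"
    using 1 by (subst Lebesgue_Measure.integrable_restrict_UNIV) auto
  then show "integrable M (\<lambda>x. v x * \<phi> x)"
    unfolding eq by (subst (asm) Lebesgue_Measure.integrable_restrict_UNIV) auto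
  have "(LINT x|lebesgue_on {c..d}. v x * \<phi> x) = (LINT x|lebesgue. (if x \<in> {c..d} then v x * \<phi> x else 0))"
    by (rule Lebesgue_Measure.integral_restrict_UNIV[symmetric]) auto
  then show "(LINT x|M. v x * \<phi> x) = (LINT x|lebesgue_on {c..d}. v x * \<phi> x)"
    unfolding integral_M_eq_lebesgue eq by simp
qed

lemma test_function_support:
  assumes "\<phi> \<in> test_functions a b"
  obtains c d where "a < c" "c < d" "d < b" "\<And>x. x \<notin> {c..d} \<Longrightarrow> \<phi> x = 0" "\<And>S. continuous_on S \<phi>"
  using assms smooth_real_continuous unfolding test_functions_iff by blast

lemma test_integrable:
  assumes "locally_integrable a b v" "\<phi> \<in> test_functions a b"
  shows "integrable M (\<lambda>x. v x * \<phi> x)"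
  using test_function_support[OF assms(2)] compact_support_integral(1)[OF assms(1)] by metis

lemma test_L2: "\<phi> \<in> test_functions a b \<Longrightarrow> \<phi> \<in> L2"
  using test_function_support L2_continuous by metis

text \<open>Test with \<open>plateau c d n\<close> and let n tend to infinity; |f| is integrable on
  [c, d] and dominates.\<close>

lemma vanishing_integral_on_interval:
  assumes f: "locally_integrable a b f"
    and orth: "\<And>\<phi>. \<phi> \<in> test_functions a b \<Longrightarrow> (LINT x|M. f x * \<phi> x) = 0"
    and cd: "a < c" "c < d" "d < b"
  shows "(LINT x|lebesgue_on {c..d}. f x) = 0"
proof -
  have cont: "continuous_on {c..d} (plateau c d n)" for n
    using plateau_test_function[OF cd] smooth_real_continuous unfolding test_functions_iff by blast
  have supp: "plateau c d n x = 0" if "x \<notin> {c..d}" for x n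
    using that by (auto simp: plateau_def flat_exp_def mult_le_0_iff)
  have zero: "(LINT x|lebesgue_on {c..d}. f x * plateau c d n x) = 0" for n
    using compact_support_integral(3)[OF f cd cont supp] orth[OF plateau_test_function[OF cd]] by simp
  note int = compact_support_integral(2)[OF f cd cont supp] locally_integrableD[OF f cd]
  have "(\<lambda>n. LINT x|lebesgue_on {c..d}. f x * plateau c d n x) \<longlonglongrightarrow> (LINT x|lebesgue_on {c..d}. f x)"
  proof (rule integral_dominated_convergence[where w = "\<lambda>x. \<bar>f x\<bar>"])
    have "AE x in lebesgue. x \<notin> {c, d}"
      by (intro AE_not_in) (simp add: negligible_iff_null_sets[symmetric])
    then have "AE x in lebesgue. x \<in> {c..d} \<longrightarrow> (\<lambda>n. f x * plateau c d n x) \<longlonglongrightarrow> f x"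
    proof eventually_elim
      fix x assume "x \<notin> {c, d}"
      then show "x \<in> {c..d} \<longrightarrow> (\<lambda>n. f x * plateau c d n x) \<longlonglongrightarrow> f x"
        using tendsto_mult[OF tendsto_const plateau_tendsto_1[of c x d], of "f x"] by auto
    qed
    then show "AE x in lebesgue_on {c..d}. (\<lambda>n. f x * plateau c d n x) \<longlonglongrightarrow> f x"
      by (subst AE_lebesgue_on_iff) auto
    show "AE x in lebesgue_on {c..d}. norm (f x * plateau c d n x) \<le> \<bar>f x\<bar>" for n
      using plateau_bounds[of c d n] by (simp add: abs_mult mult_left_le)
  qed (use int in auto)
  then show ?thesis unfolding zero by (simp add: LIMSEQ_const_iff)
qed

text \<open>The integral of \<open>f\<close> over every compact subinterval vanishes, so Lebesgue's differentiation theorem applies.\<close>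

lemma fundamental_lemma:
  assumes f: "locally_integrable a b f"
    and orth: "\<And>\<phi>. \<phi> \<in> test_functions a b \<Longrightarrow> (LINT x|M. f x * \<phi> x) = 0"
  shows "AE x in M. f x = 0"
proof -
  have sub: "AE x in lebesgue. x \<in> {c<..<d} \<longrightarrow> f x = 0" if cd: "a < c" "c < d" "d < b" for c d
  proof -
    let ?f = "\<lambda>x. if x \<in> {c..d} then f x else 0"
    have "f integrable_on {c..d}"
      using locally_integrableD[OF f cd] by (intro integrable_on_lebesgue_on) auto
    then have "?f integrable_on cbox u v" for u v by (subst (asm) integrable_alt) blast
    note int = this
    obtain N where N: "negligible N"
      "\<And>x e. \<lbrakk>x \<notin> N; 0 < e\<rbrakk> \<Longrightarrow> \<exists>\<delta>>0. \<forall>h. 0 < h \<and> h < \<delta> \<longrightarrow>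
         norm (integral (cbox x (x + h *\<^sub>R One)) ?f /\<^sub>R h ^ DIM(real) - ?f x) < e"
      by (rule integrable_ccontinuous_explicit[OF int]) (rule that; (assumption | blast))
    have "f x = 0" if x: "x \<in> {c<..<d}" "x \<notin> N" for x
    proof (rule ccontr)
      assume "f x \<noteq> 0"
      \<comment> \<open>With |f x| as tolerance, an average of f that is zero already contradicts
        the estimate.\<close>
      then obtain \<delta> where \<delta>: "\<delta> > 0" "\<And>h. 0 < h \<Longrightarrow> h < \<delta> \<Longrightarrow>
          norm (integral (cbox x (x + h *\<^sub>R One)) ?f /\<^sub>R h ^ DIM(real) - ?f x) < \<bar>f x\<bar>"
        using N(2)[OF x(2), of "\<bar>f x\<bar>"] by auto
      define h where "h = min \<delta> (d - x) / 2"
      have h: "0 < h" "h < \<delta>" "x + h < d" using \<delta> x by (auto simp: h_def min_def field_simps)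
      have "integral {x..x + h} ?f = integral {x..x + h} f"
        using h x by (intro Henstock_Kurzweil_Integration.integral_cong) auto
      also have "\<dots> = (LINT y|lebesgue_on {x..x + h}. f y)"
        using locally_integrableD[OF f, of x "x + h"] h x cd by (simp add: lebesgue_integral_eq_integral)
      also have "\<dots> = 0"
        using h x cd by (intro vanishing_integral_on_interval[OF f orth]) auto
      finally show False using \<delta>(2)[OF h(1,2)] x by simp
    qed
    moreover have "AE x in lebesgue. x \<notin> N"
      using N(1) by (intro AE_not_in) (simp add: negligible_iff_null_sets)
    ultimately show ?thesis by (auto elim: eventually_mono)
  qed
  \<comment> \<open>The intervals (a + t n, b - t n) exhaust (a, b), so countably many null sets are
    combined; n + 3 keeps t n \<le> (b - a)/3, which makes each interval nonempty.\<close>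
  define t where "t = (\<lambda>n. (b - a) / (real n + 3))"
  have t: "0 < t n" "a + t n < b - t n" for n
  proof -
    show "0 < t n" using ab by (simp add: t_def)
    have "(b - a) / (real n + 3) \<le> (b - a) / 3" using ab by (intro divide_left_mono) auto
    moreover have "a + s < b - s" if "s \<le> (b - a) / 3" for s using that ab by (simp add: field_simps)
    ultimately show "a + t n < b - t n" unfolding t_def by blast
  qed
  have "AE x in lebesgue. \<forall>n. x \<in> {a + t n<..<b - t n} \<longrightarrow> f x = 0"
    unfolding AE_all_countable using t ab by (intro allI sub) (auto simp: add_pos_pos)
  then have "AE x in lebesgue. x \<in> {a<..<b} \<longrightarrow> f x = 0"
  proof eventually_elim
    fix x assume *: "\<forall>n. x \<in> {a + t n<..<b - t n} \<longrightarrow> f x = 0"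
    show "x \<in> {a<..<b} \<longrightarrow> f x = 0"
    proof
      assume x: "x \<in> {a<..<b}"
      have "t \<longlonglongrightarrow> 0" unfolding t_def by real_asymp
      then have "eventually (\<lambda>n. t n < min (x - a) (b - x)) sequentially"
        using x by (intro order_tendstoD) auto
      then obtain n where "t n < min (x - a) (b - x)" by (auto simp: eventually_sequentially)
      then show "f x = 0" using *[rule_format, of n] by auto
    qed
  qed
  then show ?thesis by (subst AE_lebesgue_on_iff) auto
qed

section \<open>Calculus of weak derivatives\<close>

lemma is_weak_deriv_unique:
  assumes "is_weak_deriv a b n u v" "is_weak_deriv a b n u w"
  shows "AE x in M. v x = w x"
proof -
  have loc: "locally_integrable a b v" "locally_integrable a b w"
    using assms by (auto simp: is_weak_deriv_def)
  have "AE x in M. v x - w x = 0"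
  proof (rule fundamental_lemma)
    fix \<phi> assume \<phi>: "\<phi> \<in> test_functions a b"
    have "(LINT x|M. v x * \<phi> x) = (LINT x|M. w x * \<phi> x)"
      using assms \<phi> by (auto simp: is_weak_deriv_def)
    then show "(LINT x|M. (v x - w x) * \<phi> x) = 0"
      using loc[THEN test_integrable[OF _ \<phi>]] by (simp add: left_diff_distrib)
  qed (use loc locally_integrable_diff in blast)
  then show ?thesis by simp
qed

lemma is_weak_deriv_AE:
  assumes "is_weak_deriv a b n u v" "AE x in M. u x = u' x" "AE x in M. v x = v' x"
  shows "is_weak_deriv a b n u' v'"
proof -
  have cong: "(LINT x|M. f x * \<phi> x) = (LINT x|M. g x * \<phi> x)"
    if "locally_integrable a b f" "AE x in M. f x = g x" "\<phi> \<in> test_functions a b" for f g \<phi>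
  proof (rule integral_lebesgue_on_cong_AE)
    show "(\<lambda>x. f x * \<phi> x) \<in> borel_measurable M" using test_integrable[OF that(1,3)] by auto
    show "AE x in M. f x * \<phi> x = g x * \<phi> x" using that(2) by eventually_elim simp
  qed simp
  have loc: "locally_integrable a b u" "locally_integrable a b v"
    using assms(1) by (auto simp: is_weak_deriv_def)
  show ?thesis
    unfolding is_weak_deriv_def
  proof (intro conjI ballI)
    fix \<phi> assume \<phi>: "\<phi> \<in> test_functions a b"
    then show "(LINT x|M. u' x * (deriv ^^ n) \<phi> x) = (-1) ^ n * (LINT x|M. v' x * \<phi> x)"
      using cong[OF loc(1) assms(2) test_functions_higher_deriv[OF \<phi>]] cong[OF loc(2) assms(3) \<phi>] assms(1)
      by (auto simp: is_weak_deriv_def)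
  qed (use loc assms locally_integrable_AE in blast)+
qed

lemma is_weak_deriv_0: "locally_integrable a b u \<Longrightarrow> is_weak_deriv a b 0 u u"
  by (simp add: is_weak_deriv_def)

lemma is_weak_deriv_weak_deriv: "is_weak_deriv a b n u v \<Longrightarrow> is_weak_deriv a b n u (weak_deriv a b n u)"
  unfolding weak_deriv_def by (rule someI[where P = "is_weak_deriv a b n u"])

text \<open>\<open>weak_deriv\<close> is a choice among representatives; facts about a concrete
  derivative are transferred to it this way.\<close>

lemma weak_deriv_AE: "is_weak_deriv a b n u v \<Longrightarrow> AE x in M. v x = weak_deriv a b n u x"
  using is_weak_deriv_unique is_weak_deriv_weak_deriv by blast

lemma K_deriv_test:
  assumes "\<phi> \<in> test_functions a b" "x \<in> {a..b}"
  shows "K (deriv \<phi>) x = \<phi> x"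
proof -
  obtain c d where cd: "a < c" "c < d" "d < b" "\<And>x. x \<notin> {c..d} \<Longrightarrow> \<phi> x = 0"
    using assms by (auto simp: test_functions_iff)
  have "(\<phi> has_real_derivative deriv \<phi> y) (at y within {a..x})" for y
    using assms(1) smooth_real_DERIV unfolding test_functions_iff
    by (blast intro: has_field_derivative_at_within)
  then have "(deriv \<phi> has_integral \<phi> x - \<phi> a) {a..x}"
    using assms(2) by (intro fundamental_theorem_of_calculus)
     (auto simp: has_real_derivative_iff_has_vector_derivative[symmetric])
  moreover have "\<phi> a = 0" using cd by auto
  ultimately show ?thesis
    using K_eq_integral(2)[OF L2_integrable[OF test_L2[OF test_functions_deriv[OF assms(1)]]] assms(2)]
    by (simp add: integral_unique)
qed

lemma integral_deriv_test:
  assumes "\<phi> \<in> test_functions a b"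
  shows "integral\<^sup>L M (deriv \<phi>) = 0"
proof -
  obtain c d where "a < c" "c < d" "d < b" "\<And>x. x \<notin> {c..d} \<Longrightarrow> \<phi> x = 0"
    using assms by (auto simp: test_functions_iff)
  then have "\<phi> b = 0" by auto
  then show ?thesis
    using K_at_b[OF L2_integrable[OF test_L2[OF test_functions_deriv[OF assms]]]] K_deriv_test[OF assms, of b] ab
    by simp
qed

lemma ip_K_deriv_test:
  assumes "v \<in> L2" "\<phi> \<in> test_functions a b"
  shows "ip (K v) (deriv \<phi>) = - ip v \<phi>"
proof -
  have \<phi>': "deriv \<phi> \<in> L2" using assms test_L2 test_functions_deriv by blast
  have "ip v (K (deriv \<phi>)) = ip v \<phi>"
    unfolding L2_inner_def using K_deriv_test[OF assms(2)]
    by (intro Bochner_Integration.integral_cong) auto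
  then show ?thesis
    using K_parts_integrable[OF L2_integrable[OF assms(1)] L2_integrable[OF \<phi>']] integral_deriv_test[OF assms(2)]
    by simp
qed

text \<open>This is how the error of \<open>Q_proj\<close>, which is a K-image, inherits its
  derivatives from the error one level below.\<close>

lemma is_weak_deriv_K:
  assumes "v \<in> L2" "AE x in M. u x = c + K v x" "is_weak_deriv a b n v w"
  shows "is_weak_deriv a b (Suc n) u w"
proof (rule is_weak_deriv_AE)
  show "AE x in M. c + K v x = u x" using assms(2) by eventually_elim simp
  show "AE x in M. w x = w x" by simp
  have L2: "(\<lambda>x. c + K v x) \<in> L2" using assms by auto
  show "is_weak_deriv a b (Suc n) (\<lambda>x. c + K v x) w"
    unfolding is_weak_deriv_def
  proof (intro conjI ballI)
    show "locally_integrable a b w" using assms by (simp add: is_weak_deriv_def)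
    show "locally_integrable a b (\<lambda>x. c + K v x)" using L2 by (rule L2_locally_integrable)
    fix \<phi> assume \<phi>: "\<phi> \<in> test_functions a b"
    let ?\<psi> = "(deriv ^^ n) \<phi>"
    have \<psi>: "?\<psi> \<in> test_functions a b" using \<phi> by (rule test_functions_higher_deriv)
    then have \<psi>': "deriv ?\<psi> \<in> L2" using test_L2 test_functions_deriv by blast
    have "(LINT x|M. (c + K v x) * (deriv ^^ Suc n) \<phi> x) = c * integral\<^sup>L M (deriv ?\<psi>) + ip (K v) (deriv ?\<psi>)"
      using L2_mult_integrable[OF L2_K[OF assms(1)] \<psi>'] L2_integrable[OF \<psi>']
      by (simp add: distrib_right L2_inner_def)
    also have "\<dots> = - (LINT x|M. v x * ?\<psi> x)"
      using ip_K_deriv_test[OF assms(1) \<psi>] integral_deriv_test[OF \<psi>] by (simp add: L2_inner_def)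
    also have "\<dots> = (-1) ^ Suc n * (LINT x|M. w x * \<phi> x)"
      using assms(3) \<phi> by (simp add: is_weak_deriv_def)
    finally show "(LINT x|M. (c + K v x) * (deriv ^^ Suc n) \<phi> x) = (-1) ^ Suc n * (LINT x|M. w x * \<phi> x)" .
  qed
qed

text \<open>The primitive of \<eta> from a vanishes before the support; zero mean makes it vanish
  behind the support as well.\<close>

lemma test_function_antiderivative:
  assumes \<eta>: "\<eta> \<in> test_functions a b" and zero: "integral\<^sup>L M \<eta> = 0"
  obtains \<Phi> where "\<Phi> \<in> test_functions a b" "deriv \<Phi> = \<eta>"
proof -
  obtain c d where cd: "a < c" "c < d" "d < b" "\<And>x. x \<notin> {c..d} \<Longrightarrow> \<eta> x = 0" and cont: "\<And>S. continuous_on S \<eta>"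
    using test_function_support[OF \<eta>] by metis
  define \<Phi> where "\<Phi> x = (if x \<le> a then 0 else integral {a..x} \<eta>)" for x
  have left: "\<Phi> x = 0" if "x < c" for x
  proof -
    have "integral {a..x} \<eta> = integral {a..x} (\<lambda>_. 0)"
      using cd that by (intro Henstock_Kurzweil_Integration.integral_cong) auto
    then show ?thesis by (simp add: \<Phi>_def)
  qed
  have right: "\<Phi> x = 0" if "x > d" for x
  proof -
    have "(\<eta> has_integral integral {c..d} \<eta>) {c..d}"
      by (intro integrable_integral integrable_continuous_interval cont)
    then have *: "(\<eta> has_integral integral {c..d} \<eta>) {a..y}" if "y \<ge> d" for y
      by (rule has_integral_on_superset) (use cd that in auto)
    have "integral\<^sup>L M \<eta> = integral {a..b} \<eta>"
      using test_L2[OF \<eta>] by (intro integral_lebesgue_on_Icc L2_integrable)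
    then have "integral {c..d} \<eta> = 0" using *[of b] zero cd by (simp add: integral_unique)
    then show ?thesis using *[of x] that by (simp add: \<Phi>_def integral_unique)
  qed
  have D: "(\<Phi> has_real_derivative \<eta> x) (at x)" for x
  proof (cases "x < c")
    case True
    then have "eventually (\<lambda>y. y < c) (nhds x)" by (intro order_tendstoD[OF filterlim_ident])
    then have ev: "eventually (\<lambda>y. \<Phi> y = 0) (nhds x)" by eventually_elim (rule left)
    have "(\<Phi> has_real_derivative 0) (at x)" using DERIV_cong_ev[OF refl ev refl, of 0] by simp
    then show ?thesis using True cd by auto
  next
    case False
    then have x: "x > a" using cd by simp
    have "((\<lambda>y. integral {a..y} \<eta>) has_real_derivative \<eta> x) (at x within {a..x + 1})"
      using x by (intro integral_has_real_derivative cont) auto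
    then have 1: "((\<lambda>y. integral {a..y} \<eta>) has_real_derivative \<eta> x) (at x)"
      using x by (simp add: at_within_Icc_at)
    have "eventually (\<lambda>y. y > a) (nhds x)" using x by (intro order_tendstoD[OF filterlim_ident])
    then have ev: "eventually (\<lambda>y. \<Phi> y = integral {a..y} \<eta>) (nhds x)"
      by eventually_elim (simp add: \<Phi>_def)
    show ?thesis using DERIV_cong_ev[OF refl ev refl] 1 by blast
  qed
  have "smooth_real \<Phi>" using D \<eta> by (intro smooth_realI[of \<Phi> \<eta>]) (auto simp: test_functions_iff)
  moreover have "\<Phi> x = 0" if "x \<notin> {c..d}" for x using that left right by force
  ultimately have "\<Phi> \<in> test_functions a b" using cd unfolding test_functions_iff by blast
  moreover have "deriv \<Phi> = \<eta>" using DERIV_imp_deriv[OF D] by auto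
  ultimately show ?thesis by (rule that)
qed

text \<open>Subtracting a multiple of one fixed bump \<open>\<psi>\<^sub>0\<close> with nonzero
  integral gives any test function mean zero, which makes it the derivative of a test function.
  Hence w - c is orthogonal to all test functions.\<close>

lemma du_Bois_Reymond:
  assumes w: "locally_integrable a b w"
    and orth: "\<And>\<phi>. \<phi> \<in> test_functions a b \<Longrightarrow> (LINT x|M. w x * deriv \<phi> x) = 0"
  shows "\<exists>c. AE x in M. w x = c"
proof -
  obtain d\<^sub>1 where "a < d\<^sub>1" "d\<^sub>1 < b" using ab dense by blast
  then obtain c\<^sub>1 where cd: "a < c\<^sub>1" "c\<^sub>1 < d\<^sub>1" "d\<^sub>1 < b" using dense by blast
  define \<psi>\<^sub>0 where "\<psi>\<^sub>0 = plateau c\<^sub>1 d\<^sub>1 0"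
  have \<psi>\<^sub>0: "\<psi>\<^sub>0 \<in> test_functions a b" unfolding \<psi>\<^sub>0_def using cd by (rule plateau_test_function)
  define I where "I = integral\<^sup>L M \<psi>\<^sub>0"
  \<comment> \<open>If I were zero, the open interval on which \<open>\<psi>\<^sub>0\<close> is
    positive would be a null set.\<close>
  have "I \<noteq> 0"
  proof
    assume "I = 0"
    then have "AE x in M. \<psi>\<^sub>0 x = 0"
      unfolding I_def using L2_integrable[OF test_L2[OF \<psi>\<^sub>0]] plateau_bounds
      by (subst (asm) integral_nonneg_eq_0_iff_AE) (auto simp: \<psi>\<^sub>0_def)
    then have "AE x in lebesgue. x \<in> {a<..<b} \<longrightarrow> \<psi>\<^sub>0 x = 0" by (subst (asm) AE_lebesgue_on_iff) auto
    then have ae: "AE x in lebesgue. x \<in> {c\<^sub>1<..<d\<^sub>1} \<longrightarrow> x \<in> {}"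
    proof eventually_elim
      fix x assume "x \<in> {a<..<b} \<longrightarrow> \<psi>\<^sub>0 x = 0"
      then show "x \<in> {c\<^sub>1<..<d\<^sub>1} \<longrightarrow> x \<in> {}"
        using plateau_pos[of c\<^sub>1 x d\<^sub>1 0] cd by (auto simp: \<psi>\<^sub>0_def)
    qed
    obtain e where "e \<in> {c\<^sub>1<..<d\<^sub>1}" using dense[OF cd(2)] by auto
    then show False using mem_closed_if_AE_lebesgue_open[OF open_greaterThanLessThan closed_empty ae] by simp
  qed
  \<comment> \<open>The only possible value, found by testing w = c against
    \<open>\<psi>\<^sub>0\<close>.\<close>
  define c where "c = (LINT x|M. w x * \<psi>\<^sub>0 x) / I"
  have "AE x in M. w x - c = 0"
  proof (rule fundamental_lemma)
    show "locally_integrable a b (\<lambda>x. w x - c)"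
      by (intro locally_integrable_diff w L2_locally_integrable L2_const)
    fix \<psi> assume \<psi>: "\<psi> \<in> test_functions a b"
    define k where "k = - (integral\<^sup>L M \<psi> / I)"
    note int = L2_integrable[OF test_L2[OF \<psi>]] L2_integrable[OF test_L2[OF \<psi>\<^sub>0]]
    note wint = test_integrable[OF w \<psi>] test_integrable[OF w \<psi>\<^sub>0]
    have "integral\<^sup>L M (\<lambda>x. \<psi> x + k * \<psi>\<^sub>0 x) = 0"
      using int \<open>I \<noteq> 0\<close> by (simp add: k_def I_def)
    then obtain \<Phi> where "\<Phi> \<in> test_functions a b" "deriv \<Phi> = (\<lambda>x. \<psi> x + k * \<psi>\<^sub>0 x)"
      using test_function_antiderivative[OF test_functions_linear[OF \<psi> \<psi>\<^sub>0]] by metis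
    then have "0 = (LINT x|M. w x * (\<psi> x + k * \<psi>\<^sub>0 x))" using orth[of \<Phi>] by simp
    also have "\<dots> = (LINT x|M. w x * \<psi> x + k * (w x * \<psi>\<^sub>0 x))" by (simp add: algebra_simps)
    also have "\<dots> = (LINT x|M. w x * \<psi> x) + k * (LINT x|M. w x * \<psi>\<^sub>0 x)" using wint by simp
    finally have "(LINT x|M. w x * \<psi> x) = c * integral\<^sup>L M \<psi>" by (simp add: k_def c_def)
    then show "(LINT x|M. (w x - c) * \<psi> x) = 0" using int wint by (simp add: left_diff_distrib)
  qed
  then show ?thesis by auto
qed

text \<open>Both u and K v have weak derivative v, so du Bois-Reymond applies to their
  difference.\<close>

lemma weak_deriv_primitive:
  assumes "u \<in> L2" "v \<in> L2" "is_weak_deriv a b 1 u v"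
  shows "\<exists>c. AE x in M. u x = c + K v x"
proof -
  have "\<exists>c. AE x in M. u x - K v x = c"
  proof (rule du_Bois_Reymond)
    show "locally_integrable a b (\<lambda>x. u x - K v x)"
      using assms by (intro L2_locally_integrable) auto
    fix \<phi> assume \<phi>: "\<phi> \<in> test_functions a b"
    then have \<phi>': "deriv \<phi> \<in> L2" using test_L2 test_functions_deriv by blast
    have "(LINT x|M. (u x - K v x) * deriv \<phi> x) = ip u (deriv \<phi>) - ip (K v) (deriv \<phi>)"
      using ip_diff_left[OF \<phi>' assms(1) L2_K[OF assms(2)]] by (simp add: L2_inner_def)
    also have "\<dots> = 0"
      using assms(3) \<phi> ip_K_deriv_test[OF assms(2) \<phi>] by (simp add: is_weak_deriv_def L2_inner_def)
    finally show "(LINT x|M. (u x - K v x) * deriv \<phi> x) = 0" .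
  qed
  then obtain c where "AE x in M. u x - K v x = c" by blast
  then have "AE x in M. u x = c + K v x" by eventually_elim simp
  then show ?thesis by blast
qed

text \<open>The zero set is closed; a closed set containing almost every point of an open interval
  contains all of it, and the end points follow by closure.\<close>

lemma continuous_AE_zero:
  fixes g :: "real \<Rightarrow> real"
  assumes "continuous_on {a..b} g" "AE x in M. g x = 0" "x \<in> {a..b}"
  shows "g x = 0"
proof -
  let ?C = "{x \<in> {a..b}. g x = 0}"
  have C: "closed ?C" using continuous_closed_preimage_constant[OF assms(1) closed_atLeastAtMost] .
  have ae: "AE x \<in> {a<..<b} in lebesgue. x \<in> ?C"
    using assms(2) by (subst (asm) AE_lebesgue_on_iff) (auto elim: eventually_mono)
  have "y \<in> ?C" if "y \<in> {a<..<b}" for y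
    using mem_closed_if_AE_lebesgue_open[OF open_greaterThanLessThan C ae that] .
  then have "{a<..<b} \<subseteq> ?C" by blast
  then have "closure {a<..<b} \<subseteq> ?C" using C by (rule closure_minimal)
  then show ?thesis using assms(3) ab by auto
qed

text \<open>Continuous representatives are unique on [a, b], end points included, so the choice in
  \<open>cont_rep\<close> is immaterial there; this gives u(a) its meaning.\<close>

lemma cont_rep_eq:
  assumes "continuous_on {a..b} g" "AE x in M. u x = g x" "x \<in> {a..b}"
  shows "cont_rep a b u x = g x"
proof -
  have "continuous_on {a..b} (cont_rep a b u) \<and> (AE x in M. u x = cont_rep a b u x)"
    unfolding cont_rep_def by (rule someI[of _ g]) (use assms in auto)
  then have "continuous_on {a..b} (\<lambda>x. cont_rep a b u x - g x)" "AE x in M. cont_rep a b u x - g x = 0"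
    using assms by (auto intro: continuous_on_diff)
  then show ?thesis using continuous_AE_zero assms(3) by fastforce
qed

section \<open>Sobolev functions\<close>

lemma sobolev_weak_deriv:
  assumes "u \<in> sobolev a b r"
  shows "is_weak_deriv a b r u (weak_deriv a b r u)" "weak_deriv a b r u \<in> L2"
proof -
  obtain v where v: "v \<in> L2" "is_weak_deriv a b r u v"
  proof (cases "r = 0")
    case True
    then show ?thesis using assms that[of u] is_weak_deriv_0[OF L2_locally_integrable] by (simp add: sobolev_def)
  next
    case False
    then have "r \<in> {1..r}" by simp
    then show ?thesis using assms that unfolding sobolev_def by blast
  qed
  show "is_weak_deriv a b r u (weak_deriv a b r u)" using v(2) by (rule is_weak_deriv_weak_deriv)
  show "weak_deriv a b r u \<in> L2" using v(1) weak_deriv_AE[OF v(2)] by (rule L2_AE)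
qed

lemma sobolev_mono: "u \<in> sobolev a b r \<Longrightarrow> r' \<le> r \<Longrightarrow> u \<in> sobolev a b r'"
  by (auto simp: sobolev_def)

lemma sobolev_L2: "u \<in> sobolev a b r \<Longrightarrow> u \<in> L2"
  by (simp add: sobolev_def)

lemma sobolev_Suc:
  assumes u: "u \<in> sobolev a b (Suc r)"
  defines "v \<equiv> weak_deriv a b 1 u"
  shows "v \<in> sobolev a b r" "AE x in M. u x = cont_rep a b u a + K v x"
    "AE x in M. weak_deriv a b r v x = weak_deriv a b (Suc r) u x"
proof -
  have "u \<in> sobolev a b 1" using sobolev_mono[OF u] by simp
  note v = sobolev_weak_deriv[OF this, folded v_def]
  \<comment> \<open>Testing the equation for v with the n-th derivative of \<phi>, again a test
    function, turns a derivative of u of order n + 1 into one of v of order n.\<close>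
  have higher: "is_weak_deriv a b n v w" if "is_weak_deriv a b (Suc n) u w" for n w
    unfolding is_weak_deriv_def
  proof (intro conjI ballI)
    show "locally_integrable a b v" "locally_integrable a b w"
      using v that by (auto simp: is_weak_deriv_def)
    fix \<phi> assume \<phi>: "\<phi> \<in> test_functions a b"
    have "(LINT x|M. v x * (deriv ^^ n) \<phi> x) = - (LINT x|M. u x * deriv ((deriv ^^ n) \<phi>) x)"
      using v(1) test_functions_higher_deriv[OF \<phi>, of n] by (simp add: is_weak_deriv_def)
    also have "\<dots> = (-1) ^ n * (LINT x|M. w x * \<phi> x)"
      using that \<phi> by (simp add: is_weak_deriv_def)
    finally show "(LINT x|M. v x * (deriv ^^ n) \<phi> x) = (-1) ^ n * (LINT x|M. w x * \<phi> x)" .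
  qed
  show "v \<in> sobolev a b r"
    unfolding sobolev_def
  proof (intro CollectI conjI ballI)
    fix n assume "n \<in> {1..r}"
    then have "Suc n \<in> {1..Suc r}" by simp
    then obtain w where "w \<in> L2" "is_weak_deriv a b (Suc n) u w" using u unfolding sobolev_def by blast
    then show "\<exists>w\<in>L2. is_weak_deriv a b n v w" using higher by blast
  qed (rule v)
  obtain c where c: "AE x in M. u x = c + K v x"
    using weak_deriv_primitive[OF sobolev_L2[OF u] v(2,1)] by blast
  \<comment> \<open>K v vanishes at a, so the constant of integration is u(a).\<close>
  have "cont_rep a b u a = c + K v a"
    using ab c by (intro cont_rep_eq continuous_intros K_continuous L2_integrable v) auto
  then show "AE x in M. u x = cont_rep a b u a + K v x" using c by simp
  show "AE x in M. weak_deriv a b r v x = weak_deriv a b (Suc r) u x"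
    using weak_deriv_AE[OF higher[OF sobolev_weak_deriv(1)[OF u]]] by eventually_elim simp
qed

end

section \<open>Spline spaces and projections\<close>

lemma degree_linear_le: "degree P \<le> p \<Longrightarrow> degree Q \<le> p \<Longrightarrow> degree (P + smult c Q) \<le> p"
  for P Q :: "real poly"
  by (intro degree_add_le) (auto intro: order_trans[OF degree_smult_le])

lemma C_spaceI:
  assumes "k \<noteq> -1" "\<And>x. x \<in> {a..b} \<Longrightarrow> D 0 x = f x"
    "\<And>i x. i < nat k \<Longrightarrow> x \<in> {a..b} \<Longrightarrow> (D i has_real_derivative D (Suc i) x) (at x within {a..b})"
    "\<And>i. i \<le> nat k \<Longrightarrow> continuous_on {a..b} (D i)"
  shows "f \<in> C_space k a b"
  using assms(1) unfolding C_space_def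
  by (simp del: atLeastAtMost_iff) (use assms(2-) in blast)

lemma C_space_linear:
  assumes "f \<in> C_space k a b" "g \<in> C_space k a b"
  shows "(\<lambda>x. f x + c * g x) \<in> C_space k a b"
proof (cases "k = -1")
  case True
  have f: "bounded (f ` {a..b})" "piecewise_cont a b f" and g: "bounded (g ` {a..b})" "piecewise_cont a b g"
    using assms True by (auto simp: C_space_def)
  obtain B C where BC: "\<And>x. x \<in> {a..b} \<Longrightarrow> \<bar>f x\<bar> \<le> B" "\<And>x. x \<in> {a..b} \<Longrightarrow> \<bar>g x\<bar> \<le> C"
    using f(1) g(1) unfolding bounded_iff real_norm_def by (metis imageI)
  have lim: "\<exists>y. ((\<lambda>x. f x + c * g x) \<longlongrightarrow> y) F"
    if "\<exists>y. (f \<longlongrightarrow> y) F" "\<exists>y. (g \<longlongrightarrow> y) F" for F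
  proof -
    obtain y z where "(f \<longlongrightarrow> y) F" "(g \<longlongrightarrow> z) F" using \<open>\<exists>y. (f \<longlongrightarrow> y) F\<close> \<open>\<exists>y. (g \<longlongrightarrow> y) F\<close> by blast
    then have "((\<lambda>x. f x + c * g x) \<longlongrightarrow> y + c * z) F" by (intro tendsto_intros)
    then show ?thesis by blast
  qed
  have "\<bar>f x + c * g x\<bar> \<le> B + \<bar>c\<bar> * C" if "x \<in> {a..b}" for x
  proof -
    have "\<bar>f x + c * g x\<bar> \<le> \<bar>f x\<bar> + \<bar>c\<bar> * \<bar>g x\<bar>" using abs_triangle_ineq[of "f x" "c * g x"] by (simp add: abs_mult)
    also have "\<dots> \<le> B + \<bar>c\<bar> * C" by (intro add_mono mult_left_mono BC that) auto
    finally show ?thesis .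
  qed
  then have "bounded ((\<lambda>x. f x + c * g x) ` {a..b})" unfolding bounded_iff real_norm_def by blast
  moreover have "piecewise_cont a b (\<lambda>x. f x + c * g x)"
    unfolding piecewise_cont_def
  proof (intro conjI ballI)
    have "{x \<in> {a..b}. \<not> continuous (at x within {a..b}) (\<lambda>x. f x + c * g x)} \<subseteq>
        {x \<in> {a..b}. \<not> continuous (at x within {a..b}) f} \<union> {x \<in> {a..b}. \<not> continuous (at x within {a..b}) g}"
      by (auto intro: continuous_add continuous_mult_left)
    then show "finite {x \<in> {a..b}. \<not> continuous (at x within {a..b}) (\<lambda>x. f x + c * g x)}"
      using f(2) g(2) by (rule_tac finite_subset) (auto simp: piecewise_cont_def)
    show "\<exists>y. ((\<lambda>x. f x + c * g x) \<longlongrightarrow> y) (at_left x)" if "x \<in> {a<..b}" for x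
      using f(2) g(2) that unfolding piecewise_cont_def by (intro lim) auto
    show "\<exists>y. ((\<lambda>x. f x + c * g x) \<longlongrightarrow> y) (at_right x)" if "x \<in> {a..<b}" for x
      using f(2) g(2) that unfolding piecewise_cont_def by (intro lim) auto
  qed
  ultimately show ?thesis using True by (simp add: C_space_def)
next
  case False
  obtain D E where D: "\<forall>x\<in>{a..b}. D 0 x = f x"
      "\<forall>i<nat k. \<forall>x\<in>{a..b}. (D i has_real_derivative D (Suc i) x) (at x within {a..b})"
      "\<forall>i\<le>nat k. continuous_on {a..b} (D i)"
    and E: "\<forall>x\<in>{a..b}. E 0 x = g x"
      "\<forall>i<nat k. \<forall>x\<in>{a..b}. (E i has_real_derivative E (Suc i) x) (at x within {a..b})"
      "\<forall>i\<le>nat k. continuous_on {a..b} (E i)"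
    using assms False unfolding C_space_def by auto
  let ?F = "\<lambda>i x. D i x + c * E i x"
  have "\<forall>x\<in>{a..b}. ?F 0 x = f x + c * g x" using D E by simp
  moreover have "\<forall>i<nat k. \<forall>x\<in>{a..b}. (?F i has_real_derivative ?F (Suc i) x) (at x within {a..b})"
    using D E by (intro allI impI ballI DERIV_add DERIV_cmult) auto
  moreover have "\<forall>i\<le>nat k. continuous_on {a..b} (?F i)"
    using D E by (intro allI impI continuous_intros) auto
  ultimately show ?thesis using False by (intro C_spaceI[of k _ _ ?F]) blast+
qed

lemma C_space_poly: "poly P \<in> C_space k a b"
proof (cases "k = -1")
  case True
  have "bounded (poly P ` {a..b})"
    by (intro compact_imp_bounded compact_continuous_image continuous_intros) auto
  moreover have "piecewise_cont a b (poly P)"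
    unfolding piecewise_cont_def
  proof (intro conjI ballI)
    have "{x \<in> {a..b}. \<not> continuous (at x within {a..b}) (poly P)} = {}"
      using continuous_at_imp_continuous_at_within[OF poly_isCont] by blast
    then show "finite {x \<in> {a..b}. \<not> continuous (at x within {a..b}) (poly P)}"
      by (simp only: finite.emptyI)
    show "\<exists>y. (poly P \<longlongrightarrow> y) (at_left x)" for x
      by (intro exI[of _ "poly P x"] tendsto_intros)
    show "\<exists>y. (poly P \<longlongrightarrow> y) (at_right x)" for x
      by (intro exI[of _ "poly P x"] tendsto_intros)
  qed
  ultimately show ?thesis using True by (simp add: C_space_def)
next
  case False
  show ?thesis
  proof (rule C_spaceI[OF False])
    show "(poly ((pderiv ^^ i) P) has_real_derivative poly ((pderiv ^^ Suc i) P) x) (at x within {a..b})" for i x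
      unfolding funpow.simps comp_apply by (rule has_field_derivative_at_within[OF poly_DERIV])
    show "continuous_on {a..b} (poly ((pderiv ^^ i) P))" for i by (intro continuous_intros)
  qed simp
qed

locale knots = open_interval +
  fixes N :: nat and \<xi> :: "nat \<Rightarrow> real"
  assumes knot_seq: "knot_seq a b N \<xi>"
begin

abbreviation S :: "nat \<Rightarrow> int \<Rightarrow> (real \<Rightarrow> real) set" where "S \<equiv> spline_space a b N \<xi>"
abbreviation h :: real where "h \<equiv> mesh_size N \<xi>"
abbreviation I :: "nat \<Rightarrow> real set" where "I \<equiv> knot_interval N \<xi>"

lemma knot_ends: "\<xi> 0 = a" "\<xi> (Suc N) = b"
  using knot_seq by (auto simp: knot_seq_def)

lemma knot_step: "j \<le> N \<Longrightarrow> \<xi> j < \<xi> (Suc j)"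
  using knot_seq by (auto simp: knot_seq_def)

lemma knot_mono: "i \<le> j \<Longrightarrow> j \<le> Suc N \<Longrightarrow> \<xi> i \<le> \<xi> j"
proof (induction j rule: dec_induct)
  case (step n)
  then show ?case using knot_step[of n] by simp
qed simp

lemma knot_bounds: "j \<le> Suc N \<Longrightarrow> a \<le> \<xi> j \<and> \<xi> j \<le> b"
  using knot_mono[of 0 j] knot_mono[of j "Suc N"] by (simp add: knot_ends)

lemma mesh_step: "j \<le> N \<Longrightarrow> \<xi> (Suc j) - \<xi> j \<le> h"
  unfolding mesh_size_def by (intro Max_ge) auto

lemma mesh_nonneg: "0 \<le> h"
  using mesh_step[of 0] knot_step[of 0] by simp

lemma I_subset: "I j \<subseteq> {\<xi> j..\<xi> (Suc j)}"
  by (auto simp: knot_interval_def)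

lemma I_interior: "{\<xi> j<..<\<xi> (Suc j)} \<subseteq> I j"
  by (auto simp: knot_interval_def)

lemma I_subset_ab: "j \<le> N \<Longrightarrow> I j \<subseteq> {a..b}"
  using I_subset[of j] knot_bounds[of j] knot_bounds[of "Suc j"] by force

lemma I_down: "x \<in> I j \<Longrightarrow> {\<xi> j..x} \<subseteq> I j"
  by (auto simp: knot_interval_def split: if_splits)

text \<open>\<open>knot_interval\<close> assigns an interior knot to the interval on its right; for
  left limits the point has to belong to the interval on its left.\<close>

lemma knot_left_interval:
  assumes "x \<in> {a<..b}"
  obtains j where "j \<le> N" "\<xi> j < x" "x \<le> \<xi> (Suc j)"
proof -
  define j where "j = (LEAST j. x \<le> \<xi> (Suc j))"
  have ex: "x \<le> \<xi> (Suc N)" using assms by (simp add: knot_ends)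
  then have j: "x \<le> \<xi> (Suc j)" "j \<le> N" unfolding j_def by (rule LeastI, rule Least_le)
  have "\<xi> j < x"
  proof (cases j)
    case 0
    then show ?thesis using assms by (simp add: knot_ends)
  next
    case (Suc i)
    then show ?thesis using not_less_Least[of i "\<lambda>j. x \<le> \<xi> (Suc j)"] j_def by force
  qed
  then show ?thesis using j that by blast
qed

lemma I_cover:
  assumes "x \<in> {a..b}"
  obtains j where "j \<le> N" "x \<in> I j"
proof (cases "x = a")
  case True
  then have "x \<in> I 0" using knot_step[of 0] by (simp add: knot_interval_def knot_ends)
  then show ?thesis using that by blast
next
  case False
  then have "x \<in> {a<..b}" using assms by simp
  then obtain j where j: "j \<le> N" "\<xi> j < x" "x \<le> \<xi> (Suc j)" by (rule knot_left_interval)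
  show ?thesis
  proof (cases "x = \<xi> (Suc j) \<and> j < N")
    case True
    then have "x \<in> I (Suc j)" using knot_step[of "Suc j"] by (auto simp: knot_interval_def)
    then show ?thesis using True that[of "Suc j"] by simp
  next
    case False
    then have "x \<in> I j" using j by (auto simp: knot_interval_def)
    then show ?thesis using j that by blast
  qed
qed

lemma I_disjoint:
  assumes "x \<in> I i" "x \<in> I j" "i \<le> N" "j \<le> N"
  shows "i = j"
proof -
  have "False" if "x \<in> I i" "x \<in> I j" "i < j" "j \<le> N" for i j
    using that knot_mono[of "Suc i" j] I_subset[of j] by (auto simp: knot_interval_def split: if_splits)
  then show ?thesis using assms by (metis linorder_neqE_nat)
qed

section \<open>Piecewise polynomials\<close>

definition I_index :: "real \<Rightarrow> nat" where
  "I_index x = (SOME j. j \<le> N \<and> x \<in> I j)"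

lemma I_index: "j \<le> N \<Longrightarrow> x \<in> I j \<Longrightarrow> I_index x = j"
  unfolding I_index_def using I_disjoint by (intro some_equality) auto

definition piecewise :: "(nat \<Rightarrow> real poly) \<Rightarrow> real \<Rightarrow> real" where
  "piecewise z x = poly (z (I_index x)) x"

lemma piecewise_eq: "j \<le> N \<Longrightarrow> x \<in> I j \<Longrightarrow> piecewise z x = poly (z j) x"
  by (simp add: piecewise_def I_index)

lemma piecewise_eventually:
  assumes "j \<le> N"
  shows "x \<in> {\<xi> j<..<\<xi> (Suc j)} \<Longrightarrow> eventually (\<lambda>y. piecewise z y = poly (z j) y) (nhds x)"
    "x \<in> {\<xi> j<..\<xi> (Suc j)} \<Longrightarrow> eventually (\<lambda>y. piecewise z y = poly (z j) y) (at_left x)"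
    "x \<in> {\<xi> j..<\<xi> (Suc j)} \<Longrightarrow> eventually (\<lambda>y. piecewise z y = poly (z j) y) (at_right x)"
proof -
  have eq: "piecewise z y = poly (z j) y" if "y \<in> {\<xi> j<..<\<xi> (Suc j)}" for y
    using that I_interior piecewise_eq[OF assms] by blast
  show "x \<in> {\<xi> j<..<\<xi> (Suc j)} \<Longrightarrow> eventually (\<lambda>y. piecewise z y = poly (z j) y) (nhds x)"
    by (rule eventually_mono[OF eventually_nhds_in_open[OF open_greaterThanLessThan] eq])
  show "eventually (\<lambda>y. piecewise z y = poly (z j) y) (at_left x)" if "x \<in> {\<xi> j<..\<xi> (Suc j)}"
    by (rule eventually_mono[OF eventually_at_left_real[of "\<xi> j" x] eq]) (use that in auto)
  show "eventually (\<lambda>y. piecewise z y = poly (z j) y) (at_right x)" if "x \<in> {\<xi> j..<\<xi> (Suc j)}"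
    by (rule eventually_mono[OF eventually_at_right_real[of x "\<xi> (Suc j)"] eq]) (use that in auto)
qed

text \<open>For k = -1 nothing is imposed at the knots beyond one-sided limits, which polynomial
  pieces always have.\<close>

lemma piecewise_in_spline_space:
  assumes "\<And>j. j \<le> N \<Longrightarrow> degree (z j) \<le> p"
  shows "piecewise z \<in> S p (-1)"
proof -
  have "piecewise z ` {a..b} \<subseteq> (\<Union>j\<in>{..N}. poly (z j) ` {a..b})"
  proof
    fix y assume "y \<in> piecewise z ` {a..b}"
    then obtain x where x: "x \<in> {a..b}" "y = piecewise z x" by blast
    obtain j where "j \<le> N" "x \<in> I j" using I_cover[OF x(1)] .
    then show "y \<in> (\<Union>j\<in>{..N}. poly (z j) ` {a..b})" using x piecewise_eq[of j x z] by blast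
  qed
  moreover have "bounded (\<Union>j\<in>{..N}. poly (z j) ` {a..b})"
    by (intro bounded_UN finite_atMost ballI compact_imp_bounded compact_continuous_image continuous_intros) auto
  ultimately have bounded: "bounded (piecewise z ` {a..b})" by (rule bounded_subset[rotated])
  have "piecewise_cont a b (piecewise z)"
    unfolding piecewise_cont_def
  proof (intro conjI ballI)
    have "{x \<in> {a..b}. \<not> continuous (at x within {a..b}) (piecewise z)} \<subseteq> \<xi> ` {..Suc N}"
    proof (intro subsetI)
      fix x assume x: "x \<in> {x \<in> {a..b}. \<not> continuous (at x within {a..b}) (piecewise z)}"
      show "x \<in> \<xi> ` {..Suc N}"
      proof (cases "x = a")
        case True
        then show ?thesis using knot_ends by auto
      next
        case False
        then have "x \<in> {a<..b}" using x by simp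
        then obtain j where j: "j \<le> N" "\<xi> j < x" "x \<le> \<xi> (Suc j)" by (rule knot_left_interval)
        have "x = \<xi> (Suc j)"
        proof (rule ccontr)
          assume "x \<noteq> \<xi> (Suc j)"
          then have ev: "eventually (\<lambda>y. piecewise z y = poly (z j) y) (nhds x)"
            using j by (intro piecewise_eventually) auto
          have "isCont (piecewise z) x" using isCont_cong[OF ev] by simp
          then show False using x continuous_at_imp_continuous_at_within by blast
        qed
        then show ?thesis using j by auto
      qed
    qed
    then show "finite {x \<in> {a..b}. \<not> continuous (at x within {a..b}) (piecewise z)}"
      by (rule finite_subset) simp
  next
    fix x assume "x \<in> {a<..b}"
    then obtain j where j: "j \<le> N" "x \<in> {\<xi> j<..\<xi> (Suc j)}" by (rule knot_left_interval) auto
    have "(piecewise z \<longlongrightarrow> poly (z j) x) (at_left x)"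
      by (subst tendsto_cong[OF piecewise_eventually(2)[OF j]]) (intro tendsto_intros)
    then show "\<exists>y. (piecewise z \<longlongrightarrow> y) (at_left x)" by blast
  next
    fix x assume x: "x \<in> {a..<b}"
    then have "x \<in> {a..b}" by simp
    then obtain j where j: "j \<le> N" "x \<in> I j" by (rule I_cover)
    have "x \<in> {\<xi> j..<\<xi> (Suc j)}"
    proof (cases "j = N")
      case True
      then show ?thesis using x I_subset[of j] j knot_ends by auto
    qed (use j in \<open>auto simp: knot_interval_def\<close>)
    then have "(piecewise z \<longlongrightarrow> poly (z j) x) (at_right x)"
      by (subst tendsto_cong[OF piecewise_eventually(3)[OF j(1)]]) (auto intro: tendsto_intros)
    then show "\<exists>y. (piecewise z \<longlongrightarrow> y) (at_right x)" by blast
  qed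
  moreover have "\<exists>P. degree P \<le> p \<and> (\<forall>x\<in>I j. piecewise z x = poly P x)" if "j \<in> {0..N}" for j
    using assms that piecewise_eq by (intro exI[of _ "z j"]) auto
  ultimately show ?thesis using bounded by (simp add: spline_space_def C_space_def)
qed

lemma spline_pieces:
  assumes "s \<in> S p k"
  obtains P where "\<And>j. j \<le> N \<Longrightarrow> degree (P j) \<le> p" "\<And>j x. j \<le> N \<Longrightarrow> x \<in> I j \<Longrightarrow> s x = poly (P j) x"
proof -
  have "\<forall>j\<in>{0..N}. \<exists>P. degree P \<le> p \<and> (\<forall>x\<in>I j. s x = poly P x)"
    using assms by (auto simp: spline_space_def)
  from bchoice[OF this] obtain P where "\<forall>j\<in>{0..N}. degree (P j) \<le> p \<and> (\<forall>x\<in>I j. s x = poly (P j) x)"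
    by blast
  then show ?thesis by (intro that[of P]) auto
qed

lemma spline_linear:
  assumes "s \<in> S p k" "t \<in> S p k"
  shows "(\<lambda>x. s x + c * t x) \<in> S p k"
proof -
  obtain P where P: "\<And>j. j \<le> N \<Longrightarrow> degree (P j) \<le> p" "\<And>j x. j \<le> N \<Longrightarrow> x \<in> I j \<Longrightarrow> s x = poly (P j) x"
    using spline_pieces[OF assms(1)] by metis
  obtain Q where Q: "\<And>j. j \<le> N \<Longrightarrow> degree (Q j) \<le> p" "\<And>j x. j \<le> N \<Longrightarrow> x \<in> I j \<Longrightarrow> t x = poly (Q j) x"
    using spline_pieces[OF assms(2)] by metis
  have "\<exists>R. degree R \<le> p \<and> (\<forall>x\<in>I j. s x + c * t x = poly R x)" if "j \<in> {0..N}" for j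
    using P Q that by (intro exI[of _ "P j + smult c (Q j)"]) (auto intro: degree_linear_le)
  moreover have "(\<lambda>x. s x + c * t x) \<in> C_space k a b"
    using assms by (intro C_space_linear) (auto simp: spline_space_def)
  ultimately show ?thesis by (simp add: spline_space_def)
qed

lemma poly_in_spline_space: "degree P \<le> p \<Longrightarrow> poly P \<in> S p k"
  unfolding spline_space_def using C_space_poly by auto

lemma L2_indicator:
  assumes "f \<in> L2" "A \<in> sets lebesgue"
  shows "(\<lambda>x. indicat_real A x * f x) \<in> L2"
proof -
  have "A \<inter> {a<..<b} \<in> sets M" using assms(2) by (auto simp: sets_restrict_space)
  then have m: "indicat_real A \<in> borel_measurable M"
    by (intro borel_measurable_indicator') (auto simp: Int_def conj_commute)
  have "(\<lambda>x. indicat_real A x * f x) \<in> borel_measurable M" using m L2D(1)[OF assms(1)] by measurable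
  moreover have "integrable M (\<lambda>x. (indicat_real A x * f x)\<^sup>2)"
    by (rule Bochner_Integration.integrable_bound[OF L2D(2)[OF assms(1)]])
      (use calculation in \<open>auto simp: indicator_def\<close>)
  ultimately show ?thesis by (simp add: L2_space_def)
qed

lemma L2_sum: "finite A \<Longrightarrow> (\<And>j. j \<in> A \<Longrightarrow> f j \<in> L2) \<Longrightarrow> (\<lambda>x. \<Sum>j\<in>A. f j x) \<in> L2"
  by (induction A rule: finite_induct) auto

lemma L2_piecewise:
  assumes "\<And>j x. j \<le> N \<Longrightarrow> x \<in> I j \<Longrightarrow> s x = poly (P j) x"
  shows "s \<in> L2"
proof (rule L2_AE)
  have "I j \<in> sets lebesgue" for j by (simp add: knot_interval_def)
  then show "(\<lambda>x. \<Sum>j\<in>{..N}. indicat_real (I j) x * poly (P j) x) \<in> L2"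
    by (intro L2_sum L2_indicator) auto
  show "AE x in M. (\<Sum>j\<in>{..N}. indicat_real (I j) x * poly (P j) x) = s x"
  proof (rule AE_M_I)
    fix x assume "a < x" "x < b"
    then have "x \<in> {a..b}" by simp
    then obtain i where i: "i \<le> N" "x \<in> I i" by (rule I_cover)
    have "(\<Sum>j\<in>{..N}. indicat_real (I j) x * poly (P j) x) = (\<Sum>j\<in>{..N}. if j = i then poly (P i) x else 0)"
      using i I_disjoint by (intro sum.cong) (auto simp: indicator_def)
    then show "(\<Sum>j\<in>{..N}. indicat_real (I j) x * poly (P j) x) = s x" using i assms by simp
  qed
qed

lemma L2_spline: "s \<in> S p k \<Longrightarrow> s \<in> L2"
  by (rule spline_pieces) (auto intro: L2_piecewise)

text \<open>A piece of degree at most p with p + 1 zeros in its interval is zero. Finitely many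
  point evaluations thus stand in for a finite dimension of the spline space.\<close>

lemma spline_unisolvent:
  obtains X where "finite X" "\<And>s x. s \<in> S p k \<Longrightarrow> (\<And>y. y \<in> X \<Longrightarrow> s y = 0) \<Longrightarrow> x \<in> {a..b} \<Longrightarrow> s x = 0"
proof -
  have "\<exists>Y. finite Y \<and> Y \<subseteq> {\<xi> j<..<\<xi> (Suc j)} \<and> card Y = Suc p" if "j \<in> {0..N}" for j
    using infinite_arbitrarily_large[of "{\<xi> j<..<\<xi> (Suc j)}" "Suc p"] knot_step[of j] that
    by (auto simp: infinite_Ioo)
  then have "\<exists>Y. \<forall>j\<in>{0..N}. finite (Y j) \<and> Y j \<subseteq> {\<xi> j<..<\<xi> (Suc j)} \<and> card (Y j) = Suc p"
    by (intro bchoice) blast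
  then obtain Y where "\<forall>j\<in>{0..N}. finite (Y j) \<and> Y j \<subseteq> {\<xi> j<..<\<xi> (Suc j)} \<and> card (Y j) = Suc p"
    by blast
  then have Y: "\<And>j. j \<le> N \<Longrightarrow> finite (Y j) \<and> Y j \<subseteq> {\<xi> j<..<\<xi> (Suc j)} \<and> card (Y j) = Suc p"
    by simp
  show ?thesis
  proof (rule that[of "\<Union>j\<in>{..N}. Y j"])
    show "finite (\<Union>j\<in>{..N}. Y j)" using Y by auto
    fix s x assume s: "s \<in> S p k" and zero: "\<And>y. y \<in> (\<Union>j\<in>{..N}. Y j) \<Longrightarrow> s y = 0" and x: "x \<in> {a..b}"
    obtain P where P: "\<And>j. j \<le> N \<Longrightarrow> degree (P j) \<le> p" "\<And>j x. j \<le> N \<Longrightarrow> x \<in> I j \<Longrightarrow> s x = poly (P j) x"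
      using spline_pieces[OF s] by metis
    obtain j where j: "j \<le> N" "x \<in> I j" using I_cover[OF x] .
    have "P j = 0"
    proof (rule ccontr)
      assume nz: "P j \<noteq> 0"
      have "poly (P j) y = 0" if "y \<in> Y j" for y
      proof -
        have "y \<in> I j" using Y[OF j(1)] that I_interior by blast
        moreover have "s y = 0" using zero that j by auto
        ultimately show ?thesis using P(2)[OF j(1)] by simp
      qed
      then have "card (Y j) \<le> card {y. poly (P j) y = 0}"
        using poly_roots_finite[OF nz] by (intro card_mono) auto
      also have "\<dots> \<le> degree (P j)" using nz by (rule card_poly_roots_bound)
      finally show False using Y[OF j(1)] P(1)[OF j(1)] by simp
    qed
    then show "s x = 0" using P(2)[OF j] by simp
  qed
qed

text \<open>
  Orthogonal projections onto a space on which finitely many point evaluations separate elements,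
  by induction on the number of points: the functions vanishing at one of them form a subspace of
  codimension at most one.
\<close>

lemma orthogonal_projection_exists:
  assumes "finite X" "V \<subseteq> L2" "(\<lambda>x. 0) \<in> V"
    "\<And>s t c. s \<in> V \<Longrightarrow> t \<in> V \<Longrightarrow> (\<lambda>x. s x + c * t x) \<in> V"
    "\<And>s. s \<in> V \<Longrightarrow> (\<And>y. y \<in> X \<Longrightarrow> s y = 0) \<Longrightarrow> ip s s = 0" "u \<in> L2"
  shows "\<exists>s\<in>V. \<forall>v\<in>V. ip (\<lambda>x. u x - s x) v = 0"
  using assms
proof (induction X arbitrary: V u rule: finite_induct)
  case empty
  have "ip u v = 0" if "v \<in> V" for v
  proof -
    have "nrm v = 0" using empty.prems(4)[OF that] by (simp add: L2_norm_def)
    then show ?thesis using ip_Cauchy_Schwarz[of u v] empty.prems(1,5) that by auto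
  qed
  then show ?case using empty.prems(2) by force
next
  case (insert y X)
  define V' where "V' = {s \<in> V. s y = 0}"
  have IH: "\<exists>s\<in>V'. \<forall>v\<in>V'. ip (\<lambda>x. w x - s x) v = 0" if "w \<in> L2" for w
  proof (rule insert.IH)
    show "\<And>s. s \<in> V' \<Longrightarrow> (\<And>y. y \<in> X \<Longrightarrow> s y = 0) \<Longrightarrow> ip s s = 0"
      using insert.prems(4) by (auto simp: V'_def)
  qed (use insert.prems that in \<open>auto simp: V'_def\<close>)
  obtain s1 where s1: "s1 \<in> V'" "\<And>v. v \<in> V' \<Longrightarrow> ip (\<lambda>x. u x - s1 x) v = 0"
    using IH[OF insert.prems(5)] by blast
  show ?case
  proof (cases "V' = V")
    case True
    then show ?thesis using s1 by blast
  next
    case False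
    then obtain w where w: "w \<in> V" "w y \<noteq> 0" by (auto simp: V'_def)
    obtain s0 where s0: "s0 \<in> V'" "\<And>v. v \<in> V' \<Longrightarrow> ip (\<lambda>x. w x - s0 x) v = 0"
      using IH[of w] insert.prems(1) w by blast
    define e where "e = (\<lambda>x. w x - s0 x)"
    \<comment> \<open>e is orthogonal to V' and does not vanish at y, so V' and e together span
      V.\<close>
    have e: "e \<in> V" "e y \<noteq> 0" "\<And>v. v \<in> V' \<Longrightarrow> ip e v = 0"
      using insert.prems(3)[OF w(1), of s0 "-1"] s0 w by (auto simp: e_def V'_def)
    \<comment> \<open>The Fourier coefficient of u along e. If e is a null function, every inner
      product with it is zero and 0 serves as coefficient.\<close>
    define c where "c = (if ip e e = 0 then 0 else ip u e / ip e e)"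
    define s where "s = (\<lambda>x. s1 x + c * e x)"
    have L2: "u \<in> L2" "e \<in> L2" "s1 \<in> L2" "s \<in> L2"
      using insert.prems e s1 by (auto simp: V'_def s_def intro!: L2_add L2_scale)
    have sV: "s \<in> V" using insert.prems(3) s1 e by (auto simp: s_def V'_def)
    have "ip e s1 = 0" using e(3) s1 by blast
    then have "ip (\<lambda>x. u x - s x) e = ip u e - c * ip e e"
      using L2 by (simp add: ip_diff_left s_def ip_add_left L2_add L2_scale ip_scale_left ip_commute[of s1])
    also have "\<dots> = 0"
    proof (cases "ip e e = 0")
      case True
      then have "nrm e = 0" by (simp add: L2_norm_def)
      then have "ip u e = 0" using ip_Cauchy_Schwarz[of u e] L2 by simp
      then show ?thesis using True by simp
    qed (simp add: c_def)
    finally have ue: "ip (\<lambda>x. u x - s x) e = 0" .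
    have "ip (\<lambda>x. u x - s x) v = 0" if v: "v \<in> V" for v
    proof -
      \<comment> \<open>This multiple of e cancels the value at y, so v splits into an element of V'
        and a multiple of e.\<close>
      define v' where "v' = (\<lambda>x. v x + (- (v y / e y)) * e x)"
      have "v' \<in> V" unfolding v'_def by (rule insert.prems(3)[OF v e(1)])
      then have v': "v' \<in> V'" using e(2) by (simp add: v'_def V'_def)
      then have v'L2: "v' \<in> L2" using insert.prems(1) by (auto simp: V'_def)
      have "ip (\<lambda>x. u x - s x) v' = ip (\<lambda>x. (u x - s1 x) - c * e x) v'" by (simp add: s_def algebra_simps)
      also have "\<dots> = ip (\<lambda>x. u x - s1 x) v' - c * ip e v'"
        using L2 v'L2 by (simp add: ip_diff_left L2_diff L2_scale ip_scale_left)
      also have "\<dots> = 0" using s1(2)[OF v'] e(3)[OF v'] by simp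
      finally have 1: "ip (\<lambda>x. u x - s x) v' = 0" .
      have "ip (\<lambda>x. u x - s x) (\<lambda>x. v' x + (v y / e y) * e x)
          = ip (\<lambda>x. u x - s x) v' + (v y / e y) * ip (\<lambda>x. u x - s x) e"
        unfolding ip_scale_right[symmetric] using L2 v'L2 by (intro ip_add_right L2_diff L2_scale)
      then show ?thesis using 1 ue by (simp add: v'_def)
    qed
    then show ?thesis using sV by blast
  qed
qed

lemma spline_proj:
  assumes "u \<in> L2"
  shows "spline_proj a b N \<xi> p k u \<in> S p k"
    "\<And>v. v \<in> S p k \<Longrightarrow> ip (\<lambda>x. u x - spline_proj a b N \<xi> p k u x) v = 0"
proof -
  obtain X where X: "finite X" "\<And>s x. s \<in> S p k \<Longrightarrow> (\<And>y. y \<in> X \<Longrightarrow> s y = 0) \<Longrightarrow> x \<in> {a..b} \<Longrightarrow> s x = 0"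
    using spline_unisolvent[of p k] by metis
  have "\<exists>s\<in>S p k. \<forall>v\<in>S p k. ip (\<lambda>x. u x - s x) v = 0"
  proof (rule orthogonal_projection_exists[OF X(1)])
    have "(\<lambda>x. 0) = poly (0 :: real poly)" by auto
    then show "(\<lambda>x. 0) \<in> S p k" using poly_in_spline_space[of 0 p k] by simp
    fix s assume s: "s \<in> S p k" "\<And>y. y \<in> X \<Longrightarrow> s y = 0"
    then have "ip s s = ip (\<lambda>x. 0) (\<lambda>x. 0)"
      using X(2)[OF s] by (intro ip_AE L2_spline[OF s(1)] AE_M_I) auto
    then show "ip s s = 0" by (simp add: L2_inner_def)
  qed (use assms L2_spline spline_linear in auto)
  then have "\<exists>s. s \<in> S p k \<and> (\<forall>v\<in>S p k. ip (\<lambda>x. u x - s x) v = 0)" by blast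
  from someI_ex[OF this, folded spline_proj_def]
  show "spline_proj a b N \<xi> p k u \<in> S p k"
    "\<And>v. v \<in> S p k \<Longrightarrow> ip (\<lambda>x. u x - spline_proj a b N \<xi> p k u x) v = 0" by blast+
qed

text \<open>Through integration by parts this transfers orthogonality from g to K g. Each new piece
  is a primitive of the old one plus the value of \<open>K s\<close> at the left knot.\<close>

lemma K_spline:
  assumes s: "s \<in> S p k" and k: "-1 \<le> k"
  shows "K s \<in> S (Suc p) (k + 1)"
proof -
  have int: "integrable M s" using s by (intro L2_integrable L2_spline)
  note Ks = K_eq_integral[OF int]
  obtain P where P: "\<And>j. j \<le> N \<Longrightarrow> degree (P j) \<le> p" "\<And>j x. j \<le> N \<Longrightarrow> x \<in> I j \<Longrightarrow> s x = poly (P j) x"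
    using spline_pieces[OF s] by metis
  have pieces: "\<exists>R. degree R \<le> Suc p \<and> (\<forall>x\<in>I j. K s x = poly R x)" if "j \<in> {0..N}" for j
  proof -
    have j: "j \<le> N" using that by simp
    obtain Q where Q: "pderiv Q = P j" "poly Q (\<xi> j) = 0" "degree Q \<le> Suc (degree (P j))"
      using poly_antiderivative by blast
    have "K s x = poly ([:K s (\<xi> j):] + Q) x" if x: "x \<in> I j" for x
    proof -
      have ab: "a \<le> \<xi> j" "\<xi> j \<le> x" "x \<le> b" "\<xi> j \<le> b"
        using x I_subset[of j] I_subset_ab[OF j] knot_bounds[of j] j by auto
      have "s integrable_on {a..x}" using Ks(1) ab by (intro integrable_subinterval_real[OF Ks(1)]) auto
      then have "integral {a..x} s = integral {a..\<xi> j} s + integral {\<xi> j..x} s"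
        using ab by (intro Henstock_Kurzweil_Integration.integral_combine[symmetric]) auto
      moreover have "integral {\<xi> j..x} s = integral {\<xi> j..x} (poly (P j))"
        using I_down[OF x] P(2)[OF j] by (intro Henstock_Kurzweil_Integration.integral_cong) auto
      moreover have "\<dots> = poly Q x"
        using poly_int_pderiv[of "\<xi> j" x Q] ab Q by (simp add: poly_int_def)
      ultimately show ?thesis using ab Ks(2)[of x] Ks(2)[of "\<xi> j"] by simp
    qed
    moreover have "degree ([:K s (\<xi> j):] + Q) \<le> Suc p"
      using Q(3) P(1)[OF j] by (intro degree_add_le) auto
    ultimately show ?thesis by blast
  qed
  have "K s \<in> C_space (k + 1) a b"
  proof (cases "k = -1")
    case True
    then show ?thesis using K_continuous[OF int] by (intro C_spaceI[of _ _ _ "\<lambda>_. K s"]) auto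
  next
    case False
    then obtain D where D: "\<forall>x\<in>{a..b}. D 0 x = s x"
      "\<forall>i<nat k. \<forall>x\<in>{a..b}. (D i has_real_derivative D (Suc i) x) (at x within {a..b})"
      "\<forall>i\<le>nat k. continuous_on {a..b} (D i)"
      using s by (auto simp: spline_space_def C_space_def)
    \<comment> \<open>The chain of derivatives of s, shifted by one to make room for
      \<open>K s\<close> in front; \<open>K0\<close> below supplies its first link.\<close>
    let ?E = "\<lambda>i. case i of 0 \<Rightarrow> K s | Suc i \<Rightarrow> D i"
    have n: "nat (k + 1) = Suc (nat k)" using k False by simp
    have K0: "(K s has_real_derivative D 0 x) (at x within {a..b})" if x: "x \<in> {a..b}" for x
    proof -
      have 1: "((\<lambda>x. integral {a..x} (D 0)) has_real_derivative D 0 x) (at x within {a..b})"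
        using D(3) x by (intro integral_has_real_derivative) auto
      have "integral {a..y} (D 0) = K s y" if "y \<in> {a..b}" for y
        unfolding Ks(2)[OF that] using D(1) that by (intro Henstock_Kurzweil_Integration.integral_cong) auto
      then show ?thesis
        using x by (intro has_field_derivative_transform_within[OF 1 zero_less_one]) auto
    qed
    have "\<forall>i<nat (k + 1). \<forall>x\<in>{a..b}. (?E i has_real_derivative ?E (Suc i) x) (at x within {a..b})"
      using D(2) K0 unfolding n by (auto simp: less_Suc_eq_0_disj)
    moreover have "\<forall>i\<le>nat (k + 1). continuous_on {a..b} (?E i)"
      using D(3) K_continuous[OF int] unfolding n by (auto split: nat.split)
    ultimately show ?thesis using k by (intro C_spaceI[of _ _ _ ?E]) auto
  qed
  then show ?thesis using pieces by (auto simp: spline_space_def)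
qed

end

section \<open>Error estimates\<close>

context open_interval
begin

lemma nrm_triangle:
  assumes "f \<in> L2" "g \<in> L2"
  shows "nrm (\<lambda>x. f x + g x) \<le> nrm f + nrm g"
proof (rule power2_le_imp_le)
  have "(nrm (\<lambda>x. f x + g x))\<^sup>2 = ip f f + 2 * ip f g + ip g g"
    using assms by (simp add: nrm_square ip_add_left ip_add_right L2_add ip_commute[of g f])
  also have "\<dots> \<le> (nrm f)\<^sup>2 + 2 * (nrm f * nrm g) + (nrm g)\<^sup>2"
    using ip_le[OF assms] by (simp add: nrm_square)
  also have "\<dots> = (nrm f + nrm g)\<^sup>2" by (simp add: power2_sum)
  finally show "(nrm (\<lambda>x. f x + g x))\<^sup>2 \<le> (nrm f + nrm g)\<^sup>2" .
qed (simp add: nrm_nonneg)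

lemma nrm_le_sup:
  assumes "f \<in> L2" "0 \<le> e" "\<And>x. a < x \<Longrightarrow> x < b \<Longrightarrow> \<bar>f x\<bar> \<le> e"
  shows "nrm f \<le> e * sqrt (b - a)"
proof (rule power2_le_imp_le)
  have m: "measure M {a<..<b} = b - a" using ab by (simp add: measure_restrict_space)
  have "(LINT x|M. (f x)\<^sup>2) \<le> (LINT x|M. e\<^sup>2)"
    using assms L2D(2)[OF assms(1)] by (intro integral_mono) (auto simp: abs_le_square_iff[symmetric])
  also have "\<dots> = (b - a) * e\<^sup>2" using m by simp
  also have "\<dots> = (e * sqrt (b - a))\<^sup>2" using ab by (simp add: power_mult_distrib)
  finally show "(nrm f)\<^sup>2 \<le> (e * sqrt (b - a))\<^sup>2"
    unfolding nrm_square L2_inner_def power2_eq_square[of "f _"] .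
qed (use assms ab in simp)

lemma weierstrass_poly:
  assumes "continuous_on {a..b} G" "e > 0"
  shows "\<exists>w. \<forall>x\<in>{a..b}. \<bar>G x - poly w x\<bar> < e"
proof -
  obtain g where g: "real_polynomial_function g" "\<And>x. x \<in> {a..b} \<Longrightarrow> \<bar>G x - g x\<bar> < e"
    using Stone_Weierstrass_real_polynomial_function[OF compact_Icc assms] by blast
  obtain c n where "g = (\<lambda>x. \<Sum>i\<le>n. c i * x ^ i)"
    using g(1) unfolding real_polynomial_function_iff_sum by blast
  then have "poly (\<Sum>i\<le>n. monom (c i) i) x = g x" for x
    by (simp add: poly_sum poly_monom)
  then show ?thesis using g(2) by (intro exI[of _ "\<Sum>i\<le>n. monom (c i) i"]) simp
qed

section \<open>Iterates of K\<close>

lemma K_AE: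
  assumes "integrable M f" "AE x in M. f x = g x" "x \<in> {a..b}"
  shows "K f x = K g x"
proof -
  obtain f' where f': "f' \<in> borel_measurable borel"
    "AE x in lebesgue. (if x \<in> {a<..<b} then f x else 0) = f' x"
    by (rule borel_representative[OF assms(1)])
  have "AE x in lebesgue. x \<in> {a<..<b} \<longrightarrow> f x = g x"
    using assms(2) by (subst (asm) AE_lebesgue_on_iff) auto
  then have "AE x in lebesgue. (if x \<in> {a<..<b} then g x else 0) = f' x"
    using f'(2) by eventually_elim auto
  then show ?thesis using K_eq_lborel[OF f' assms(3)] K_eq_lborel[OF f'(1) _ assms(3), of g] by simp
qed

lemma K_add:
  assumes "f \<in> L2" "g \<in> L2" "x \<in> {a..b}"
  shows "K (\<lambda>x. f x + g x) x = K f x + K g x"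
proof -
  have int: "f integrable_on {a..x}" if "f \<in> L2" for f
    by (rule integrable_subinterval_real[OF K_eq_integral(1)[OF L2_integrable[OF that] assms(3)]])
      (use assms(3) in auto)
  show ?thesis
    using assms int by (simp add: K_eq_integral(2) L2_integrable L2_add Henstock_Kurzweil_Integration.integral_add)
qed

lemma K_diff:
  assumes "f \<in> L2" "g \<in> L2" "x \<in> {a..b}"
  shows "K (\<lambda>x. f x - g x) x = K f x - K g x"
  using K_add[of "\<lambda>x. f x - g x" g x] assms by (simp add: L2_diff)

lemma L2_K_iter: "f \<in> L2 \<Longrightarrow> (K ^^ m) f \<in> L2"
  by (induction m) auto

lemma K_iter_AE:
  assumes "f \<in> L2" "AE x in M. f x = g x"
  shows "AE x in M. (K ^^ m) f x = (K ^^ m) g x"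
proof (induction m)
  case (Suc m)
  then have "K ((K ^^ m) f) x = K ((K ^^ m) g) x" if "x \<in> {a..b}" for x
    using that by (intro K_AE L2_integrable L2_K_iter assms(1))
  then show ?case by (intro AE_M_I) simp
qed (use assms in simp)

text \<open>U is kept together with its m-th derivative P because the spline approximation of U is
  measured by exactly that derivative.\<close>

lemma K_iter_poly:
  "\<exists>U. (pderiv ^^ m) U = P \<and> degree U \<le> degree P + m \<and> (\<forall>x\<in>{a..b}. (K ^^ m) (poly P) x = poly U x)"
proof (induction m)
  case (Suc m)
  then obtain U where U: "(pderiv ^^ m) U = P" "degree U \<le> degree P + m"
    "\<And>x. x \<in> {a..b} \<Longrightarrow> (K ^^ m) (poly P) x = poly U x" by blast
  obtain Q where Q: "pderiv Q = U" "poly Q a = 0" "degree Q \<le> Suc (degree U)"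
    using poly_antiderivative by blast
  have "(pderiv ^^ Suc m) Q = P" using U Q by (simp add: funpow_Suc_right del: funpow.simps)
  moreover have "(K ^^ Suc m) (poly P) x = poly Q x" if x: "x \<in> {a..b}" for x
  proof -
    have "K (poly U) x = K ((K ^^ m) (poly P)) x"
      using U(3) x by (intro K_AE L2_integrable L2_poly AE_M_I) auto
    then show ?thesis using K_poly[OF Q(1,2) x] by simp
  qed
  ultimately show ?case using Q U by (intro exI[of _ Q]) auto
qed (auto intro: exI[of _ P])

lemma ip_K_left:
  assumes "f \<in> L2" "w \<in> L2" "integral\<^sup>L M f = 0"
  shows "ip (K f) w = - ip f (K w)"
  using K_parts_integrable[OF assms(1,2)[THEN L2_integrable]] assms(3) by simp

text \<open>
  Integration by parts produces no boundary terms, since the means of \<open>g, K g, K (K g), \<dots>\<close> are up to sign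
  the inner products of \<open>g\<close> with \<open>1, K 1, K (K 1), \<dots>\<close>.
\<close>

lemma ip_K_iter_left:
  assumes g: "g \<in> L2" "\<And>P. degree P \<le> p \<Longrightarrow> ip g (poly P) = 0"
    and "m \<le> Suc p" "w \<in> L2"
  shows "ip ((K ^^ m) g) w = (-1) ^ m * ip g ((K ^^ m) w)"
  using assms(3,4)
proof (induction m arbitrary: w)
  case (Suc m)
  obtain U where U: "degree U \<le> m" "\<And>x. x \<in> {a..b} \<Longrightarrow> (K ^^ m) (poly [:1:]) x = poly U x"
    using K_iter_poly[of m "[:1:]"] by auto
  have "integral\<^sup>L M ((K ^^ m) g) = ip ((K ^^ m) g) (poly [:1:])" by (simp add: L2_inner_def)
  also have "\<dots> = (-1) ^ m * ip g ((K ^^ m) (poly [:1:]))" using Suc by simp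
  also have "ip g ((K ^^ m) (poly [:1:])) = ip g (poly U)"
    using U(2) by (intro ip_AE g L2_K_iter L2_poly AE_M_I) auto
  \<comment> \<open>U has degree at most m, and \<open>Suc m \<le> Suc p\<close> gives m \<le> p;
    this is why up to p + 1 integrations are allowed.\<close>
  also have "\<dots> = 0" using U(1) Suc.prems by (intro g(2)) simp
  finally have "ip (K ((K ^^ m) g)) w = - ip ((K ^^ m) g) (K w)"
    using Suc.prems by (intro ip_K_left L2_K_iter g) auto
  also have "\<dots> = - ((-1) ^ m * ip g ((K ^^ m) (K w)))" using Suc by (simp add: L2_K)
  finally show ?case by (simp add: funpow_swap1)
qed simp

text \<open>Taylor's formula at a with integral remainder, written as an n-fold K. The alternative P
  = 0 covers n = 0.\<close>

lemma sobolev_Taylor: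
  assumes "f \<in> sobolev a b n"
  shows "\<exists>P. (P = 0 \<or> degree P < n) \<and> (AE x in M. f x = poly P x + (K ^^ n) (weak_deriv a b n f) x)"
  using assms
proof (induction n arbitrary: f)
  case 0
  have "is_weak_deriv a b 0 f f" using sobolev_L2[OF 0] by (intro is_weak_deriv_0 L2_locally_integrable)
  from weak_deriv_AE[OF this] show ?case by (intro exI[of _ 0]) simp
next
  case (Suc n)
  let ?v = "weak_deriv a b 1 f" and ?D = "weak_deriv a b (Suc n) f"
  note v = sobolev_Suc[OF Suc.prems]
  have vL2: "?v \<in> L2" and wL2: "weak_deriv a b n ?v \<in> L2"
    using sobolev_L2[OF v(1)] sobolev_weak_deriv(2)[OF v(1)] .
  obtain P where P: "P = 0 \<or> degree P < n" "AE x in M. ?v x = poly P x + (K ^^ n) (weak_deriv a b n ?v) x"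
    using Suc.IH[OF v(1)] by blast
  obtain R where R: "pderiv R = P" "poly R a = 0" "degree R \<le> Suc (degree P)"
    using poly_antiderivative by blast
  have R': "R = 0 \<or> degree R < Suc n"
  proof (cases "P = 0")
    case True
    then have "degree R = 0" using R(1) by (simp add: pderiv_eq_0_iff)
    then show ?thesis by simp
  next
    case False
    then show ?thesis using P(1) R(3) by auto
  qed
  let ?c = "cont_rep a b f a"
  have "AE x in M. K ?v x = poly R x + (K ^^ Suc n) ?D x"
  proof -
    have "K ?v x = poly R x + K ((K ^^ n) (weak_deriv a b n ?v)) x" if x: "x \<in> {a..b}" for x
    proof -
      have "K ?v x = K (\<lambda>x. poly P x + (K ^^ n) (weak_deriv a b n ?v) x) x"
        using P(2) x by (intro K_AE L2_integrable vL2)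
      also have "\<dots> = poly R x + K ((K ^^ n) (weak_deriv a b n ?v)) x"
        using K_add[OF L2_poly L2_K_iter[OF wL2] x] K_poly[OF R(1,2) x] by simp
      finally show ?thesis .
    qed
    then have "AE x in M. K ?v x = poly R x + (K ^^ Suc n) (weak_deriv a b n ?v) x" by (intro AE_M_I) simp
    with K_iter_AE[OF wL2 v(3), of "Suc n"] show ?thesis by eventually_elim simp
  qed
  with v(2) have "AE x in M. f x = poly ([:?c:] + R) x + (K ^^ Suc n) ?D x" by eventually_elim simp
  moreover have "degree ([:?c:] + R) < Suc n" using R' by (intro degree_add_less) auto
  ultimately show ?case by blast
qed

end

section \<open>Recursion for the constants\<close>

lemma spline_const_0: "-1 \<le> k \<Longrightarrow> spline_const p k 0 = 1"
  by (simp add: spline_const_def)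

text \<open>Degree minus smoothness is the same throughout, hence so is t: one more integration
  costs one more factor t/2, and the factorial quotient is unchanged. For k = p all constants are
  powers of 1/pi.\<close>

lemma spline_const_Suc:
  assumes "0 \<le> k" "k \<le> int p"
  shows "spline_const (Suc p) k (Suc m) = spline_const p (k - 1) m * spline_const p (k - 1) 1"
proof (cases "k = int p")
  case True
  then show ?thesis by (simp add: spline_const_def)
next
  case False
  define t where "t = 1 / sqrt (real_of_int ((int p - (k - 1)) * (int p - (k - 1) + 1)))"
  have t: "t = 1 / sqrt (real_of_int ((int (Suc p) - k) * (int (Suc p) - k + 1)))"
    by (simp add: t_def algebra_simps)
  have one: "spline_const p (k - 1) 1 = (1 / 2) * t"
    using assms False by (simp add: spline_const_def t_def)
  show ?thesis
  proof (cases "int m - 2 \<le> k - 1")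
    case True
    then have "spline_const p (k - 1) m = (1 / 2) ^ m * t ^ m"
      using False by (simp add: spline_const_def t_def)
    moreover have "spline_const (Suc p) k (Suc m) = (1 / 2) ^ Suc m * t ^ Suc m"
      using False True unfolding spline_const_def t[symmetric] Let_def by simp
    ultimately show ?thesis unfolding one by simp
  next
    case small: False
    define F where "F = sqrt (fact (p + 1 - m) / fact (nat (int p + int m + 1 - 2 * k)) :: real)"
    have "spline_const p (k - 1) m = (1 / 2) ^ m * (t ^ nat k * F)"
    proof -
      have "int p - 1 + int m - 2 * (k - 1) = int p + int m + 1 - 2 * k"
        "k - 1 + 1 = k" "k - 1 \<noteq> int p - 1"
        using False by auto
      then show ?thesis using small unfolding spline_const_def t_def[symmetric] Let_def F_def
        by (simp only: if_False)
    qed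
    moreover have "spline_const (Suc p) k (Suc m) = (1 / 2) ^ Suc m * (t ^ nat (k + 1) * F)"
    proof -
      have "int (Suc p) - 1 + int (Suc m) - 2 * k = int p + int m + 1 - 2 * k"
        "Suc p + 1 - Suc m = p + 1 - m" "\<not> int (Suc m) - 2 \<le> k" "k \<noteq> int (Suc p) - 1"
        using False small by auto
      then show ?thesis unfolding spline_const_def t[symmetric] Let_def F_def by (simp only: if_False)
    qed
    moreover have "nat (k + 1) = Suc (nat k)" using assms by simp
    ultimately show ?thesis unfolding one by simp
  qed
qed

context knots
begin

section \<open>Estimates for functions orthogonal to splines\<close>

lemma integral_piecewise:
  assumes f: "\<And>j x. j \<le> N \<Longrightarrow> x \<in> I j \<Longrightarrow> f x = poly (q j) x"
  shows "integral\<^sup>L M f = (\<Sum>j\<le>N. poly_int (\<xi> j) (\<xi> (Suc j)) (q j))"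
proof -
  have "(f has_integral (\<Sum>j<n. poly_int (\<xi> j) (\<xi> (Suc j)) (q j))) {a..\<xi> n}" if "n \<le> Suc N" for n
    using that
  proof (induction n)
    case 0
    then show ?case by (simp add: knot_ends has_integral_refl)
  next
    case (Suc n)
    have "(poly (q n) has_integral poly_int (\<xi> n) (\<xi> (Suc n)) (q n)) {\<xi> n..\<xi> (Suc n)}"
      unfolding poly_int_def by (rule integrable_integral[OF poly_integrable])
    moreover have "f x = poly (q n) x" if "x \<in> {\<xi> n..\<xi> (Suc n)} - {\<xi> (Suc n)}" for x
      using that Suc.prems by (intro f) (auto simp: knot_interval_def)
    ultimately have "(f has_integral poly_int (\<xi> n) (\<xi> (Suc n)) (q n)) {\<xi> n..\<xi> (Suc n)}"
      by (intro has_integral_spike_finite[of "{\<xi> (Suc n)}" _ f "poly (q n)"]) auto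
    then show ?case
      using Suc knot_bounds[of n] knot_step[of n]
      by (auto intro!: has_integral_combine[of a "\<xi> n" "\<xi> (Suc n)"])
  qed
  from this[of "Suc N"] have "(f has_integral (\<Sum>j\<le>N. poly_int (\<xi> j) (\<xi> (Suc j)) (q j))) {a..b}"
    by (simp add: knot_ends lessThan_Suc_atMost)
  then show ?thesis
    using integral_lebesgue_on_Icc(2)[OF L2_integrable[OF L2_piecewise[OF f]]] by (simp add: integral_unique)
qed

text \<open>The squared L^2 norm is additive over the knot intervals, so the local estimates can be
  summed once each length is replaced by h.\<close>

lemma piecewise_poly_approximation:
  assumes "m \<le> Suc p"
  obtains s where "s \<in> S p (-1)"
    "nrm (\<lambda>x. poly U x - s x) \<le> spline_const p (-1) m * h ^ m * nrm (poly ((pderiv ^^ m) U))"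
proof -
  let ?w = "(pderiv ^^ m) U" and ?c = "spline_const p (-1) m"
  have "\<forall>j\<in>{0..N}. \<exists>z. degree z \<le> p \<and> poly_int (\<xi> j) (\<xi> (Suc j)) ((U - z) * (U - z))
     \<le> (?c * (\<xi> (Suc j) - \<xi> j) ^ m)\<^sup>2 * poly_int (\<xi> j) (\<xi> (Suc j)) (?w * ?w)"
    using poly_approximation[OF knot_step assms] by simp
  from bchoice[OF this] obtain z where z: "\<forall>j\<in>{0..N}. degree (z j) \<le> p \<and>
      poly_int (\<xi> j) (\<xi> (Suc j)) ((U - z j) * (U - z j))
        \<le> (?c * (\<xi> (Suc j) - \<xi> j) ^ m)\<^sup>2 * poly_int (\<xi> j) (\<xi> (Suc j)) (?w * ?w)" by blast
  have s: "piecewise z \<in> S p (-1)" using z by (intro piecewise_in_spline_space) simp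
  have "(nrm (\<lambda>x. poly U x - piecewise z x))\<^sup>2
      = (\<Sum>j\<le>N. poly_int (\<xi> j) (\<xi> (Suc j)) ((U - z j) * (U - z j)))"
    unfolding nrm_square L2_inner_def by (rule integral_piecewise) (simp add: piecewise_eq)
  also have "\<dots> \<le> (\<Sum>j\<le>N. (?c * h ^ m)\<^sup>2 * poly_int (\<xi> j) (\<xi> (Suc j)) (?w * ?w))"
  proof (rule sum_mono)
    fix j assume "j \<in> {..N}"
    then have j: "j \<le> N" by simp
    have "(?c * (\<xi> (Suc j) - \<xi> j) ^ m)\<^sup>2 \<le> (?c * h ^ m)\<^sup>2"
      using knot_step[OF j] mesh_step[OF j]
      by (intro power_mono mult_left_mono mult_nonneg_nonneg spline_const_nonneg) auto
    then have "(?c * (\<xi> (Suc j) - \<xi> j) ^ m)\<^sup>2 * poly_int (\<xi> j) (\<xi> (Suc j)) (?w * ?w)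
        \<le> (?c * h ^ m)\<^sup>2 * poly_int (\<xi> j) (\<xi> (Suc j)) (?w * ?w)"
      by (intro mult_right_mono poly_int_square_nonneg)
    then show "poly_int (\<xi> j) (\<xi> (Suc j)) ((U - z j) * (U - z j))
        \<le> (?c * h ^ m)\<^sup>2 * poly_int (\<xi> j) (\<xi> (Suc j)) (?w * ?w)"
      using z j by (meson atLeastAtMost_iff le0 order_trans)
  qed
  also have "\<dots> = (?c * h ^ m)\<^sup>2 * (nrm (poly ?w))\<^sup>2"
  proof -
    have "(nrm (poly ?w))\<^sup>2 = (\<Sum>j\<le>N. poly_int (\<xi> j) (\<xi> (Suc j)) (?w * ?w))"
      unfolding nrm_square L2_inner_def by (rule integral_piecewise) simp
    then show ?thesis by (simp add: sum_distrib_left)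
  qed
  finally have "(nrm (\<lambda>x. poly U x - piecewise z x))\<^sup>2 \<le> (?c * h ^ m * nrm (poly ?w))\<^sup>2"
    by (simp add: power_mult_distrib)
  then have "nrm (\<lambda>x. poly U x - piecewise z x) \<le> ?c * h ^ m * nrm (poly ?w)"
    by (rule power2_le_imp_le) (intro mult_nonneg_nonneg spline_const_nonneg zero_le_power mesh_nonneg nrm_nonneg)
  then show ?thesis using s that by blast
qed

text \<open>
  Testing \<open>K\<^sup>m g\<close> against a polynomial moves \<open>K\<^sup>m\<close> to the polynomial, so only polynomials have to be
  approximated by splines; continuity of \<open>K\<^sup>m g\<close> makes it a uniform limit of such test functions.
\<close>

lemma discontinuous_estimate:
  assumes g: "g \<in> L2" "\<And>s. s \<in> S p (-1) \<Longrightarrow> ip g s = 0" and m: "m \<le> Suc p"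
  shows "nrm ((K ^^ m) g) \<le> spline_const p (-1) m * h ^ m * nrm g"
\<comment> \<open>The case m = 0 is separate because g itself need not be continuous; uniform
  approximation requires at least one integration.\<close>
proof (cases m)
  case 0
  then show ?thesis by (simp add: spline_const_0)
next
  case (Suc m')
  let ?G = "(K ^^ m) g"
  define C where "C = spline_const p (-1) m * h ^ m"
  have C: "C \<ge> 0" unfolding C_def by (intro mult_nonneg_nonneg spline_const_nonneg zero_le_power mesh_nonneg)
  have GL2: "?G \<in> L2" using g by (intro L2_K_iter)
  have polys: "ip g (poly P) = 0" if "degree P \<le> p" for P
    using g(2) poly_in_spline_space[OF that] .
  have test: "ip ?G (poly w) \<le> C * nrm g * nrm (poly w)" for w
  proof -
    obtain U where U: "(pderiv ^^ m) U = w" "\<And>x. x \<in> {a..b} \<Longrightarrow> (K ^^ m) (poly w) x = poly U x"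
      using K_iter_poly[of m w] by blast
    obtain s where s: "s \<in> S p (-1)" "nrm (\<lambda>x. poly U x - s x) \<le> C * nrm (poly w)"
      using piecewise_poly_approximation[OF m, of U] unfolding C_def U(1) by blast
    have sL2: "s \<in> L2" using s(1) by (rule L2_spline)
    have "\<bar>ip ?G (poly w)\<bar> = \<bar>ip g ((K ^^ m) (poly w))\<bar>"
      using ip_K_iter_left[OF g(1) polys m L2_poly, of w] by (simp add: abs_mult)
    also have "ip g ((K ^^ m) (poly w)) = ip g (poly U)"
      using U(2) by (intro ip_AE g L2_K_iter L2_poly AE_M_I) auto
    \<comment> \<open>Orthogonality of g allows any spline to be subtracted, so U is replaced by its
      approximation error.\<close>
    also have "\<dots> = ip g (\<lambda>x. poly U x - s x)"
      using ip_diff_right[OF g(1) L2_poly sL2] g(2)[OF s(1)] by simp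
    also have "\<bar>\<dots>\<bar> \<le> nrm g * nrm (\<lambda>x. poly U x - s x)"
      using g sL2 by (intro ip_Cauchy_Schwarz L2_diff L2_poly)
    also have "\<dots> \<le> nrm g * (C * nrm (poly w))" using s(2) by (intro mult_left_mono nrm_nonneg)
    finally show ?thesis by (simp add: mult_ac)
  qed
  have "nrm ?G * nrm ?G \<le> C * nrm g * nrm ?G + e" if e: "e > 0" for e
  proof -
    \<comment> \<open>B - 1 is the total coefficient of e / B in the error below; the added 1 makes
      B positive.\<close>
    define B where "B = (nrm ?G + C * nrm g) * sqrt (b - a) + 1"
    have B: "B > 0" unfolding B_def using C ab
      by (intro add_nonneg_pos mult_nonneg_nonneg add_nonneg_nonneg nrm_nonneg) auto
    have "continuous_on {a..b} ?G"
      using K_continuous[OF L2_integrable[OF L2_K_iter[OF g(1)]]] by (simp add: Suc)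
    then obtain w where w: "\<forall>x\<in>{a..b}. \<bar>?G x - poly w x\<bar> < e / B"
      using weierstrass_poly[of ?G "e / B"] e B by auto
    have small: "nrm (\<lambda>x. ?G x - poly w x) \<le> e / B * sqrt (b - a)"
      using e B w by (intro nrm_le_sup L2_diff GL2 L2_poly) (auto intro: less_imp_le)
    have small': "nrm (\<lambda>x. poly w x - ?G x) = nrm (\<lambda>x. ?G x - poly w x)"
      unfolding L2_norm_def L2_inner_def by (simp add: algebra_simps)
    have w_le: "nrm (poly w) \<le> nrm ?G + e / B * sqrt (b - a)"
      using nrm_triangle[OF GL2 L2_diff[OF L2_poly GL2], of w] small small' by simp
    have "nrm ?G * nrm ?G = ip ?G (\<lambda>x. ?G x - poly w x) + ip ?G (poly w)"
      using nrm_square[of ?G] ip_diff_right[OF GL2 GL2 L2_poly, of w] by (simp add: power2_eq_square)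
    also have "\<dots> \<le> nrm ?G * (e / B * sqrt (b - a)) + C * nrm g * (nrm ?G + e / B * sqrt (b - a))"
    proof (rule add_mono)
      show "ip ?G (\<lambda>x. ?G x - poly w x) \<le> nrm ?G * (e / B * sqrt (b - a))"
        by (rule order_trans[OF ip_le[OF GL2 L2_diff[OF GL2 L2_poly]] mult_left_mono[OF small nrm_nonneg]])
      show "ip ?G (poly w) \<le> C * nrm g * (nrm ?G + e / B * sqrt (b - a))"
        using C by (intro order_trans[OF test mult_left_mono[OF w_le]] mult_nonneg_nonneg nrm_nonneg)
    qed
    also have "\<dots> = C * nrm g * nrm ?G + e / B * ((nrm ?G + C * nrm g) * sqrt (b - a))"
      by (simp only: distrib_left distrib_right) (simp only: mult_ac add_ac)
    also have "\<dots> = C * nrm g * nrm ?G + e / B * (B - 1)" by (simp add: B_def)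
    also have "\<dots> \<le> C * nrm g * nrm ?G + e" using e B by (simp add: field_simps)
    finally show ?thesis .
  qed
  then have "nrm ?G * nrm ?G \<le> C * nrm g * nrm ?G" by (rule field_le_epsilon)
  then have "nrm ?G \<le> C * nrm g"
    using nrm_nonneg[of ?G] C nrm_nonneg[of g] by (cases "nrm ?G = 0") auto
  then show ?thesis by (simp add: C_def)
qed

text \<open>n stands for k + 1, so that the induction over smoothness runs over the natural numbers.
  The induction hypothesis is used twice on K g: with one integration, to bound K g by g, and with m
  - 1 integrations.\<close>

lemma dual_estimate:
  assumes "int n \<le> int p" "g \<in> L2" "\<And>s. s \<in> S p (int n - 1) \<Longrightarrow> ip g s = 0" "m \<le> Suc p"
  shows "nrm ((K ^^ m) g) \<le> spline_const p (int n - 1) m * h ^ m * nrm g"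
  using assms
proof (induction n arbitrary: p g m)
  case 0
  then show ?case using discontinuous_estimate[of g p m] by simp
next
  case (Suc n)
  show ?case
  proof (cases m)
    case 0
    then show ?thesis by (simp add: spline_const_0)
  next
    case m: (Suc m')
    obtain p' where p: "p = Suc p'" using Suc.prems(1) by (cases p) auto
    note g = Suc.prems(2)
    \<comment> \<open>Constants are splines, so g has mean zero and integration by parts leaves no
      boundary term.\<close>
    have "poly [:1:] \<in> S p (int (Suc n) - 1)" by (rule poly_in_spline_space) simp
    from Suc.prems(3)[OF this] have mean: "integral\<^sup>L M g = 0" by (simp add: L2_inner_def)
    have Kg: "ip (K g) s = 0" if s: "s \<in> S p' (int n - 1)" for s
    proof -
      have "K s \<in> S p (int (Suc n) - 1)" using K_spline[OF s] unfolding p by simp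
      then show ?thesis using ip_K_left[OF g L2_spline[OF s] mean] Suc.prems(3) by simp
    qed
    have IH: "nrm ((K ^^ j) (K g)) \<le> spline_const p' (int n - 1) j * h ^ j * nrm (K g)" if "j \<le> Suc p'" for j
      using Suc.prems(1) Kg that g unfolding p by (intro Suc.IH L2_K) auto
    let ?C = "spline_const p' (int n - 1) 1 * h"
    have C: "0 \<le> ?C" by (intro mult_nonneg_nonneg spline_const_nonneg mesh_nonneg)
    \<comment> \<open>Moving one K to the other side leaves K (K g), which the induction hypothesis
      bounds by K g; dividing by the norm of K g gives \<open>step\<close>.\<close>
    have "nrm (K g) * nrm (K g) = - ip g (K (K g))"
      using nrm_square[of "K g"] ip_K_left[OF g L2_K[OF g] mean] by (simp add: power2_eq_square)
    also have "\<dots> \<le> nrm g * nrm (K (K g))"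
      using ip_Cauchy_Schwarz[OF g L2_K[OF L2_K[OF g]]] by simp
    also have "\<dots> \<le> nrm g * (?C * nrm (K g))"
      using IH[of 1] by (intro mult_left_mono nrm_nonneg) simp
    finally have "nrm (K g) * nrm (K g) \<le> (?C * nrm g) * nrm (K g)" by (simp add: mult_ac)
    then have step: "nrm (K g) \<le> ?C * nrm g"
      using nrm_nonneg[of "K g"] C nrm_nonneg[of g] by (cases "nrm (K g) = 0") auto
    have "nrm ((K ^^ m) g) \<le> spline_const p' (int n - 1) m' * h ^ m' * nrm (K g)"
      using IH[of m'] Suc.prems(4) unfolding m p by (simp add: funpow_swap1)
    also have "\<dots> \<le> spline_const p' (int n - 1) m' * h ^ m' * (?C * nrm g)"
      by (intro mult_left_mono step mult_nonneg_nonneg spline_const_nonneg zero_le_power mesh_nonneg)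
    also have "\<dots> = spline_const p (int (Suc n) - 1) m * h ^ m * nrm g"
      using spline_const_Suc[of "int n" p' m'] Suc.prems(1) unfolding m p by (simp add: mult_ac)
    finally show ?thesis .
  qed
qed

lemma spline_estimate:
  assumes "-1 \<le> k" "k \<le> int p - 1" "g \<in> L2" "\<And>s. s \<in> S p k \<Longrightarrow> ip g s = 0" "m \<le> Suc p"
  shows "nrm ((K ^^ m) g) \<le> spline_const p k m * h ^ m * nrm g"
  using dual_estimate[where n = "nat (k + 1)" and p = p and g = g and m = m] assms by simp

lemma spline_proj_estimate:
  assumes k: "-1 \<le> k" "k \<le> int p - 1" and f: "f \<in> sobolev a b n" and n: "n \<le> Suc p"
  defines "g \<equiv> \<lambda>x. f x - spline_proj a b N \<xi> p k f x"
  shows "g \<in> L2" "\<And>s. s \<in> S p k \<Longrightarrow> ip g s = 0"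
    "nrm g \<le> spline_const p k n * h ^ n * nrm (weak_deriv a b n f)"
proof -
  let ?s = "spline_proj a b N \<xi> p k f" and ?v = "weak_deriv a b n f"
  have fL2: "f \<in> L2" using f by (rule sobolev_L2)
  note s = spline_proj[OF fL2, where p = p and k = k]
  have sL2: "?s \<in> L2" using s(1) by (rule L2_spline)
  show g: "g \<in> L2" unfolding g_def using fL2 sL2 by (rule L2_diff)
  show orth: "\<And>s. s \<in> S p k \<Longrightarrow> ip g s = 0" unfolding g_def by (rule s(2))
  have vL2: "?v \<in> L2" using f by (rule sobolev_weak_deriv)
  obtain P where P: "P = 0 \<or> degree P < n" "AE x in M. f x = poly P x + (K ^^ n) ?v x"
    using sobolev_Taylor[OF f] by blast
  have polys: "ip g (poly R) = 0" if "degree R \<le> p" for R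
    using orth poly_in_spline_space[OF that] .
  \<comment> \<open>The Taylor polynomial has degree below n \<le> p + 1, so it is a spline and
    orthogonal to g: only the remainder contributes.\<close>
  have "degree P \<le> p" using P(1) n by auto
  have "nrm g * nrm g = ip g f - ip g ?s"
    using nrm_square[of g] ip_diff_right[OF g fL2 sL2] by (simp add: power2_eq_square g_def)
  also have "\<dots> = ip g f" using orth[OF s(1)] by simp
  also have "\<dots> = ip g (\<lambda>x. poly P x + (K ^^ n) ?v x)"
    using P(2) by (intro ip_AE g fL2) auto
  also have "\<dots> = ip g ((K ^^ n) ?v)"
    using ip_add_right[OF g L2_poly L2_K_iter[OF vL2]] polys[OF \<open>degree P \<le> p\<close>] by simp
  also have "\<dots> \<le> \<bar>ip ((K ^^ n) g) ?v\<bar>"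
    using ip_K_iter_left[OF g polys n vL2] by (simp add: abs_mult)
  also have "\<dots> \<le> nrm ((K ^^ n) g) * nrm ?v" by (intro ip_Cauchy_Schwarz L2_K_iter g vL2)
  also have "\<dots> \<le> (spline_const p k n * h ^ n * nrm g) * nrm ?v"
    using spline_estimate[OF k g orth n] by (intro mult_right_mono nrm_nonneg)
  finally have *: "nrm g * nrm g \<le> (spline_const p k n * h ^ n * nrm ?v) * nrm g" by (simp add: mult_ac)
  show "nrm g \<le> spline_const p k n * h ^ n * nrm ?v"
  proof (cases "nrm g = 0")
    case True
    then show ?thesis by (simp add: mult_nonneg_nonneg spline_const_nonneg mesh_nonneg nrm_nonneg)
  next
    case False
    then show ?thesis using * nrm_nonneg[of g] by simp
  qed
qed

text \<open>f plays the role of the q-th derivative of u, reached by q single derivatives as in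
  \<open>Q_proj\<close>. As each \<open>weak_deriv\<close> is a separate choice, its highest
  derivative is identified with that of u almost everywhere only.\<close>

lemma Q_proj_error:
  assumes "u \<in> sobolev a b r" "q \<le> r" "int q \<le> k + 1" "k \<le> int p - 1"
  shows "\<exists>f. f \<in> sobolev a b (r - q) \<and>
     (AE x in M. weak_deriv a b (r - q) f x = weak_deriv a b r u x) \<and>
     (\<forall>l\<le>q. is_weak_deriv a b l (\<lambda>x. u x - Q_proj a b N \<xi> q p k u x)
        ((K ^^ (q - l)) (\<lambda>x. f x - spline_proj a b N \<xi> (p - q) (k - int q) f x)))"
  using assms
proof (induction q arbitrary: u r p k)
  case 0
  have "(\<lambda>x. u x - spline_proj a b N \<xi> p k u x) \<in> L2"
    using sobolev_L2[OF 0(1)] spline_proj(1) L2_spline by blast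
  then show ?case using 0 is_weak_deriv_0[OF L2_locally_integrable] by auto
next
  case (Suc q)
  obtain r' where r: "r = Suc r'" using Suc.prems(2) by (cases r) auto
  let ?v = "weak_deriv a b 1 u" and ?c = "cont_rep a b u a"
  note v = sobolev_Suc[OF Suc.prems(1)[unfolded r]]
  define Qv where "Qv = Q_proj a b N \<xi> q (p - 1) (k - 1) ?v"
  have k: "k - 1 \<le> int (p - 1) - 1" using Suc.prems by simp
  have pk: "p - 1 - q = p - Suc q" "k - 1 - int q = k - int (Suc q)" by simp_all
  obtain f where f: "f \<in> sobolev a b (r' - q)"
    "AE x in M. weak_deriv a b (r' - q) f x = weak_deriv a b r' ?v x"
    and IH: "\<forall>l\<le>q. is_weak_deriv a b l (\<lambda>x. ?v x - Qv x)
        ((K ^^ (q - l)) (\<lambda>x. f x - spline_proj a b N \<xi> (p - Suc q) (k - int (Suc q)) f x))"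
    using Suc.IH[OF v(1) _ _ k] Suc.prems unfolding r Qv_def pk by auto
  define g where "g = (\<lambda>x. f x - spline_proj a b N \<xi> (p - Suc q) (k - int (Suc q)) f x)"
  have gL2: "g \<in> L2" unfolding g_def using sobolev_L2[OF f(1)] spline_proj(1) L2_spline by blast
  have e0: "is_weak_deriv a b 0 (\<lambda>x. ?v x - Qv x) ((K ^^ q) g)"
    using IH[rule_format, of 0] unfolding g_def by simp
  have "is_weak_deriv a b 0 (\<lambda>x. ?v x - Qv x) (\<lambda>x. ?v x - Qv x)"
    using e0 by (intro is_weak_deriv_0) (simp add: is_weak_deriv_def)
  \<comment> \<open>A weak derivative of order 0 is the function itself almost everywhere, so l = 0
    recovers the error of the level below.\<close>
  then have eae: "AE x in M. (K ^^ q) g x = ?v x - Qv x" using e0 is_weak_deriv_unique by blast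
  have vL2: "?v \<in> L2" using v(1) by (rule sobolev_L2)
  have eL2: "(\<lambda>x. ?v x - Qv x) \<in> L2" using L2_K_iter[OF gL2] eae by (rule L2_AE)
  have QvL2: "Qv \<in> L2" using L2_diff[OF vL2 eL2] by simp
  \<comment> \<open>The constants u(a) cancel, so the error is K applied to the error for the
    derivative of u; the 0 is the constant that \<open>is_weak_deriv_K\<close> expects.\<close>
  have err: "AE x in M. u x - Q_proj a b N \<xi> (Suc q) p k u x = 0 + K (\<lambda>x. ?v x - Qv x) x"
  proof -
    have "AE x in M. K (\<lambda>x. ?v x - Qv x) x = K ?v x - K Qv x"
      by (intro AE_M_I K_diff vL2 QvL2) auto
    with v(2) show ?thesis by eventually_elim (simp add: Qv_def)
  qed
  have "is_weak_deriv a b l (\<lambda>x. u x - Q_proj a b N \<xi> (Suc q) p k u x) ((K ^^ (Suc q - l)) g)"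
    if l: "l \<le> Suc q" for l
  proof (cases l)
    case 0
    have "AE x in M. K ((K ^^ q) g) x = K (\<lambda>x. ?v x - Qv x) x"
      by (rule AE_M_I, rule K_AE[OF L2_integrable[OF L2_K_iter[OF gL2]] eae]) auto
    with err have ae: "AE x in M. K ((K ^^ q) g) x = u x - Q_proj a b N \<xi> (Suc q) p k u x"
      by eventually_elim simp
    have wd: "is_weak_deriv a b 0 (K ((K ^^ q) g)) (K ((K ^^ q) g))"
      by (intro is_weak_deriv_0 L2_locally_integrable L2_K L2_K_iter gL2)
    have "is_weak_deriv a b 0 (\<lambda>x. u x - Q_proj a b N \<xi> (Suc q) p k u x) (K ((K ^^ q) g))"
      by (rule is_weak_deriv_AE[OF wd ae]) (rule AE_I2, rule refl)
    then show ?thesis using 0 by simp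
  next
    case (Suc l')
    then have "is_weak_deriv a b l' (\<lambda>x. ?v x - Qv x) ((K ^^ (q - l')) g)"
      using IH l unfolding g_def by simp
    from is_weak_deriv_K[OF eL2 err this] show ?thesis using Suc by simp
  qed
  moreover have "AE x in M. weak_deriv a b (r - Suc q) f x = weak_deriv a b r u x"
    using f(2) v(3) unfolding r by eventually_elim simp
  ultimately show ?case using f(1) unfolding g_def r by (intro exI[of _ f]) auto
qed

end

theorem theorem3:
  fixes a b :: real and r p q l N :: nat and k :: int
    and u :: "real \<Rightarrow> real" and \<xi> :: "nat \<Rightarrow> real"
  assumes "a < b"
    and "u \<in> sobolev a b r"
    and "knot_seq a b N \<xi>"
    and "-1 \<le> k" and "k \<le> int p - 1"
    and "int q \<le> min (k + 1) (int r)"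
    and "l \<le> q"
    and "int p \<ge> max (int r - 1) (2 * int q - int l - 1)"
  shows "L2_norm a b (weak_deriv a b l (\<lambda>x. u x - Q_proj a b N \<xi> q p k u x))
         \<le> spline_const (p - q) (k - int q) (q - l) * spline_const (p - q) (k - int q) (r - q)
            * mesh_size N \<xi> ^ (r - l) * L2_norm a b (weak_deriv a b r u)"
proof -
  interpret knots a b N \<xi> by standard (fact assms)+
  have q: "q \<le> r" "int q \<le> k + 1" using assms(6) by auto
  obtain f where f: "f \<in> sobolev a b (r - q)"
    "AE x in M. weak_deriv a b (r - q) f x = weak_deriv a b r u x"
    and err: "\<forall>l\<le>q. is_weak_deriv a b l (\<lambda>x. u x - Q_proj a b N \<xi> q p k u x)
        ((K ^^ (q - l)) (\<lambda>x. f x - spline_proj a b N \<xi> (p - q) (k - int q) f x))"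
    using Q_proj_error[OF assms(2) q assms(5)] by blast
  have k': "-1 \<le> k - int q" "k - int q \<le> int (p - q) - 1" using q assms(5) by auto
  \<comment> \<open>p \<ge> r - 1 yields the first bound and p \<ge> 2q - l - 1 the second; p - q is
    not truncated because q \<le> k + 1 \<le> p.\<close>
  have deg: "r - q \<le> Suc (p - q)" "q - l \<le> Suc (p - q)" using assms q by auto
  define g where "g = (\<lambda>x. f x - spline_proj a b N \<xi> (p - q) (k - int q) f x)"
  note g = spline_proj_estimate[OF k' f(1) deg(1), folded g_def]
  let ?c1 = "spline_const (p - q) (k - int q) (q - l)" and ?c2 = "spline_const (p - q) (k - int q) (r - q)"
  have "nrm (weak_deriv a b l (\<lambda>x. u x - Q_proj a b N \<xi> q p k u x)) = nrm ((K ^^ (q - l)) g)"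
    using err assms(7) g(1) weak_deriv_AE unfolding g_def by (intro nrm_AE[symmetric] L2_K_iter) auto
  also have "\<dots> \<le> ?c1 * h ^ (q - l) * nrm g"
    by (rule spline_estimate[OF k' g(1,2) deg(2)])
  also have "\<dots> \<le> ?c1 * h ^ (q - l) * (?c2 * h ^ (r - q) * nrm (weak_deriv a b (r - q) f))"
    by (intro mult_left_mono g(3) mult_nonneg_nonneg spline_const_nonneg zero_le_power mesh_nonneg)
  also have "nrm (weak_deriv a b (r - q) f) = nrm (weak_deriv a b r u)"
    using f(2) by (intro nrm_AE sobolev_weak_deriv(2)[OF f(1)])
  also have "?c1 * h ^ (q - l) * (?c2 * h ^ (r - q) * nrm (weak_deriv a b r u))
      = ?c1 * ?c2 * h ^ ((q - l) + (r - q)) * nrm (weak_deriv a b r u)"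
    by (simp add: power_add)
  also have "(q - l) + (r - q) = r - l" using assms(7) q(1) by simp
  finally show ?thesis .
qed

end
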